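(* (a) Let $F$ be a field of characteristic two and let $Q\ge 2$ be a power of $2$. If $M$ is a special $Q$-matrix with entries in $F$, then the $(Q+2)\times Q$ matrix $\begin{pmatrix} M\\ B(Q)\\ C(Q)\end{pmatrix}$ has rank $Q$. (b) Consequently, for every non-zero $\alpha$ in the algebraic closure $L$ of $\mathbb{Z}/(2)$, with $m$, $Q=2^{m-1}$, $q=4Q$, $g$, $\mathcal{O}$, $v$, $X$, $Y$ attached to $\alpha$ as in the context: the map $X\to Y\oplus \mathcal{O}_{12Q-3}$, $u\mapsto (ug,uv)$, is one to one; $v\notin g\mathcal{O}$; and, with $f=y^3z^3$, the element $(xy)f^Q$ is not in the ideal $(x^{4Q},y^{4Q},z^{4Q},g)$ of $L[x,y,z]$.
   Context: Special matrices. For a power $Q\ge2$ of $2$ and a field $F$ of characteristic two, a matrix $M=(m_{i,j})$, $0\le i,j<Q$, with entries in $F$ is a special $Q$-matrix if: (1) $m_{i,j}=0$ whenever $i=j$ or $i\not\equiv j \pmod 3$; (2) if $i\equiv j\pmod 3$ and $i\ne j$, then $m_{i,j}\ne0$, and $m_{i,j}$ depends only on the integer $\operatorname{ord}_2(i-j)$. $C(Q)$ is the row vector of length $Q$ with all entries $1$; $B(Q)=(b_0,\dots,b_{Q-1})$ with $b_i=1$ if $i\equiv 2Q-1\pmod 3$ and $b_i=0$ otherwise. Data attached to $\alpha$. Let $\alpha\in L$, $\alpha\neq0$. Choose $\beta\in L$ with $\alpha=\beta^2+\beta$; $m$ is the degree of $\beta$ over $\mathbb{Z}/(2)$ (equivalently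 the smallest $k\ge1$ with $\sum_{\ell=0}^{k-1}\alpha^{2^\ell}=0$). $Q=2^{m-1}$, $q=4Q$. $P=z^4+xyz^2+x^3z+y^3z$, $g=P+\alpha x^2y^2$. $\mathcal{O}=L[x,y,z]/(x^q,y^q,z^q)$, graded, with $\mathcal{O}_n$ its degree $n$ part; polynomials also denote their images in $\mathcal{O}$. $v\in\mathcal{O}_{6Q+2}$ is the class of $(xy)(yz)^{3Q}$. $R=\sum x^iy^jz^k\in\mathcal O$, the sum over all triples of nonnegative integers $(i,j,k)$ with $k=1$ or $2$, $i+j+k=q$, $i\equiv j\pmod 3$. $W\subseteq\mathcal{O}_{6Q-5}$ is spanned by the $x^iy^jP^k$ with $i+j+4k=6Q-5$, $k\le Q-1$; $W_0\subseteq W$ is spanned by those with $k<Q-1$. $D\subseteq\mathcal{O}_{6Q-1}$ is spanned by the $x^iy^jR$ with $i+j=2Q-1$. $W'\subseteq\mathcal{O}_{6Q-1}$ is spanned by $D$ together with the $x^iy^jP^k$ with $i+j+4k=6Q-1$, $k\le Q-1$. One has $gW\subseteq W'$ and $vW_0=0$, so multiplication by $g$ and by $v$ induce maps $W/W_0\to W'/gW_0$ and $W/W_0\to\mathcal{O}_{12Q-3}$. For $0\le i\le 2Q-1$ put $E_i=x^iy^{2Q-1-i}P^{Q-1}\in W$ and $F_i=x^{2Q+i}y^{4Q-1-i}\in W'$. $X\subseteq W/W_0$ is spanned by (the classes of) $G_i=E_{2i}+E_{2Q-1-2i}$, $0\le i\le Q-1$. $Y\subseteq W'/gW_0$ is spanned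 by (the classes of) $H_i=F_{2i}+F_{2Q-1-2i}$, $0\le i\le Q-1$, together with $\gamma=(x^{2Q-2}y+xy^{2Q-2})R$. Multiplication by $g$ maps $X$ into $Y$. *)

theory Defs
  imports
    "HOL-Algebra.Algebraic_Closure_Type"
    "HOL-Library.Z2"
    "HOL-Library.Poly_Mapping"
    "Jordan_Normal_Form.DL_Rank"
begin

section \<open>Special matrices\<close>

text \<open>The integer \<open>ord\<^sub>2 (i - j)\<close> is the 2-adic multiplicity of the integer \<open>i - j\<close>.\<close>

definition special_matrix :: "nat \<Rightarrow> 'f::field mat \<Rightarrow> bool" where
  "special_matrix Q M \<longleftrightarrow>
     M \<in> carrier_mat Q Q \<and>
     (\<forall>i<Q. \<forall>j<Q. i = j \<or> i mod 3 \<noteq> j mod 3 \<longrightarrow> M $$ (i, j) = 0) \<and>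
     (\<forall>i<Q. \<forall>j<Q. i \<noteq> j \<and> i mod 3 = j mod 3 \<longrightarrow> M $$ (i, j) \<noteq> 0) \<and>
     (\<exists>c :: nat \<Rightarrow> 'f. \<forall>i<Q. \<forall>j<Q. i \<noteq> j \<and> i mod 3 = j mod 3 \<longrightarrow>
        M $$ (i, j) = c (multiplicity 2 (int i - int j)))"

definition row_B :: "nat \<Rightarrow> 'f::field mat" where
  "row_B Q = mat 1 Q (\<lambda>(_, i). if i mod 3 = (2 * Q - 1) mod 3 then 1 else 0)"

definition row_C :: "nat \<Rightarrow> 'f::field mat" where
  "row_C Q = mat 1 Q (\<lambda>_. 1)"


section \<open>The field \<open>L\<close> and the polynomial ring \<open>L[x,y,z]\<close>\<close>

type_synonym L = "bit alg_closure"

text \<open>The degree of the minimal polynomial over the prime field.\<close>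

definition deg_Z2 :: "L \<Rightarrow> nat" where
  "deg_Z2 \<beta> = (LEAST n. \<exists>p :: bit poly. p \<noteq> 0 \<and> Polynomial.degree p = n \<and>
                         poly (map_poly to_ac p) \<beta> = 0)"

datatype var = VX | VY | VZ

text \<open>A polynomial is a finitely supported function from exponent vectors to coefficients;
  the multiplication of \<^theory>\<open>HOL-Library.Poly_Mapping\<close> is convolution.\<close>

type_synonym pol = "(var \<Rightarrow>\<^sub>0 nat) \<Rightarrow>\<^sub>0 L"

definition Const :: "L \<Rightarrow> pol" where "Const c = Poly_Mapping.single 0 c"
definition Var :: "var \<Rightarrow> pol" where
  "Var t = Poly_Mapping.single (Poly_Mapping.single t 1) 1"

abbreviation "xx \<equiv> Var VX"
abbreviation "yy \<equiv> Var VY"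
abbreviation "zz \<equiv> Var VZ"

definition mon_deg :: "(var \<Rightarrow>\<^sub>0 nat) \<Rightarrow> nat" where
  "mon_deg e = Poly_Mapping.lookup e VX + Poly_Mapping.lookup e VY + Poly_Mapping.lookup e VZ"

definition homogeneous :: "nat \<Rightarrow> pol \<Rightarrow> bool" where
  "homogeneous n p \<longleftrightarrow> (\<forall>e \<in> Poly_Mapping.keys p. mon_deg e = n)"

definition lspan :: "pol set \<Rightarrow> pol set" where
  "lspan = Modules.module.span (\<lambda>c p. Const c * p)"

lemma Const_1: "Const 1 = 1"
  by (simp add: Const_def)

lemma vector_space_pol: "Vector_Spaces.vector_space (\<lambda>c (p :: pol). Const c * p)"
  by unfold_locales
    (simp_all only: Const_1 mult_1_left, simp_all add: Const_def algebra_simps single_add mult_single)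

abbreviation LXYZ :: "pol ring" where "LXYZ \<equiv> ring_of_type_algebra"


section \<open>The ring \<open>\<O>\<close>\<close>

definition O_ideal :: "nat \<Rightarrow> pol set" where
  "O_ideal Q = genideal LXYZ {xx ^ (4 * Q), yy ^ (4 * Q), zz ^ (4 * Q)}"

definition O_ring :: "nat \<Rightarrow> pol set ring" where
  "O_ring Q = LXYZ Quot O_ideal Q"

text \<open>The image of a polynomial in \<open>\<O>\<close>.\<close>

definition cls :: "nat \<Rightarrow> pol \<Rightarrow> pol set" where
  "cls Q p = O_ideal Q +>\<^bsub>LXYZ\<^esub> p"

definition O_graded :: "nat \<Rightarrow> nat \<Rightarrow> pol set set" where
  "O_graded Q n = cls Q ` {p. homogeneous n p}"


section \<open>Elements and subspaces attached to \<open>\<alpha>\<close>\<close>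

definition P_pol :: pol where
  "P_pol = zz ^ 4 + xx * yy * zz ^ 2 + xx ^ 3 * zz + yy ^ 3 * zz"

definition g_pol :: "L \<Rightarrow> pol" where
  "g_pol \<alpha> = P_pol + Const \<alpha> * xx ^ 2 * yy ^ 2"

definition f_pol :: pol where
  "f_pol = yy ^ 3 * zz ^ 3"

definition v_pol :: "nat \<Rightarrow> pol" where
  "v_pol Q = (xx * yy) * (yy * zz) ^ (3 * Q)"

definition R_pol :: "nat \<Rightarrow> pol" where
  "R_pol Q = (\<Sum>(i, j, k) \<in> {(i, j, k). (k = 1 \<or> k = 2) \<and> i + j + k = 4 * Q \<and> i mod 3 = j mod 3}.
              xx ^ i * yy ^ j * zz ^ k)"

text \<open>As images of polynomials in \<open>\<O>\<close> are linear in the polynomial, a subspace of \<open>\<O>\<close> spanned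
  by images of polynomials is the image of the span of these polynomials.\<close>

definition W_sp :: "nat \<Rightarrow> pol set set" where
  "W_sp Q = cls Q ` lspan {xx ^ i * yy ^ j * P_pol ^ k | i j k. i + j + 4 * k = 6 * Q - 5 \<and> k \<le> Q - 1}"

definition W0_sp :: "nat \<Rightarrow> pol set set" where
  "W0_sp Q = cls Q ` lspan {xx ^ i * yy ^ j * P_pol ^ k | i j k. i + j + 4 * k = 6 * Q - 5 \<and> k < Q - 1}"

definition W'_sp :: "nat \<Rightarrow> pol set set" where
  "W'_sp Q = cls Q ` lspan
     ({xx ^ i * yy ^ j * R_pol Q | i j. i + j = 2 * Q - 1} \<union>
      {xx ^ i * yy ^ j * P_pol ^ k | i j k. i + j + 4 * k = 6 * Q - 1 \<and> k \<le> Q - 1})"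

definition E_pol :: "nat \<Rightarrow> nat \<Rightarrow> pol" where
  "E_pol Q i = xx ^ i * yy ^ (2 * Q - 1 - i) * P_pol ^ (Q - 1)"

definition F_pol :: "nat \<Rightarrow> nat \<Rightarrow> pol" where
  "F_pol Q i = xx ^ (2 * Q + i) * yy ^ (4 * Q - 1 - i)"

definition G_pol :: "nat \<Rightarrow> nat \<Rightarrow> pol" where
  "G_pol Q i = E_pol Q (2 * i) + E_pol Q (2 * Q - 1 - 2 * i)"

definition H_pol :: "nat \<Rightarrow> nat \<Rightarrow> pol" where
  "H_pol Q i = F_pol Q (2 * i) + F_pol Q (2 * Q - 1 - 2 * i)"

definition gamma_pol :: "nat \<Rightarrow> pol" where
  "gamma_pol Q = (xx ^ (2 * Q - 2) * yy + xx * yy ^ (2 * Q - 2)) * R_pol Q"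

text \<open>Elements of \<open>W/W\<^sub>0\<close> and of \<open>W'/gW\<^sub>0\<close> are the cosets of \<open>W\<^sub>0\<close> in \<open>W\<close> and of \<open>gW\<^sub>0\<close> in \<open>W'\<close>.\<close>

definition gW0 :: "L \<Rightarrow> nat \<Rightarrow> pol set set" where
  "gW0 \<alpha> Q = (\<lambda>w. cls Q (g_pol \<alpha>) \<otimes>\<^bsub>O_ring Q\<^esub> w) ` W0_sp Q"

definition W_mod_W0 :: "nat \<Rightarrow> pol set set set" where
  "W_mod_W0 Q = (\<lambda>w. W0_sp Q +>\<^bsub>O_ring Q\<^esub> w) ` W_sp Q"

definition W'_mod_gW0 :: "L \<Rightarrow> nat \<Rightarrow> pol set set set" where
  "W'_mod_gW0 \<alpha> Q = (\<lambda>w. gW0 \<alpha> Q +>\<^bsub>O_ring Q\<^esub> w) ` W'_sp Q"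

definition X_sp :: "nat \<Rightarrow> pol set set set" where
  "X_sp Q = (\<lambda>p. W0_sp Q +>\<^bsub>O_ring Q\<^esub> cls Q p) ` lspan {G_pol Q i | i. i \<le> Q - 1}"

definition Y_sp :: "L \<Rightarrow> nat \<Rightarrow> pol set set set" where
  "Y_sp \<alpha> Q = (\<lambda>p. gW0 \<alpha> Q +>\<^bsub>O_ring Q\<^esub> cls Q p) ` lspan ({H_pol Q i | i. i \<le> Q - 1} \<union> {gamma_pol Q})"

lemma X_sp_subset:
  assumes "Q \<ge> 2"
  shows "X_sp Q \<subseteq> W_mod_W0 Q"
proof -
  interpret pv: Vector_Spaces.vector_space "\<lambda>c (p :: pol). Const c * p"
    by (rule vector_space_pol)
  have "E_pol Q i \<in> lspan {xx ^ i * yy ^ j * P_pol ^ k | i j k. i + j + 4 * k = 6 * Q - 5 \<and> k \<le> Q - 1}"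
    if "i \<le> 2 * Q - 1" for i
    unfolding lspan_def E_pol_def
  proof (rule pv.span_base, intro CollectI exI conjI)
    show "i + (2 * Q - 1 - i) + 4 * (Q - 1) = 6 * Q - 5"
      using that assms by auto
  qed auto
  then have "{G_pol Q i | i. i \<le> Q - 1} \<subseteq>
      lspan {xx ^ i * yy ^ j * P_pol ^ k | i j k. i + j + 4 * k = 6 * Q - 5 \<and> k \<le> Q - 1}"
    unfolding G_pol_def lspan_def by (auto intro!: pv.span_add)
  then have "lspan {G_pol Q i | i. i \<le> Q - 1} \<subseteq>
      lspan {xx ^ i * yy ^ j * P_pol ^ k | i j k. i + j + 4 * k = 6 * Q - 5 \<and> k \<le> Q - 1}"
    unfolding lspan_def by (intro pv.span_minimal pv.subspace_span)
  then show ?thesis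
    unfolding X_sp_def W_mod_W0_def W_sp_def by blast
qed

lemma Y_sp_subset:
  assumes "Q \<ge> 2"
  shows "Y_sp \<alpha> Q \<subseteq> W'_mod_gW0 \<alpha> Q"
proof -
  interpret pv: Vector_Spaces.vector_space "\<lambda>c (p :: pol). Const c * p"
    by (rule vector_space_pol)
  define D where "D = {xx ^ i * yy ^ j * R_pol Q | i j. i + j = 2 * Q - 1}"
  define B where "B = {xx ^ i * yy ^ j * P_pol ^ k | i j k. i + j + 4 * k = 6 * Q - 1 \<and> k \<le> Q - 1}"
  have "F_pol Q i \<in> lspan (D \<union> B)" if "i \<le> 2 * Q - 1" for i
  proof -
    have "F_pol Q i = xx ^ (2 * Q + i) * yy ^ (4 * Q - 1 - i) * P_pol ^ 0"
      by (simp add: F_pol_def)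
    moreover have "(2 * Q + i) + (4 * Q - 1 - i) + 4 * 0 = 6 * Q - 1"
      using that assms by auto
    ultimately have "F_pol Q i \<in> B"
      unfolding B_def by blast
    then show ?thesis
      unfolding lspan_def by (intro pv.span_base) auto
  qed
  then have "H_pol Q i \<in> lspan (D \<union> B)" if "i \<le> Q - 1" for i
    using that assms unfolding H_pol_def lspan_def by (intro pv.span_add) auto
  moreover have "gamma_pol Q \<in> lspan (D \<union> B)"
  proof -
    have *: "xx ^ i * yy ^ j * R_pol Q \<in> lspan (D \<union> B)" if "i + j = 2 * Q - 1" for i j
      using that unfolding lspan_def D_def by (intro pv.span_base) auto
    have "gamma_pol Q = xx ^ (2 * Q - 2) * yy ^ 1 * R_pol Q + xx ^ 1 * yy ^ (2 * Q - 2) * R_pol Q"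
      by (simp add: gamma_pol_def distrib_right)
    also have "\<dots> \<in> lspan (D \<union> B)"
      using assms *[of "2 * Q - 2" 1] *[of 1 "2 * Q - 2"]
      unfolding lspan_def by (intro pv.span_add) auto
    finally show ?thesis .
  qed
  ultimately have "lspan ({H_pol Q i | i. i \<le> Q - 1} \<union> {gamma_pol Q}) \<subseteq> lspan (D \<union> B)"
    unfolding lspan_def by (intro pv.span_minimal pv.subspace_span) (auto simp: lspan_def)
  then show ?thesis
    unfolding Y_sp_def W'_mod_gW0_def W'_sp_def D_def B_def by blast
qed

text \<open>Multiplying all elements of a coset \<open>w + W\<^sub>0\<close> by \<open>g\<close> gives the coset \<open>gw + gW\<^sub>0\<close>, and
  multiplying them by \<open>v\<close> gives the single element \<open>vw\<close>, because \<open>vW\<^sub>0 = 0\<close>.\<close>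

definition mult_g :: "L \<Rightarrow> nat \<Rightarrow> pol set set \<Rightarrow> pol set set" where
  "mult_g \<alpha> Q u = (\<lambda>w. cls Q (g_pol \<alpha>) \<otimes>\<^bsub>O_ring Q\<^esub> w) ` u"

definition mult_v :: "nat \<Rightarrow> pol set set \<Rightarrow> pol set" where
  "mult_v Q u = the_elem ((\<lambda>w. cls Q (v_pol Q) \<otimes>\<^bsub>O_ring Q\<^esub> w) ` u)"

end

(* Splitting the indices of a residue class modulo 3 by parity, a special matrix block of size 2N
   becomes two blocks of size N coupled by a non-zero constant matrix. Call a block odd if its kernel
   contains a vector of coordinate sum 1 and meets the vectors of sum 0 trivially, and even if it is
   injective and has the all-ones vector as the image of a vector of sum 0. Over characteristic two,
   odd and odd couple to even, and odd and even couple to odd; by induction one of the three residue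
   classes is even and two are odd, and the rows B and C remove the two kernels.

   In characteristic two, z^(2^n) is a combination of the P^(2^k) plus multiples of z^2 and z, and for
   2^n = 4Q the latter add up to R. So in O the element R is a combination of the P^(2^k), while
   modulo gW_0 the factor P acts as alpha x^2 y^2. Hence g G_i is a combination of the H_j with
   coefficients beta^(2^(o+1)) + beta, where o = ord_2(i - j), which form a special matrix because the
   Frobenius orbit of beta has exactly m elements, plus gamma unless i = 2Q-1 modulo 3. In these
   remaining cases, and only there, v G_i is the non-zero element (xyz)^(4Q-1). Thus injectivity is
   the rank statement, and the kernel vector of the block of class 2Q-1 yields an element killed by g
   but not by v. *)
theory Submission
  imports Defs
begin

section \<open>Special matrices\<close>

text \<open>The names odd and even are the parities of the block sizes. In characteristic two a
  symmetric matrix with zero diagonal is alternating, so a block of odd size is singular and a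
  kernel of dimension one is the best possible; for Q a power of 2 exactly one residue class has
  even size. Invertibility alone does not survive the splitting: the coupling is a constant times
  the all-ones matrix, so each half sees the other only through its coordinate sum. Hence the sums
  and the all-ones vector in both notions.

  On the polynomial side the obstacle is the power P^Q in g E_t. Powers up to P^(Q-1) can be traded
  for monomials in x, y modulo gW_0, but P^Q lies just beyond. The vanishing of z^(4Q) in O is the
  relation that expresses it through R and lower powers. Multiples of R cause little trouble: x^t
  y^u R depends only on t modulo 3, so R contributes to g G_i either nothing or the single element
  gamma. To read off coefficients, gamma and the H_j must be independent modulo gW_0; the degree in
  z decides this, as g and P are monic of degree 4 in z while these elements have z-degree at most
  2.\<close>

definition dist_kernel :: "(nat \<Rightarrow> 'f::field) \<Rightarrow> nat \<Rightarrow> nat \<Rightarrow> 'f" where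
  "dist_kernel c i j = (if i = j then 0 else c (multiplicity 2 (int i - int j)))"

definition kernel_op :: "'i set \<Rightarrow> ('i \<Rightarrow> 'i \<Rightarrow> 'f::field) \<Rightarrow> ('i \<Rightarrow> 'f) \<Rightarrow> 'i \<Rightarrow> 'f" where
  "kernel_op A K u i = (\<Sum>j\<in>A. K i j * u j)"

text \<open>Together the two clauses say that the kernel is a line on which the coordinate sum does
  not vanish.\<close>

definition odd_kernel :: "'i set \<Rightarrow> ('i \<Rightarrow> 'i \<Rightarrow> 'f::field) \<Rightarrow> bool" where
  "odd_kernel A K \<longleftrightarrow>
     (\<exists>w. (\<forall>i\<in>A. kernel_op A K w i = 0) \<and> sum w A = 1) \<and>
     (\<forall>u. (\<forall>i\<in>A. kernel_op A K u i = 0) \<and> sum u A = 0 \<longrightarrow> (\<forall>i\<in>A. u i = 0))"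

text \<open>For a finite block, \<open>v\<close> is the inverse matrix applied to the all-ones
  vector, so the sum condition says that the entries of the inverse add up to 0.\<close>

definition even_kernel :: "'i set \<Rightarrow> ('i \<Rightarrow> 'i \<Rightarrow> 'f::field) \<Rightarrow> bool" where
  "even_kernel A K \<longleftrightarrow>
     (\<exists>v. (\<forall>i\<in>A. kernel_op A K v i = 1) \<and> sum v A = 0) \<and>
     (\<forall>u. (\<forall>i\<in>A. kernel_op A K u i = 0) \<longrightarrow> (\<forall>i\<in>A. u i = 0))"

lemma kernel_op_cong:
  "(\<And>j. j \<in> A \<Longrightarrow> K i j = K' i j) \<Longrightarrow> (\<And>j. j \<in> A \<Longrightarrow> u j = u' j) \<Longrightarrow> kernel_op A K u i = kernel_op A K' u' i"
  unfolding kernel_op_def by (auto intro: sum.cong)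

lemma kernel_op_image:
  assumes "inj_on f A"
  shows "kernel_op (f ` A) K u (f i) = kernel_op A (\<lambda>i j. K (f i) (f j)) (u \<circ> f) i"
  unfolding kernel_op_def using assms by (simp add: sum.reindex)

lemma odd_kernel_image:
  assumes "inj_on f A" "odd_kernel A (\<lambda>i j. K (f i) (f j))"
  shows "odd_kernel (f ` A) K"
proof -
  obtain w where w: "\<forall>i\<in>A. kernel_op A (\<lambda>i j. K (f i) (f j)) w i = 0" "sum w A = 1"
    using assms(2) unfolding odd_kernel_def by blast
  define w' where "w' = w \<circ> inv_into A f"
  have w': "w' (f i) = w i" if "i \<in> A" for i
    using that assms(1) by (simp add: w'_def)
  have "kernel_op A (\<lambda>i j. K (f i) (f j)) (w' \<circ> f) i = kernel_op A (\<lambda>i j. K (f i) (f j)) w i" for i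
    by (rule kernel_op_cong) (auto simp: w')
  moreover have "sum w' (f ` A) = sum w A"
    using assms(1) w' by (simp add: sum.reindex)
  ultimately have "\<exists>w. (\<forall>i\<in>f ` A. kernel_op (f ` A) K w i = 0) \<and> sum w (f ` A) = 1"
    using w by (intro exI[of _ w']) (auto simp: kernel_op_image[OF assms(1)])
  moreover have "\<forall>i\<in>f ` A. u i = 0" if "\<forall>i\<in>f ` A. kernel_op (f ` A) K u i = 0" "sum u (f ` A) = 0" for u
  proof -
    have "\<forall>i\<in>A. kernel_op A (\<lambda>i j. K (f i) (f j)) (u \<circ> f) i = 0" "sum (u \<circ> f) A = 0"
      using that by (simp_all add: kernel_op_image[OF assms(1)] sum.reindex[OF assms(1)])
    then have "\<forall>i\<in>A. (u \<circ> f) i = 0" using assms(2) unfolding odd_kernel_def by blast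
    then show ?thesis by simp
  qed
  ultimately show ?thesis unfolding odd_kernel_def by blast
qed

lemma even_kernel_image:
  assumes "inj_on f A" "even_kernel A (\<lambda>i j. K (f i) (f j))"
  shows "even_kernel (f ` A) K"
proof -
  obtain w where w: "\<forall>i\<in>A. kernel_op A (\<lambda>i j. K (f i) (f j)) w i = 1" "sum w A = 0"
    using assms(2) unfolding even_kernel_def by blast
  define w' where "w' = w \<circ> inv_into A f"
  have w': "w' (f i) = w i" if "i \<in> A" for i
    using that assms(1) by (simp add: w'_def)
  have "kernel_op A (\<lambda>i j. K (f i) (f j)) (w' \<circ> f) i = kernel_op A (\<lambda>i j. K (f i) (f j)) w i" for i
    by (rule kernel_op_cong) (auto simp: w')
  moreover have "sum w' (f ` A) = sum w A"
    using assms(1) w' by (simp add: sum.reindex)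
  ultimately have "\<exists>w. (\<forall>i\<in>f ` A. kernel_op (f ` A) K w i = 1) \<and> sum w (f ` A) = 0"
    using w by (intro exI[of _ w']) (auto simp: kernel_op_image[OF assms(1)])
  moreover have "\<forall>i\<in>f ` A. u i = 0" if "\<forall>i\<in>f ` A. kernel_op (f ` A) K u i = 0" for u
  proof -
    have "\<forall>i\<in>A. kernel_op A (\<lambda>i j. K (f i) (f j)) (u \<circ> f) i = 0"
      using that by (simp add: kernel_op_image[OF assms(1)])
    then have "\<forall>i\<in>A. (u \<circ> f) i = 0" using assms(2) unfolding even_kernel_def by blast
    then show ?thesis by simp
  qed
  ultimately show ?thesis unfolding even_kernel_def by blast
qed

text \<open>Pair with the kernel vector \<open>w\<close>: by symmetry it is orthogonal to the image
  of the block, while its pairing with the constant vector \<open>d\<close> is \<open>d\<close>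
  itself. So no non-zero constant vector lies in the image of an odd block.\<close>

lemma odd_kernel_sum_zero:
  assumes sym: "\<And>i j. i \<in> A \<Longrightarrow> j \<in> A \<Longrightarrow> K i j = K j i"
    and odd: "odd_kernel A K" and u: "\<And>i. i \<in> A \<Longrightarrow> kernel_op A K u i + d = 0"
  shows "d = 0" 
proof -
  obtain w where w: "\<forall>i\<in>A. kernel_op A K w i = 0" "sum w A = 1"
    using odd unfolding odd_kernel_def by blast
  have "0 = (\<Sum>i\<in>A. w i * (kernel_op A K u i + d))"
    using u by simp
  also have "\<dots> = (\<Sum>i\<in>A. \<Sum>j\<in>A. w i * K i j * u j) + d"
    using w(2) by (simp add: kernel_op_def distrib_left sum.distrib sum_distrib_left mult.assoc flip: sum_distrib_right)
  also have "(\<Sum>i\<in>A. \<Sum>j\<in>A. w i * K i j * u j) = (\<Sum>j\<in>A. u j * kernel_op A K w j)"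
    unfolding kernel_op_def sum_distrib_left
    by (subst sum.swap) (auto intro!: sum.cong simp: sym mult_ac)
  also have "\<dots> = 0" using w(1) by simp
  finally show ?thesis by simp
qed

section \<open>Two blocks coupled by a non-zero constant\<close>

locale coupled_blocks =
  fixes A B :: "'i set" and K :: "'i \<Rightarrow> 'i \<Rightarrow> 'f::field" and c :: 'f
  assumes fin: "finite A" "finite B" and disj: "A \<inter> B = {}"
    and sym: "\<And>i j. i \<in> A \<union> B \<Longrightarrow> j \<in> A \<union> B \<Longrightarrow> K i j = K j i"
    and coup: "\<And>i j. i \<in> A \<Longrightarrow> j \<in> B \<Longrightarrow> K i j = c"
    and c0: "c \<noteq> 0" and char2: "(2::'f) = 0"
begin

lemma kernel_op_A: "i \<in> A \<Longrightarrow> kernel_op (A \<union> B) K u i = kernel_op A K u i + c * sum u B"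
  unfolding kernel_op_def using fin disj coup by (simp add: sum.union_disjoint sum_distrib_left)

lemma kernel_op_B: "i \<in> B \<Longrightarrow> kernel_op (A \<union> B) K u i = kernel_op B K u i + c * sum u A"
  unfolding kernel_op_def using fin disj coup sym by (simp add: sum.union_disjoint sum_distrib_left)

lemma sum_Un: "sum u (A \<union> B) = sum u A + sum u B"
  using fin disj by (simp add: sum.union_disjoint)

lemma add_self: "(x::'f) + x = 0"
  using char2 by (metis mult_2 mult_zero_left)

definition glue :: "('i \<Rightarrow> 'f) \<Rightarrow> ('i \<Rightarrow> 'f) \<Rightarrow> 'i \<Rightarrow> 'f" where
  "glue u v i = (if i \<in> A then u i else v i)"

lemma glue_simps:
  "kernel_op A K (glue u v) i = kernel_op A K u i" "kernel_op B K (glue u v) i = kernel_op B K v i"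
  "sum (glue u v) A = sum u A" "sum (glue u v) B = sum v B"
  using disj by (auto simp: glue_def kernel_op_def intro!: sum.cong)

lemma kernel_op_scale: "kernel_op C K (\<lambda>i. a * u i) i = a * kernel_op C K u i"
  by (simp add: kernel_op_def sum_distrib_left mult_ac)

lemma commute: "coupled_blocks B A K c"
proof
  show "K i j = c" if "i \<in> B" "j \<in> A" for i j
    using that sym[of i j] coup by simp
qed (use fin disj sym c0 char2 in auto)

text \<open>For a kernel vector of the union, each block maps its own half to a constant vector.
  Both constants vanish by \<open>odd_kernel_sum_zero\<close>, so both coordinate sums are 0 and
  each half is a kernel vector of sum 0.\<close>

lemma odd_odd:
  assumes "odd_kernel A K" "odd_kernel B K"
  shows "even_kernel (A \<union> B) K"
proof -
  obtain w w' where w: "\<forall>i\<in>A. kernel_op A K w i = 0" "sum w A = 1"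
    "\<forall>i\<in>B. kernel_op B K w' i = 0" "sum w' B = 1"
    using assms unfolding odd_kernel_def by blast
  \<comment> \<open>Each half contributes nothing on its own indices and sees \<open>c\<close> times
    the sum of the other half; dividing by \<open>c\<close> makes this 1. The two sums
    \<open>inverse c\<close> cancel in characteristic two.\<close>
  define v where "v = glue (\<lambda>i. inverse c * w i) (\<lambda>i. inverse c * w' i)"
  have "kernel_op (A \<union> B) K v i = 1" if "i \<in> A \<union> B" for i
    using that w c0
    by (auto simp: v_def kernel_op_A kernel_op_B glue_simps kernel_op_scale simp flip: sum_distrib_left)
  moreover have "sum v (A \<union> B) = 0"
    using w by (simp add: v_def sum_Un glue_simps add_self flip: sum_distrib_left)
  moreover have "u i = 0" if u: "\<forall>i\<in>A \<union> B. kernel_op (A \<union> B) K u i = 0" and i: "i \<in> A \<union> B" for u i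
  proof -
    have a: "kernel_op A K u i + c * sum u B = 0" if "i \<in> A" for i
      using u that kernel_op_A[OF that, of u] by simp
    have b: "kernel_op B K u i + c * sum u A = 0" if "i \<in> B" for i
      using u that kernel_op_B[OF that, of u] by simp
    have "c * sum u B = 0"
      by (rule odd_kernel_sum_zero[OF _ assms(1) a]) (simp_all add: sym)
    moreover have "c * sum u A = 0"
      by (rule odd_kernel_sum_zero[OF _ assms(2) b]) (simp_all add: sym)
    ultimately have z: "sum u B = 0" "sum u A = 0" using c0 by simp_all
    then have "\<forall>i\<in>A. kernel_op A K u i = 0" "\<forall>i\<in>B. kernel_op B K u i = 0"
      using a b by simp_all
    then show ?thesis using z i assms unfolding odd_kernel_def by blast
  qed
  ultimately show ?thesis unfolding even_kernel_def by blast
qed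

lemma odd_even:
  assumes "odd_kernel A K" "even_kernel B K"
  shows "odd_kernel (A \<union> B) K"
proof -
  obtain w v where w: "\<forall>i\<in>A. kernel_op A K w i = 0" "sum w A = 1"
    "\<forall>i\<in>B. kernel_op B K v i = 1" "sum v B = 0"
    using assms unfolding odd_kernel_def even_kernel_def by blast
  \<comment> \<open>On B the block itself yields \<open>c\<close>, cancelling the \<open>c\<close>
    that comes from the sum 1 of \<open>w\<close>; on A nothing is added because \<open>v\<close>
    has sum 0.\<close>
  define w' where "w' = glue w (\<lambda>i. c * v i)"
  have "kernel_op (A \<union> B) K w' i = 0" if "i \<in> A \<union> B" for i
    using that w
    by (auto simp: w'_def kernel_op_A kernel_op_B glue_simps kernel_op_scale add_self simp flip: sum_distrib_left)
  moreover have "sum w' (A \<union> B) = 1"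
    using w by (simp add: w'_def sum_Un glue_simps flip: sum_distrib_left)
  moreover have "u i = 0" if u: "\<forall>i\<in>A \<union> B. kernel_op (A \<union> B) K u i = 0" "sum u (A \<union> B) = 0"
    and i: "i \<in> A \<union> B" for u i
  proof -
    have a: "kernel_op A K u i + c * sum u B = 0" if "i \<in> A" for i
      using u that kernel_op_A[OF that, of u] by simp
    have b: "kernel_op B K u i + c * sum u A = 0" if "i \<in> B" for i
      using u that kernel_op_B[OF that, of u] by simp
    have "c * sum u B = 0"
      by (rule odd_kernel_sum_zero[OF _ assms(1) a]) (simp_all add: sym)
    then have "sum u B = 0" using c0 by simp
    moreover have "sum u A = 0" using u(2) \<open>sum u B = 0\<close> by (simp add: sum_Un)
    ultimately have "\<forall>i\<in>A. kernel_op A K u i = 0" "\<forall>i\<in>B. kernel_op B K u i = 0" "sum u A = 0"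
      using a b by simp_all
    then show ?thesis using i assms unfolding odd_kernel_def even_kernel_def by blast
  qed
  ultimately show ?thesis unfolding odd_kernel_def by blast
qed

end

section \<open>Residue classes modulo 3 and their splitting by parity\<close>

definition residue_block :: "nat \<Rightarrow> nat \<Rightarrow> nat set" where
  "residue_block Q r = {i. i < Q \<and> i mod 3 = r mod 3}"

lemma finite_residue_block [simp]: "finite (residue_block Q r)"
  by (simp add: residue_block_def)

lemma mod3_double: "(2 * a) mod 3 = (2 * b) mod 3 \<longleftrightarrow> a mod 3 = b mod (3::nat)"
proof -
  have "(2 * x) mod 3 = (if x mod 3 = 0 then 0 else if x mod 3 = 1 then 2 else (1::nat))" for x
  proof -
    have "x mod 3 = 0 \<or> x mod 3 = 1 \<or> x mod 3 = 2" using mod_less_divisor[of 3 x] by linarith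
    then show ?thesis using mod_mult_right_eq[of 2 x 3] by auto
  qed
  moreover have "a mod 3 < 3" "b mod 3 < 3" by simp_all
  ultimately show ?thesis by (auto split: if_splits)
qed

lemma mod3_diff:
  fixes a b d :: nat
  assumes "d \<le> a" "d \<le> b"
  shows "(a - d) mod 3 = (b - d) mod 3 \<longleftrightarrow> a mod 3 = b mod 3"
proof (cases "b \<le> a")
  case True
  then show ?thesis using assms mod_eq_dvd_iff_nat[of b a 3] mod_eq_dvd_iff_nat[of "b - d" "a - d" 3] by simp
next
  case False
  then show ?thesis using assms mod_eq_dvd_iff_nat[of a b 3] mod_eq_dvd_iff_nat[of "a - d" "b - d" 3]
    by (simp add: eq_commute)
qed

text \<open>As 2 is its own inverse modulo 3, even members satisfy i = 2r and odd ones i = 2(r - 1),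
  written as 2r + 1 to avoid truncated subtraction.\<close>

lemma residue_block_double:
  "2 * i \<in> residue_block (2 * Q) r \<longleftrightarrow> i \<in> residue_block Q (2 * r)"
  "2 * i + 1 \<in> residue_block (2 * Q) r \<longleftrightarrow> i \<in> residue_block Q (2 * r + 1)"
proof -
  have "2 * (2 * r) = r + r * 3" "2 * (2 * r + 1) + 1 = r + (r + 1) * 3" by simp_all
  then have *: "(2 * (2 * r)) mod 3 = r mod 3" "(2 * (2 * r + 1) + 1) mod 3 = r mod 3"
    by (simp_all only: mod_mult_self1)
  have "2 * i mod 3 = r mod 3 \<longleftrightarrow> i mod 3 = 2 * r mod 3"
    using mod3_double[of i "2 * r"] by (simp only: *)
  then show "2 * i \<in> residue_block (2 * Q) r \<longleftrightarrow> i \<in> residue_block Q (2 * r)"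
    unfolding residue_block_def by (simp only: mem_Collect_eq mult_less_cancel1) simp
  have "(2 * i + 1) mod 3 = r mod 3 \<longleftrightarrow> i mod 3 = (2 * r + 1) mod 3"
    using mod3_double[of i "2 * r + 1"] mod3_diff[of 1 "2 * i + 1" "2 * (2 * r + 1) + 1"]
    by (simp only: * add_diff_cancel_right' le_add2)
  moreover have "2 * i + 1 < 2 * Q \<longleftrightarrow> i < Q" by linarith
  ultimately show "2 * i + 1 \<in> residue_block (2 * Q) r \<longleftrightarrow> i \<in> residue_block Q (2 * r + 1)"
    unfolding residue_block_def by (simp only: mem_Collect_eq)
qed

lemma residue_block_split:
  "residue_block (2 * Q) r =
     (\<lambda>i. 2 * i) ` residue_block Q (2 * r) \<union> (\<lambda>i. 2 * i + 1) ` residue_block Q (2 * r + 1)"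
proof (rule Set.set_eqI, rule iffI)
  fix i assume i: "i \<in> residue_block (2 * Q) r"
  show "i \<in> (\<lambda>i. 2 * i) ` residue_block Q (2 * r) \<union> (\<lambda>i. 2 * i + 1) ` residue_block Q (2 * r + 1)"
  proof (cases "even i")
    case True
    then obtain k where "i = 2 * k" by (rule evenE)
    then show ?thesis using i residue_block_double(1) by blast
  next
    case False
    then obtain k where "i = 2 * k + 1" by (rule oddE)
    then show ?thesis using i residue_block_double(2) by blast
  qed
next
  fix i assume "i \<in> (\<lambda>i. 2 * i) ` residue_block Q (2 * r) \<union> (\<lambda>i. 2 * i + 1) ` residue_block Q (2 * r + 1)"
  then show "i \<in> residue_block (2 * Q) r"
    using residue_block_double by blast
qed

lemma residue_block_cong: "r mod 3 = s mod 3 \<Longrightarrow> residue_block Q r = residue_block Q s"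
  by (simp add: residue_block_def)

lemma multiplicity_double: "d \<noteq> 0 \<Longrightarrow> multiplicity 2 (2 * d) = Suc (multiplicity 2 (d::int))"
  by (rule multiplicity_times_same) auto

lemma dist_kernel_sym: "dist_kernel c i j = dist_kernel c j i"
  using multiplicity_uminus_right[of 2 "int i - int j"] by (auto simp: dist_kernel_def)

lemma dist_kernel_double:
  "dist_kernel c (2 * i) (2 * j) = dist_kernel (\<lambda>k. c (Suc k)) i j"
  "dist_kernel c (2 * i + 1) (2 * j + 1) = dist_kernel (\<lambda>k. c (Suc k)) i j"
proof -
  have "2 * int i - 2 * int j = 2 * (int i - int j)" by simp
  then show "dist_kernel c (2 * i) (2 * j) = dist_kernel (\<lambda>k. c (Suc k)) i j"
    "dist_kernel c (2 * i + 1) (2 * j + 1) = dist_kernel (\<lambda>k. c (Suc k)) i j"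
    using multiplicity_double[of "int i - int j"] by (auto simp: dist_kernel_def)
qed

text \<open>An odd difference has order 0; this is what makes the coupling of the two halves
  constant.\<close>

lemma dist_kernel_parity: "dist_kernel c (2 * i) (2 * j + 1) = c 0"
proof -
  have "odd (2 * int i - (2 * int j + 1))" by simp
  then have "multiplicity 2 (2 * int i - (2 * int j + 1)) = 0"
    by (rule not_dvd_imp_multiplicity_0)
  then show ?thesis unfolding dist_kernel_def by (auto simp: add.commute) presburger
qed

lemma coupled_blocks_residue:
  assumes "(2::'f::field) = 0" "c 0 \<noteq> (0::'f)"
  shows "coupled_blocks ((\<lambda>i. 2 * i) ` residue_block Q r) ((\<lambda>i. 2 * i + 1) ` residue_block Q s)
    (dist_kernel c) (c 0)"
proof
  show "(\<lambda>i. 2 * i) ` residue_block Q r \<inter> (\<lambda>i. 2 * i + 1) ` residue_block Q s = {}"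
    by auto presburger
qed (use assms in \<open>auto simp: dist_kernel_sym dist_kernel_parity[simplified]\<close>)

lemma odd_kernel_double:
  assumes "odd_kernel (residue_block Q r) (dist_kernel (\<lambda>k. c (Suc k)))"
  shows "odd_kernel ((\<lambda>i. 2 * i) ` residue_block Q r) (dist_kernel c)"
    "odd_kernel ((\<lambda>i. 2 * i + 1) ` residue_block Q r) (dist_kernel c)"
  using assms by (auto intro!: odd_kernel_image simp: inj_on_def dist_kernel_double dist_kernel_double[simplified])

lemma even_kernel_double:
  assumes "even_kernel (residue_block Q r) (dist_kernel (\<lambda>k. c (Suc k)))"
  shows "even_kernel ((\<lambda>i. 2 * i) ` residue_block Q r) (dist_kernel c)"
    "even_kernel ((\<lambda>i. 2 * i + 1) ` residue_block Q r) (dist_kernel c)"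
  using assms by (auto intro!: even_kernel_image simp: inj_on_def dist_kernel_double dist_kernel_double[simplified])

text \<open>Naming the classes by 2Q + 1, 2Q + 2 and 2Q is compatible with doubling: modulo 3 the
  class 4Q + 1 splits into 2Q + 2 and 2Q, the class 4Q + 2 into 2Q + 1 and 2Q + 2, and 4Q into 2Q
  and 2Q + 1. The function \<open>c\<close> varies in the induction because every halving shifts it
  by one.\<close>

lemma dist_kernel_blocks:
  fixes c :: "nat \<Rightarrow> 'f::field"
  assumes "(2::'f) = 0" "n \<ge> 1" "\<forall>k. c k \<noteq> 0"
  shows "even_kernel (residue_block (2 ^ n) (2 * 2 ^ n + 1)) (dist_kernel c) \<and>
    odd_kernel (residue_block (2 ^ n) (2 * 2 ^ n + 2)) (dist_kernel c) \<and>
    odd_kernel (residue_block (2 ^ n) (2 * 2 ^ n)) (dist_kernel c)"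
  using assms(2,3)
proof (induction n arbitrary: c rule: dec_induct)
  case base
  have "residue_block 2 r = (if r mod 3 = 0 then {0} else if r mod 3 = 1 then {1} else {})" for r
    unfolding residue_block_def less_2_cases_iff by auto
  \<comment> \<open>For Q = 2 the even block is empty and the two odd blocks are one-by-one zero
    matrices.\<close>
  then have "residue_block 2 5 = {}" "residue_block 2 6 = {0}" "residue_block 2 4 = {1}"
    by simp_all
  then show ?case
    by (auto simp: even_kernel_def odd_kernel_def kernel_op_def dist_kernel_def intro: exI[of _ "\<lambda>_. 1"])
next
  case (step n)
  define Q where "Q = (2::nat) ^ n"
  let ?c = "\<lambda>k. c (Suc k)"
  have ev: "even_kernel (residue_block Q (2 * Q + 1)) (dist_kernel ?c)"
    and od: "odd_kernel (residue_block Q (2 * Q + 2)) (dist_kernel ?c)"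
      "odd_kernel (residue_block Q (2 * Q)) (dist_kernel ?c)"
    using step.IH[of ?c] step.prems unfolding Q_def by blast+
  have cb: "coupled_blocks ((\<lambda>i. 2 * i) ` residue_block Q r) ((\<lambda>i. 2 * i + 1) ` residue_block Q s)
    (dist_kernel c) (c 0)" for r s
    using coupled_blocks_residue assms(1) step.prems by blast
  have sp: "residue_block (2 * Q) r = (\<lambda>i. 2 * i) ` residue_block Q s \<union> (\<lambda>i. 2 * i + 1) ` residue_block Q t"
    if "s mod 3 = 2 * r mod 3" "t mod 3 = (2 * r + 1) mod 3" for r s t
    unfolding residue_block_split residue_block_cong[OF that(1)] residue_block_cong[OF that(2)] ..
  have "even_kernel (residue_block (2 * Q) (2 * (2 * Q) + 1)) (dist_kernel c)"
  proof (subst sp[of "2 * Q + 2" _ "2 * Q"])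
    show "(2 * Q + 2) mod 3 = 2 * (2 * (2 * Q) + 1) mod 3" by presburger
    show "2 * Q mod 3 = (2 * (2 * (2 * Q) + 1) + 1) mod 3" by presburger
  qed (intro coupled_blocks.odd_odd[OF cb] odd_kernel_double od)
  moreover have "odd_kernel (residue_block (2 * Q) (2 * (2 * Q) + 2)) (dist_kernel c)"
  proof (subst sp[of "2 * Q + 1" _ "2 * Q + 2"])
    show "(2 * Q + 1) mod 3 = 2 * (2 * (2 * Q) + 2) mod 3" by presburger
    show "(2 * Q + 2) mod 3 = (2 * (2 * (2 * Q) + 2) + 1) mod 3" by presburger
  qed (subst Un_commute, intro coupled_blocks.odd_even[OF coupled_blocks.commute[OF cb]]
        odd_kernel_double even_kernel_double od ev)
  moreover have "odd_kernel (residue_block (2 * Q) (2 * (2 * Q))) (dist_kernel c)"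
  proof (subst sp[of "2 * Q" _ "2 * Q + 1"])
    show "2 * Q mod 3 = 2 * (2 * (2 * Q)) mod 3" by presburger
    show "(2 * Q + 1) mod 3 = (2 * (2 * (2 * Q)) + 1) mod 3" by presburger
  qed (intro coupled_blocks.odd_even[OF cb] odd_kernel_double even_kernel_double od ev)
  ultimately show ?case by (simp add: Q_def)
qed

lemma mod3_cases: "i mod 3 = Suc m mod 3 \<or> i mod 3 = Suc (Suc m) mod 3 \<or> i mod 3 = m mod (3::nat)"
  using mod_less_divisor[of 3 i] mod_less_divisor[of 3 m] unfolding mod_Suc
  by (auto split: if_splits)
lemma mod3_distinct: "Suc m mod 3 \<noteq> Suc (Suc m) mod 3" "Suc m mod 3 \<noteq> m mod 3" "Suc (Suc m) mod 3 \<noteq> m mod (3::nat)"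
  using mod_less_divisor[of 3 m] unfolding mod_Suc
  by (auto split: if_splits)

lemma residue_block_cover: "{..<Q} = residue_block Q (2 * Q + 1) \<union> residue_block Q (2 * Q + 2) \<union> residue_block Q (2 * Q)"
proof -
  have "i mod 3 = (2 * Q + 1) mod 3 \<or> i mod 3 = (2 * Q + 2) mod 3 \<or> i mod 3 = (2 * Q) mod 3" for i
    using mod3_cases[of i "2 * Q"] by (simp only: add_2_eq_Suc' Suc_eq_plus1[symmetric])
  then show ?thesis unfolding residue_block_def by blast
qed

lemma sum_residue_blocks:
  "sum u {..<Q} = sum u (residue_block Q (2 * Q + 1)) + sum u (residue_block Q (2 * Q + 2)) + sum u (residue_block Q (2 * Q))"
proof -
  have "residue_block Q (2 * Q + 1) \<inter> residue_block Q (2 * Q + 2) = {}"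
    "(residue_block Q (2 * Q + 1) \<union> residue_block Q (2 * Q + 2)) \<inter> residue_block Q (2 * Q) = {}"
  proof -
    have "(2 * Q + 1) mod 3 \<noteq> (2 * Q + 2) mod 3" "(2 * Q + 1) mod 3 \<noteq> (2 * Q) mod 3"
      "(2 * Q + 2) mod 3 \<noteq> (2 * Q) mod 3"
      using mod3_distinct[of "2 * Q"] by (simp_all only: add_2_eq_Suc' Suc_eq_plus1[symmetric] not_False_eq_True)
    then show "residue_block Q (2 * Q + 1) \<inter> residue_block Q (2 * Q + 2) = {}"
      "(residue_block Q (2 * Q + 1) \<union> residue_block Q (2 * Q + 2)) \<inter> residue_block Q (2 * Q) = {}"
      unfolding residue_block_def Int_def Un_def by (safe; simp only:)+
  qed
  then show ?thesis unfolding residue_block_cover by (simp add: sum.union_disjoint)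
qed

section \<open>Kernel and rank of special matrices\<close>

definition special_fun :: "(nat \<Rightarrow> 'f::field) \<Rightarrow> nat \<Rightarrow> nat \<Rightarrow> 'f" where
  "special_fun c i j = (if i mod 3 = j mod 3 then dist_kernel c i j else 0)"

lemma sum_special_fun:
  assumes "i < Q"
  shows "(\<Sum>j<Q. special_fun c i j * u j) = kernel_op (residue_block Q i) (dist_kernel c) u i"
  unfolding kernel_op_def
  by (rule sum.mono_neutral_cong_right) (auto simp: residue_block_def special_fun_def)

lemma special_fun_sym: "special_fun c i j = special_fun c j i"
  by (simp add: special_fun_def dist_kernel_sym[of c i j])

lemma special_fun_block:
  assumes "\<forall>i<Q. (\<Sum>j<Q. special_fun c i j * u j) = 0" "i \<in> residue_block Q r"
  shows "kernel_op (residue_block Q r) (dist_kernel c) u i = 0"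
proof -
  have "i < Q" "residue_block Q r = residue_block Q i"
    using assms(2) by (auto simp: residue_block_def)
  then show ?thesis using assms(1) sum_special_fun by metis
qed

text \<open>The row B selects the class of 2Q - 1, which is that of 2Q + 2, and removes its kernel.
  With that class and the even one gone, the row C sees only the remaining odd class.\<close>

lemma special_fun_kernel_zero:
  fixes c :: "nat \<Rightarrow> 'f::field"
  assumes "(2::'f) = 0" "n \<ge> 1" "Q = 2 ^ n" "\<forall>k. c k \<noteq> 0"
    and u: "\<forall>i<Q. (\<Sum>j<Q. special_fun c i j * u j) = 0"
    and B: "sum u (residue_block Q (2 * Q + 2)) = 0" and C: "sum u {..<Q} = 0"
    and i: "i < Q"
  shows "u i = 0"
proof -
  note blk = dist_kernel_blocks[OF assms(1,2,4), folded assms(3)]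
  have 1: "\<forall>i\<in>residue_block Q (2 * Q + 1). u i = 0"
    using blk special_fun_block[OF u] unfolding even_kernel_def by blast
  have 2: "\<forall>i\<in>residue_block Q (2 * Q + 2). u i = 0"
    using blk B special_fun_block[OF u] unfolding odd_kernel_def by blast
  have "sum u (residue_block Q (2 * Q)) = 0"
    using 1 B C sum_residue_blocks[of u Q] by simp
  then have "\<forall>i\<in>residue_block Q (2 * Q). u i = 0"
    using blk special_fun_block[OF u] unfolding odd_kernel_def by blast
  then show ?thesis using 1 2 i residue_block_cover[of Q] by blast
qed

text \<open>The kernel vector of one odd block, extended by zero, is killed by the matrix but not by
  the row B. It later yields the element that separates \<open>v\<close> from the multiples of
  \<open>g\<close>.\<close>

lemma special_fun_kernel_vector:
  fixes c :: "nat \<Rightarrow> 'f::field"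
  assumes "(2::'f) = 0" "n \<ge> 1" "Q = 2 ^ n" "\<forall>k. c k \<noteq> 0"
  obtains w where "\<forall>i<Q. (\<Sum>j<Q. special_fun c i j * w j) = 0"
    "sum w (residue_block Q (2 * Q + 2)) = 1" "\<forall>i. i \<notin> residue_block Q (2 * Q + 2) \<longrightarrow> w i = 0"
proof -
  let ?B = "residue_block Q (2 * Q + 2)"
  obtain w where w: "\<forall>i\<in>?B. kernel_op ?B (dist_kernel c) w i = 0" "sum w ?B = 1"
    using dist_kernel_blocks[OF assms(1,2,4), folded assms(3)] unfolding odd_kernel_def by blast
  define w' where "w' i = (if i \<in> ?B then w i else 0)" for i
  have "(\<Sum>j<Q. special_fun c i j * w' j) = 0" if "i < Q" for i
  proof (cases "i \<in> ?B")
    case True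
    then have "residue_block Q i = ?B" by (auto simp: residue_block_def)
    then have "(\<Sum>j<Q. special_fun c i j * w' j) = kernel_op ?B (dist_kernel c) w' i"
      using sum_special_fun[OF that] by metis
    also have "\<dots> = kernel_op ?B (dist_kernel c) w i"
      by (rule kernel_op_cong) (auto simp: w'_def)
    finally show ?thesis using w True by simp
  next
    case False
    then show ?thesis using that
      by (intro sum.neutral) (auto simp: special_fun_def w'_def residue_block_def)
  qed
  moreover have "sum w' ?B = 1"
    using w(2) by (simp add: w'_def cong: sum.cong)
  ultimately show thesis using that[of w'] by (auto simp: w'_def)
qed

lemma special_matrix_special_fun:
  assumes "special_matrix Q (M :: 'f::field mat)"
  obtains c where "\<forall>k. c k \<noteq> 0" "\<forall>i<Q. \<forall>j<Q. M $$ (i, j) = special_fun c i j"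
proof -
  obtain c where c: "\<forall>i<Q. \<forall>j<Q. i \<noteq> j \<and> i mod 3 = j mod 3 \<longrightarrow>
        M $$ (i, j) = c (multiplicity 2 (int i - int j))"
    using assms unfolding special_matrix_def by blast
  show thesis
  \<comment> \<open>A zero of \<open>c\<close> can only sit at an order not attained by distinct
    congruent indices below Q, so it may be replaced by 1; the block induction asks for non-zero
    values everywhere.\<close>
  proof (rule that[of "\<lambda>k. if c k = 0 then 1 else c k"])
    show "\<forall>i<Q. \<forall>j<Q. M $$ (i, j) = special_fun (\<lambda>k. if c k = 0 then 1 else c k) i j"
      using assms c unfolding special_matrix_def special_fun_def dist_kernel_def
      by auto
  qed auto
qed

theorem special_matrix_rank:
  assumes "CHAR('f::field) = 2" "Q \<ge> 2" "Q = 2 ^ n" "special_matrix Q (M :: 'f mat)"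
  shows "vec_space.rank (Q + 2) (M @\<^sub>r row_B Q @\<^sub>r row_C Q) = Q"
proof -
  have two: "(2::'f) = 0"
    using of_nat_CHAR[where 'a='f] assms(1) by simp
  have n: "n \<ge> 1" using assms(2,3) by (cases n) auto
  obtain c where c: "\<forall>k. c k \<noteq> 0" "\<forall>i<Q. \<forall>j<Q. M $$ (i, j) = special_fun c i j"
    using special_matrix_special_fun[OF assms(4)] by blast
  let ?A = "M @\<^sub>r row_B Q @\<^sub>r row_C Q :: 'f mat"
  have M: "M \<in> carrier_mat Q Q" using assms(4) by (simp add: special_matrix_def)
  have B: "row_B Q \<in> carrier_mat 1 Q" "row_C Q \<in> carrier_mat 1 Q"
    by (auto simp: row_B_def row_C_def)
  have BC: "row_B Q @\<^sub>r row_C Q \<in> carrier_mat 2 Q"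
    using carrier_append_rows[OF B] by (simp add: numeral_2_eq_2)
  have A: "?A \<in> carrier_mat (Q + 2) Q"
    by (rule carrier_append_rows[OF M BC])
  have ker: "v = 0\<^sub>v Q" if v: "v \<in> carrier_vec Q" "?A *\<^sub>v v = 0\<^sub>v (Q + 2)" for v
  proof -
    have "?A *\<^sub>v v = (M *\<^sub>v v) @\<^sub>v ((row_B Q *\<^sub>v v) @\<^sub>v (row_C Q *\<^sub>v v))"
      using mat_mult_append[OF M BC v(1)] mat_mult_append[OF B v(1)] by simp
    then have *: "(M *\<^sub>v v) @\<^sub>v ((row_B Q *\<^sub>v v) @\<^sub>v (row_C Q *\<^sub>v v)) = 0\<^sub>v (Q + 2)"
      using v(2) by simp
    have dims: "dim_vec (M *\<^sub>v v) = Q" "dim_vec (row_B Q *\<^sub>v v) = 1" "dim_vec (row_C Q *\<^sub>v v) = 1"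
      using M B by auto
    have dv: "dim_vec v = Q" using v by auto
    have "vec_index (M *\<^sub>v v) i = 0" if "i < Q" for i
      using arg_cong[OF *, of "\<lambda>w. vec_index w i"] that dims by simp
    then have 1: "\<forall>i<Q. (\<Sum>j<Q. special_fun c i j * vec_index v j) = 0"
      using M c(2) dv by (auto simp: scalar_prod_def atLeast0LessThan intro!: sum.cong)
    have "vec_index (row_B Q *\<^sub>v v) 0 = 0"
      using arg_cong[OF *, of "\<lambda>w. vec_index w Q"] dims by simp
    then have "(\<Sum>j<Q. (if j mod 3 = (2 * Q - 1) mod 3 then 1 else 0) * vec_index v j) = 0"
      using dv by (simp add: row_B_def scalar_prod_def atLeast0LessThan)
    moreover have "(\<Sum>j<Q. (if j mod 3 = (2 * Q - 1) mod 3 then 1 else 0) * vec_index v j) =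
      (\<Sum>j\<in>residue_block Q (2 * Q + 2). vec_index v j)"
    proof -
      have "2 * Q + 2 = 2 * Q - 1 + 3" using assms(2) by simp
      then have "residue_block Q (2 * Q + 2) = {j \<in> {..<Q}. j mod 3 = (2 * Q - 1) mod 3}"
        unfolding residue_block_def by (simp only: mod_add_self2) auto
      then show ?thesis by (simp add: sum.If_cases if_distrib[of "\<lambda>c. c * _"] Int_def cong: if_cong)
    qed
    ultimately have 2: "(\<Sum>j\<in>residue_block Q (2 * Q + 2). vec_index v j) = 0" by simp
    have "vec_index (row_C Q *\<^sub>v v) 0 = 0"
      using arg_cong[OF *, of "\<lambda>w. vec_index w (Q + 1)"] dims by simp
    then have 3: "(\<Sum>j<Q. vec_index v j) = 0"
      using dv by (simp add: row_C_def scalar_prod_def atLeast0LessThan)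
    show ?thesis
      using special_fun_kernel_zero[OF two n assms(3) c(1) 1 2 3] dv by auto
  qed
  interpret vec_space "TYPE('f)" "Q + 2" .
  \<comment> \<open>Independence is formulated for the set of columns, so repetitions must be
    excluded first; two equal columns would put a difference of unit vectors into the
    kernel.\<close>
  have dist: "distinct (cols ?A)"
  proof (rule ccontr)
    assume "\<not> distinct (cols ?A)"
    then obtain i j where ij: "i < Q" "j < Q" "i \<noteq> j" "col ?A i = col ?A j"
      using A by (auto simp: distinct_conv_nth)
    have "?A *\<^sub>v (unit_vec Q i - unit_vec Q j) = 0\<^sub>v (Q + 2)"
    proof -
      have "?A *\<^sub>v unit_vec Q k = col ?A k" if "k < Q" for k
        using A that by (intro eq_vecI) (auto simp: scalar_prod_right_unit)
      then show ?thesis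
        using ij A by (subst mult_minus_distrib_mat_vec[OF A]) auto
    qed
    then have "unit_vec Q i - unit_vec Q j = (0\<^sub>v Q :: 'f vec)"
      by (intro ker) auto
    then have "vec_index (unit_vec Q i - unit_vec Q j :: 'f vec) i = 0"
      using ij(1) by simp
    then show False using ij by simp
  qed
  show ?thesis
  proof (rule lin_indpt_full_rank[OF A dist])
    show "lin_indpt (set (cols ?A))"
      using ker lin_depE[OF A _ dist] by blast
  qed
qed

section \<open>The degree over the prime field\<close>

lemma char2_add_self:
  assumes "(2::'a::comm_ring_1) = 0"
  shows "(x::'a) + x = 0"
  using assms by (metis mult_2 mult_zero_left)

lemma char2_square_add:
  assumes "(2::'a::comm_ring_1) = 0"
  shows "((x::'a) + y)\<^sup>2 = x\<^sup>2 + y\<^sup>2"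
  using assms by (simp add: power2_sum)

lemma char2_frobenius_add:
  assumes "(2::'a::comm_ring_1) = 0"
  shows "((x::'a) + y) ^ (2 ^ n) = x ^ (2 ^ n) + y ^ (2 ^ n)"
proof (induction n)
  case (Suc n)
  have "(x + y) ^ (2 ^ Suc n) = ((x + y) ^ (2 ^ n))\<^sup>2" by (simp add: mult.commute flip: power_mult)
  also have "\<dots> = (x ^ (2 ^ n))\<^sup>2 + (y ^ (2 ^ n))\<^sup>2"
    by (simp add: Suc char2_square_add[OF assms])
  finally show ?case by (simp add: mult.commute flip: power_mult)
qed simp

lemma char2_frobenius_sum:
  assumes "(2::'a::comm_ring_1) = 0"
  shows "(\<Sum>i\<in>A. f i :: 'a) ^ (2 ^ n) = (\<Sum>i\<in>A. f i ^ (2 ^ n))"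
  by (induction A rule: infinite_finite_induct) (simp_all add: char2_frobenius_add[OF assms] zero_power)

text \<open>The k-th summand is \<beta>^(2^(k+1)) + \<beta>^(2^k), so the sum telescopes.\<close>

lemma char2_artin_schreier_sum:
  assumes "(2::'a::comm_ring_1) = 0"
  shows "(\<Sum>k<n. ((\<beta>::'a)\<^sup>2 + \<beta>) ^ (2 ^ k)) = \<beta> ^ (2 ^ n) + \<beta>"
proof (induction n)
  case 0
  then show ?case using char2_add_self[OF assms] by simp
next
  case (Suc n)
  have "(\<Sum>k<Suc n. (\<beta>\<^sup>2 + \<beta>) ^ (2 ^ k)) = \<beta> ^ (2 ^ n) + \<beta> + ((\<beta>\<^sup>2) ^ (2 ^ n) + \<beta> ^ (2 ^ n))"
    unfolding sum.lessThan_Suc Suc by (simp only: char2_frobenius_add[OF assms])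
  also have "\<dots> = (\<beta> ^ (2 ^ n) + \<beta> ^ (2 ^ n)) + (\<beta> ^ (2 ^ Suc n) + \<beta>)"
    by (simp add: algebra_simps flip: power_mult)
  finally show ?case by (simp only: char2_add_self[OF assms] add_0)
qed

lemma two_L: "(2::L) = 0"
  by (metis bit_numeral_even to_ac_0 to_ac_numeral)

lemma to_ac_bit_cases: "to_ac (b :: bit) = 0 \<or> to_ac b = 1"
  by (cases b) auto

lemma deg_Z2_exists: "\<exists>p :: bit poly. p \<noteq> 0 \<and> Polynomial.degree p = deg_Z2 \<beta> \<and> poly (map_poly to_ac p) \<beta> = 0"
  unfolding deg_Z2_def by (rule LeastI_ex) (use alg_closure_algebraic[of \<beta>] in blast)

lemma poly_map_to_ac:
  "poly (map_poly to_ac (p :: bit poly)) \<beta> = (\<Sum>i\<le>Polynomial.degree p. to_ac (coeff p i) * \<beta> ^ i)"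
  by (simp add: poly_altdef degree_map_poly coeff_map_poly)

locale Z2_degree =
  fixes \<beta> :: L and m :: nat
  assumes m_def: "m = deg_Z2 \<beta>"
begin

text \<open>Its range is the field generated by \<beta>. What is used of it is that it has 2^m
  elements and is stable under multiplication by \<beta>.\<close>

definition comb :: "(nat \<Rightarrow> bit) \<Rightarrow> L" where
  "comb c = (\<Sum>i<m. to_ac (c i) * \<beta> ^ i)"

lemma m_pos: "m > 0"
proof (rule ccontr)
  assume "\<not> m > 0"
  then obtain p :: "bit poly" where p: "p \<noteq> 0" "Polynomial.degree p = 0" "poly (map_poly to_ac p) \<beta> = 0"
    using deg_Z2_exists[of \<beta>] m_def by auto
  then have "coeff p 0 = 0" by (simp add: poly_map_to_ac)
  then show False using p(1,2) leading_coeff_0_iff[of p] by simp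
qed

text \<open>A non-trivial relation would be a non-zero polynomial of degree below \<open>m\<close>
  with root \<beta>, against the minimality in \<open>deg_Z2\<close>.\<close>

lemma comb_zero:
  assumes "comb c = 0" "i < m"
  shows "c i = 0"
proof (rule ccontr)
  assume i: "c i \<noteq> 0"
  define p where "p = (\<Sum>i<m. Polynomial.monom (c i) i)"
  have cp: "coeff p j = (if j < m then c j else 0)" for j
    by (simp add: p_def coeff_sum sum.delta)
  have deg: "Polynomial.degree p < m"
  proof -
    have "Polynomial.degree p \<le> m - 1" by (rule degree_le) (use cp m_pos in auto)
    then show ?thesis using m_pos by simp
  qed
  have "p \<noteq> 0" using i assms(2) cp by (metis coeff_0)
  have "poly (map_poly to_ac p) \<beta> = (\<Sum>i<m. to_ac (coeff p i) * \<beta> ^ i)"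
    unfolding poly_map_to_ac using deg
    by (intro sum.mono_neutral_left) (auto simp: coeff_eq_0)
  also have "\<dots> = comb c" by (simp add: comb_def cp)
  finally have "deg_Z2 \<beta> \<le> Polynomial.degree p"
    unfolding deg_Z2_def using \<open>p \<noteq> 0\<close> assms(1) by (intro Least_le) auto
  then show False using deg m_def by simp
qed

lemma comb_add: "comb c + comb d = comb (\<lambda>i. c i + d i)"
  unfolding comb_def to_ac_add distrib_right sum.distrib ..

lemma power_m: "\<exists>d. \<beta> ^ m = comb d"
proof -
  obtain p :: "bit poly" where p: "p \<noteq> 0" "Polynomial.degree p = m" "poly (map_poly to_ac p) \<beta> = 0"
    using deg_Z2_exists[of \<beta>] m_def by auto
  have "coeff p m \<noteq> 0" using p leading_coeff_0_iff by blast
  then have "coeff p m = 1" by (cases "coeff p m") auto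
  then have "0 = comb (coeff p) + \<beta> ^ m"
    using p(2,3) unfolding poly_map_to_ac comb_def by (simp add: lessThan_Suc_atMost[symmetric])
  then have "\<beta> ^ m = comb (coeff p)"
    using char2_add_self[OF two_L] by (metis add_left_cancel)
  then show ?thesis by blast
qed

lemma mult_comb: "\<exists>d. \<beta> * comb c = comb d"
proof -
  obtain d where d: "\<beta> ^ m = comb d" using power_m by blast
  obtain n where n: "m = Suc n" using m_pos by (cases m) auto
  have "\<beta> * comb c = (\<Sum>i<n. to_ac (c i) * \<beta> ^ Suc i) + to_ac (c n) * \<beta> ^ m"
    unfolding comb_def by (simp add: n sum_distrib_left algebra_simps)
  also have "(\<Sum>i<n. to_ac (c i) * \<beta> ^ Suc i) = comb (\<lambda>i. if i = 0 then 0 else c (i - 1))"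
  proof -
    have "comb (\<lambda>i. if i = 0 then 0 else c (i - 1)) =
        (\<Sum>i<Suc n. to_ac (if i = 0 then 0 else c (i - 1)) * \<beta> ^ i)"
      by (subst comb_def) (simp only: n)
    then show ?thesis unfolding sum.lessThan_Suc_shift by simp
  qed
  also have "to_ac (c n) * \<beta> ^ m = comb (\<lambda>i. c n * d i)"
    unfolding d comb_def to_ac_mult sum_distrib_left mult.assoc ..
  finally show ?thesis unfolding comb_add by blast
qed

lemma comb_inj: "inj_on comb (PiE {..<m} (\<lambda>_. UNIV))"
proof (rule inj_onI)
  fix c d :: "nat \<Rightarrow> bit" assume cd: "c \<in> PiE {..<m} (\<lambda>_. UNIV)" "d \<in> PiE {..<m} (\<lambda>_. UNIV)" "comb c = comb d"
  have "comb (\<lambda>i. c i + d i) = 0"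
    unfolding comb_add[symmetric] cd(3) by (rule char2_add_self[OF two_L])
  then have "c i + d i = 0" if "i < m" for i using comb_zero that by blast
  then have "c i = d i" if "i < m" for i
    using that by (cases "c i"; cases "d i") force+
  then show "c = d" using cd(1,2) by (intro PiE_ext) auto
qed

lemma range_comb: "range comb = comb ` (PiE {..<m} (\<lambda>_. UNIV))"
proof -
  have "comb c = comb (restrict c {..<m})" for c by (simp add: comb_def)
  then show ?thesis by (metis (no_types, lifting) image_iff restrict_PiE_iff UNIV_I subsetI subset_antisym image_subsetI rangeI)
qed

lemma card_bit: "card (UNIV :: bit set) = 2" "finite (UNIV :: bit set)"
proof -
  have *: "(UNIV :: bit set) = {0, 1}" using bit.exhaust by auto
  then show "card (UNIV :: bit set) = 2" "finite (UNIV :: bit set)" unfolding * by (simp_all add: card_insert_if)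
qed

lemma finite_range_comb: "finite (range comb)"
  unfolding range_comb using card_bit by (intro finite_imageI finite_PiE) auto

lemma card_range_comb: "card (range comb) = 2 ^ m"
  unfolding range_comb by (simp add: card_image[OF comb_inj] card_PiE card_bit)

text \<open>Multiplication by a non-zero \<beta> permutes the 2^m - 1 non-zero values of
  \<open>comb\<close>; comparing the products of these values before and after gives \<beta>^(2^m -
  1) = 1.\<close>

lemma frobenius_m: "\<beta> ^ (2 ^ m) = \<beta>"
proof (cases "\<beta> = 0")
  case False
  let ?V = "range comb - {0}"
  have fin: "finite ?V" using finite_range_comb by simp
  have inj: "inj_on ((*) \<beta>) ?V" using False by (simp add: inj_on_def)
  have "(*) \<beta> ` ?V \<subseteq> ?V" using mult_comb False by auto
  then have im: "(*) \<beta> ` ?V = ?V" by (rule endo_inj_surj[OF fin _ inj])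
  have z: "0 \<in> range comb" unfolding comb_def by (rule range_eqI[of _ _ "\<lambda>_. 0"]) simp
  have "(\<Prod>v\<in>?V. v) = (\<Prod>v\<in>(*) \<beta> ` ?V. v)" by (simp only: im)
  also have "\<dots> = (\<Prod>v\<in>?V. \<beta> * v)" using inj by (subst prod.reindex) auto
  also have "\<dots> = \<beta> ^ card ?V * (\<Prod>v\<in>?V. v)" by (simp add: prod.distrib)
  finally have "\<beta> ^ card ?V = 1" using fin by simp
  moreover have "card ?V = 2 ^ m - 1" using z finite_range_comb card_range_comb by simp
  ultimately have "\<beta> ^ (2 ^ m - 1) * \<beta> = \<beta>" by simp
  moreover have "Suc (2 ^ m - 1) = (2::nat) ^ m" by simp
  ultimately show ?thesis by (metis power_Suc2)
qed simp

text \<open>If \<beta> were fixed, so would be all 2^m values of \<open>comb\<close>, but X^(2^k) -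
  X has at most 2^k roots.\<close>

lemma frobenius_less_m:
  assumes "0 < k" "k < m"
  shows "\<beta> ^ (2 ^ k) \<noteq> \<beta>"
proof
  assume b: "\<beta> ^ (2 ^ k) = \<beta>"
  define p :: "L poly" where "p = Polynomial.monom 1 (2 ^ k) - Polynomial.monom 1 1"
  have "(1::nat) < 2 ^ k" using assms by (intro one_less_power) auto
  then have cp: "coeff p (2 ^ k) = 1" by (simp add: p_def)
  then have p0: "p \<noteq> 0" by auto
  have deg: "Polynomial.degree p \<le> 2 ^ k"
    unfolding p_def by (rule degree_diff_le) (auto simp: degree_monom_eq)
  have "(\<beta> ^ i) ^ (2 ^ k) = \<beta> ^ i" for i using b by (metis mult.commute power_mult)
  moreover have "(to_ac (b::bit)) ^ (2 ^ k) = to_ac b" for b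
    using to_ac_bit_cases[of b] by auto
  ultimately have "comb c ^ (2 ^ k) = comb c" for c
    unfolding comb_def char2_frobenius_sum[OF two_L] by (simp add: power_mult_distrib)
  then have "range comb \<subseteq> {x. poly p x = 0}" by (auto simp: p_def poly_monom)
  then have "2 ^ m \<le> card {x. poly p x = 0}"
    using card_mono[OF poly_roots_finite[OF p0]] card_range_comb by metis
  also have "\<dots> \<le> 2 ^ k" using card_poly_roots_bound[OF p0] deg by simp
  finally show False using assms by simp
qed

end

section \<open>Coefficients of polynomials and the ring O\<close>

lemma two_pol: "(2::pol) = 0"
  by (metis single_numeral single_zero two_L)

definition expo :: "nat \<Rightarrow> nat \<Rightarrow> nat \<Rightarrow> (var \<Rightarrow>\<^sub>0 nat)" where
  "expo a b c = Poly_Mapping.single VX a + Poly_Mapping.single VY b + Poly_Mapping.single VZ c"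

lemma lookup_expo [simp]:
  "Poly_Mapping.lookup (expo a b c) VX = a" "Poly_Mapping.lookup (expo a b c) VY = b" "Poly_Mapping.lookup (expo a b c) VZ = c"
  by (simp_all add: expo_def lookup_add lookup_single)

lemma expo_lookup: "expo (Poly_Mapping.lookup e VX) (Poly_Mapping.lookup e VY) (Poly_Mapping.lookup e VZ) = e"
proof (rule poly_mapping_eqI)
  show "Poly_Mapping.lookup (expo (Poly_Mapping.lookup e VX) (Poly_Mapping.lookup e VY) (Poly_Mapping.lookup e VZ)) k = Poly_Mapping.lookup e k" for k
    by (cases k) simp_all
qed

lemma expo_cases: obtains a b c where "e = expo a b c"
  using expo_lookup[of e] by metis

lemma expo_eq_iff [simp]: "expo a b c = expo a' b' c' \<longleftrightarrow> a = a' \<and> b = b' \<and> c = c'"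
  by (metis lookup_expo)

lemma expo_add: "expo a b c + expo a' b' c' = expo (a + a') (b + b') (c + c')"
  by (simp add: expo_def single_add ac_simps)

lemma expo_zero: "expo 0 0 0 = 0"
  by (simp add: expo_def)

lemma mon_deg_expo [simp]: "mon_deg (expo a b c) = a + b + c"
  by (simp add: mon_deg_def)

definition cf :: "pol \<Rightarrow> nat \<Rightarrow> nat \<Rightarrow> nat \<Rightarrow> L" where
  "cf p a b c = Poly_Mapping.lookup p (expo a b c)"

lemma cf_eqI: "(\<And>a b c. cf p a b c = cf q a b c) \<Longrightarrow> p = q"
  by (rule poly_mapping_eqI) (metis cf_def expo_cases)

lemma cf_zero [simp]: "cf 0 a b c = 0"
  and cf_add [simp]: "cf (p + q) a b c = cf p a b c + cf q a b c"
  and cf_diff [simp]: "cf (p - q) a b c = cf p a b c - cf q a b c"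
  and cf_sum: "cf (\<Sum>i\<in>A. f i) a b c = (\<Sum>i\<in>A. cf (f i) a b c)"
  by (simp_all add: cf_def lookup_add lookup_minus lookup_sum)

lemma cf_single: "cf (Poly_Mapping.single (expo i j k) d) a b c = (if a = i \<and> b = j \<and> c = k then d else 0)"
  by (auto simp: cf_def lookup_single when_def)

lemma pol_expand: "p = (\<Sum>e\<in>Poly_Mapping.keys p. Poly_Mapping.single e (Poly_Mapping.lookup p e))"
  by (rule poly_mapping_eqI)
    (simp add: lookup_sum lookup_single when_def in_keys_iff cong: if_cong)

lemma pol_induct [case_names mono add]:
  assumes "\<And>a b c d. P (Poly_Mapping.single (expo a b c) d)" "\<And>p q. P p \<Longrightarrow> P q \<Longrightarrow> P (p + q :: pol)"
  shows "P p"
proof -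
  have z: "P 0" using assms(1)[of 0 0 0 0] by simp
  have "P (Poly_Mapping.single e (Poly_Mapping.lookup p e))" for e
    using assms(1) expo_cases[of e] by metis
  then have "P (\<Sum>e\<in>A. Poly_Mapping.single e (Poly_Mapping.lookup p e))" for A
    using z assms(2) by (induction A rule: infinite_finite_induct) auto
  then show ?thesis using pol_expand by metis
qed

lemma monomial_eq: "xx ^ a * yy ^ b * zz ^ c = Poly_Mapping.single (expo a b c) 1"
proof -
  have "(Poly_Mapping.single (Poly_Mapping.single t 1) 1 :: pol) ^ n = Poly_Mapping.single (Poly_Mapping.single t n) 1" for t n
    by (induction n) (simp_all add: mult_single flip: single_add)
  then show ?thesis by (simp add: Var_def mult_single expo_def)
qed

lemma monomial_xy: "xx ^ a * yy ^ b = Poly_Mapping.single (expo a b 0) 1"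
  using monomial_eq[of a b 0] by simp

lemma Const_monomial: "Const d * (xx ^ a * yy ^ b * zz ^ c) = Poly_Mapping.single (expo a b c) d"
  by (simp add: monomial_eq Const_def mult_single)

lemma cf_single_mult:
  "cf (Poly_Mapping.single (expo i j k) d * p) a b c =
     (if i \<le> a \<and> j \<le> b \<and> k \<le> c then d * cf p (a - i) (b - j) (c - k) else 0)"
proof (induction p rule: pol_induct)
  case (mono a' b' c' d')
  show ?case unfolding mult_single expo_add cf_single by auto
next
  case (add p q)
  then show ?case by (simp add: distrib_left)
qed

lemma cf_monomial_mult:
  "cf (xx ^ i * yy ^ j * zz ^ k * p) a b c =
     (if i \<le> a \<and> j \<le> b \<and> k \<le> c then cf p (a - i) (b - j) (c - k) else 0)"
  unfolding monomial_eq cf_single_mult by simp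

lemma cf_xy_mult:
  "cf (xx ^ i * yy ^ j * p) a b c = (if i \<le> a \<and> j \<le> b then cf p (a - i) (b - j) c else 0)"
  unfolding monomial_xy cf_single_mult by simp

lemma cf_xy: "cf (xx ^ i * yy ^ j) a b c = (if a = i \<and> b = j \<and> c = 0 then 1 else 0)"
  unfolding monomial_xy cf_single ..

lemma cf_monomial: "cf (xx ^ i * yy ^ j * zz ^ k) a b c = (if a = i \<and> b = j \<and> c = k then 1 else 0)"
  unfolding monomial_eq cf_single ..

lemma cf_Const_mult [simp]: "cf (Const d * p) a b c = d * cf p a b c"
  unfolding Const_def using cf_single_mult[of 0 0 0 d p a b c] by (simp add: expo_zero)

text \<open>Squaring is additive, so it acts term by term. Both the expansion of z^(2^n) and the
  coefficients of powers of P rest on this.\<close>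

lemma cf_square:
  "cf (p\<^sup>2) a b c = (if even a \<and> even b \<and> even c then (cf p (a div 2) (b div 2) (c div 2))\<^sup>2 else 0)"
proof (induction p rule: pol_induct)
  case (mono i j k d)
  have "(Poly_Mapping.single (expo i j k) d :: pol)\<^sup>2 = Poly_Mapping.single (expo (2 * i) (2 * j) (2 * k)) (d\<^sup>2)"
    by (simp add: power2_eq_square mult_single expo_add mult_2)
  then show ?case by (auto simp: cf_single elim!: evenE)
next
  case (add p q)
  then show ?case by (simp add: char2_square_add[OF two_pol] char2_square_add[OF two_L])
qed

lemma homogeneous_iff: "homogeneous n p \<longleftrightarrow> (\<forall>a b c. cf p a b c \<noteq> 0 \<longrightarrow> a + b + c = n)"
proof -
  have "homogeneous n p \<longleftrightarrow> (\<forall>e. Poly_Mapping.lookup p e \<noteq> 0 \<longrightarrow> mon_deg e = n)"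
    by (auto simp: homogeneous_def in_keys_iff)
  also have "\<dots> \<longleftrightarrow> (\<forall>a b c. cf p a b c \<noteq> 0 \<longrightarrow> a + b + c = n)"
    unfolding cf_def by (metis expo_cases mon_deg_expo)
  finally show ?thesis .
qed

lemma homogeneous_add: "homogeneous n p \<Longrightarrow> homogeneous n q \<Longrightarrow> homogeneous n (p + q)"
  unfolding homogeneous_iff by (metis add_0 cf_add)

lemma homogeneous_mult:
  assumes "homogeneous n p" "homogeneous k q"
  shows "homogeneous (n + k) (p * q)"
  unfolding homogeneous_def
proof
  fix e assume "e \<in> Poly_Mapping.keys (p * q)"
  then obtain f g where "e = f + g" "f \<in> Poly_Mapping.keys p" "g \<in> Poly_Mapping.keys q"
    using keys_mult by blast
  moreover have "mon_deg (f + g) = mon_deg f + mon_deg g"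
    by (simp add: mon_deg_def lookup_add)
  ultimately show "mon_deg e = n + k"
    using assms unfolding homogeneous_def by simp
qed

lemma homogeneous_power: "homogeneous n p \<Longrightarrow> homogeneous (k * n) (p ^ k)"
proof (induction k)
  case 0
  then show ?case using cf_xy[of 0 0] by (simp add: homogeneous_iff)
next
  case (Suc k)
  then show ?case using homogeneous_mult[of n p "k * n" "p ^ k"] by simp
qed

lemma homogeneous_monomial: "homogeneous (a + b + c) (xx ^ a * yy ^ b * zz ^ c)"
  by (simp add: homogeneous_iff cf_monomial)

lemma homogeneous_xy: "homogeneous (a + b) (xx ^ a * yy ^ b)"
  by (simp add: homogeneous_iff cf_xy)

lemma homogeneous_Const_mult: "homogeneous n p \<Longrightarrow> homogeneous n (Const c * p)"
  by (auto simp: homogeneous_iff)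

lemma P_pol_eq:
  "P_pol = xx ^ 0 * yy ^ 0 * zz ^ 4 + xx ^ 1 * yy ^ 1 * zz ^ 2 + xx ^ 3 * yy ^ 0 * zz ^ 1 + xx ^ 0 * yy ^ 3 * zz ^ 1"
  by (simp add: P_pol_def)

lemma homogeneous_P: "homogeneous 4 P_pol"
  unfolding P_pol_eq homogeneous_iff cf_add cf_monomial by auto

lemma homogeneous_P_power: "homogeneous (i + j + 4 * k) (xx ^ i * yy ^ j * P_pol ^ k)"
  using homogeneous_mult[OF homogeneous_xy homogeneous_power[OF homogeneous_P]] by (simp add: mult.commute)

lemma v_pol_eq: "v_pol Q = xx ^ 1 * yy ^ (3 * Q + 1) * zz ^ (3 * Q)"
  by (simp add: v_pol_def power_mult_distrib algebra_simps)

lemma homogeneous_v: "homogeneous (6 * Q + 2) (v_pol Q)"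
  using homogeneous_monomial[of 1 "3 * Q + 1" "3 * Q"] unfolding v_pol_eq by (simp add: algebra_simps)

text \<open>The ideal \<open>(x\<^bsup>4Q\<^esup>, y\<^bsup>4Q\<^esup>, z\<^bsup>4Q\<^esup>)\<close>, described by the coefficients that vanish on it.\<close>

definition small_zero :: "nat \<Rightarrow> pol set" where
  "small_zero Q = {p. \<forall>a<4 * Q. \<forall>b<4 * Q. \<forall>c<4 * Q. cf p a b c = 0}"

lemma small_zeroD: "p \<in> small_zero Q \<Longrightarrow> a < 4 * Q \<Longrightarrow> b < 4 * Q \<Longrightarrow> c < 4 * Q \<Longrightarrow> cf p a b c = 0"
  by (simp add: small_zero_def)

lemma small_zero_0 [simp]: "0 \<in> small_zero Q"
  and small_zero_add: "p \<in> small_zero Q \<Longrightarrow> q \<in> small_zero Q \<Longrightarrow> p + q \<in> small_zero Q"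
  and small_zero_diff: "p \<in> small_zero Q \<Longrightarrow> q \<in> small_zero Q \<Longrightarrow> p - q \<in> small_zero Q"
  by (simp_all add: small_zero_def)

lemma small_zero_sum: "(\<And>i. i \<in> A \<Longrightarrow> f i \<in> small_zero Q) \<Longrightarrow> (\<Sum>i\<in>A. f i) \<in> small_zero Q"
  by (simp add: small_zero_def cf_sum)

text \<open>A monomial factor moves coefficients only towards larger exponents, so the box of
  exponents below 4Q receives coefficients from inside the box alone.\<close>

lemma small_zero_mult: "p \<in> small_zero Q \<Longrightarrow> r * p \<in> small_zero Q"
proof (induction r rule: pol_induct)
  case (mono i j k d)
  then show ?case by (simp add: small_zero_def cf_single_mult)
next
  case (add r s)
  then show ?case by (simp add: distrib_right small_zero_add)
qed

lemma LXYZ_simps [simp]: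
  "carrier LXYZ = UNIV" "x \<otimes>\<^bsub>LXYZ\<^esub> y = x * y" "x \<oplus>\<^bsub>LXYZ\<^esub> y = x + y" "\<zero>\<^bsub>LXYZ\<^esub> = 0" "\<one>\<^bsub>LXYZ\<^esub> = 1"
  by (simp_all add: ring_of_type_algebra_def)

interpretation LXYZ: cring LXYZ
  by (rule cring_from_type_algebra)

lemma LXYZ_minus: "\<ominus>\<^bsub>LXYZ\<^esub> x = - x"
  by (rule LXYZ.minus_equality) simp_all

lemma LXYZ_idealI:
  assumes "0 \<in> I" "\<And>p q. p \<in> I \<Longrightarrow> q \<in> I \<Longrightarrow> p + q \<in> I" "\<And>p r. p \<in> I \<Longrightarrow> r * p \<in> I"
  shows "ideal I LXYZ"
proof (rule idealI[OF LXYZ.ring_axioms])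
  show "subgroup I (add_monoid LXYZ)"
  proof
    fix x assume "x \<in> I"
    then have "- x \<in> I" using assms(3)[of x "- 1"] by simp
    moreover have "inv\<^bsub>add_monoid LXYZ\<^esub> x = - x"
      using LXYZ_minus[of x] by (simp add: a_inv_def)
    ultimately show "inv\<^bsub>add_monoid LXYZ\<^esub> x \<in> I" by simp
  qed (use assms in auto)
qed (use assms in \<open>auto simp: mult.commute\<close>)

text \<open>The ideal is generated by monomials, so a polynomial lies in it exactly if each of its
  terms does. From here on, equality in O is a condition on coefficients.\<close>

lemma O_ideal_eq: "O_ideal Q = small_zero Q"
proof
  have "ideal (small_zero Q) LXYZ"
    by (rule LXYZ_idealI) (simp_all add: small_zero_add small_zero_mult)
  moreover have "{xx ^ (4 * Q), yy ^ (4 * Q), zz ^ (4 * Q)} \<subseteq> small_zero Q"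
    using cf_monomial[of "4 * Q" 0 0] cf_monomial[of 0 "4 * Q" 0] cf_monomial[of 0 0 "4 * Q"]
    by (auto simp: small_zero_def)
  ultimately show "O_ideal Q \<subseteq> small_zero Q"
    unfolding O_ideal_def by (rule LXYZ.genideal_minimal)
next
  have I: "ideal (O_ideal Q) LXYZ"
    unfolding O_ideal_def by (rule LXYZ.genideal_ideal) simp
  interpret I: ideal "O_ideal Q" LXYZ by (rule I)
  have gens: "xx ^ (4 * Q) \<in> O_ideal Q" "yy ^ (4 * Q) \<in> O_ideal Q" "zz ^ (4 * Q) \<in> O_ideal Q"
    using LXYZ.genideal_self[of "{xx ^ (4 * Q), yy ^ (4 * Q), zz ^ (4 * Q)}"] unfolding O_ideal_def by auto
  have mul: "r * p \<in> O_ideal Q" if "p \<in> O_ideal Q" for r p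
    using I.I_l_closed[OF that, of r] by simp
  have add: "p + r \<in> O_ideal Q" if "p \<in> O_ideal Q" "r \<in> O_ideal Q" for r p
    using I.a_closed[OF that] by simp
  have zero: "0 \<in> O_ideal Q" using I.zero_closed by simp
  show "small_zero Q \<subseteq> O_ideal Q"
  proof
    fix p assume p: "p \<in> small_zero Q"
    have "Poly_Mapping.single e (Poly_Mapping.lookup p e) \<in> O_ideal Q" for e
    proof -
      obtain a b c where e: "e = expo a b c" by (rule expo_cases)
      have s: "Poly_Mapping.single e (Poly_Mapping.lookup p e) = Const (cf p a b c) * (xx ^ a * yy ^ b * zz ^ c)"
        by (simp add: Const_monomial e cf_def)
      consider "cf p a b c = 0" | "a \<ge> 4 * Q" | "b \<ge> 4 * Q" | "c \<ge> 4 * Q"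
        using small_zeroD[OF p, of a b c] by linarith
      then show ?thesis
      proof cases
        case 1
        then show ?thesis unfolding s using zero by (simp add: Const_def)
      next
        case 2
        have "Const (cf p a b c) * (xx ^ a * yy ^ b * zz ^ c) =
          (Const (cf p a b c) * xx ^ (a - 4 * Q) * yy ^ b * zz ^ c) * xx ^ (4 * Q)"
          using power_add[of xx "a - 4 * Q" "4 * Q"] 2 by (simp add: mult_ac)
        then show ?thesis unfolding s using mul[OF gens(1)] by metis
      next
        case 3
        have "Const (cf p a b c) * (xx ^ a * yy ^ b * zz ^ c) =
          (Const (cf p a b c) * xx ^ a * yy ^ (b - 4 * Q) * zz ^ c) * yy ^ (4 * Q)"
          using power_add[of yy "b - 4 * Q" "4 * Q"] 3 by (simp add: mult_ac)
        then show ?thesis unfolding s using mul[OF gens(2)] by metis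
      next
        case 4
        have "Const (cf p a b c) * (xx ^ a * yy ^ b * zz ^ c) =
          (Const (cf p a b c) * xx ^ a * yy ^ b * zz ^ (c - 4 * Q)) * zz ^ (4 * Q)"
          using power_add[of zz "c - 4 * Q" "4 * Q"] 4 by (simp add: mult_ac)
        then show ?thesis unfolding s using mul[OF gens(3)] by metis
      qed
    qed
    then have "(\<Sum>e\<in>A. Poly_Mapping.single e (Poly_Mapping.lookup p e)) \<in> O_ideal Q" for A
      using add zero by (induction A rule: infinite_finite_induct) auto
    then show "p \<in> O_ideal Q" using pol_expand by metis
  qed
qed

lemma O_ideal_ideal: "ideal (O_ideal Q) LXYZ"
  unfolding O_ideal_def by (rule LXYZ.genideal_ideal) simp

lemma cls_eq: "cls Q p = {r + p | r. r \<in> small_zero Q}"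
  unfolding cls_def O_ideal_eq a_r_coset_def' by auto

lemma cls_eq_iff: "cls Q p = cls Q q \<longleftrightarrow> p - q \<in> small_zero Q"
proof
  assume "cls Q p = cls Q q"
  moreover have "p \<in> cls Q p" unfolding cls_eq using small_zero_0 by force
  ultimately obtain r where "r \<in> small_zero Q" "p = r + q" unfolding cls_eq by auto
  then show "p - q \<in> small_zero Q" by simp
next
  assume d: "p - q \<in> small_zero Q"
  have "r + p = (r + (p - q)) + q" "r + q = (r - (p - q)) + p" for r by simp_all
  then show "cls Q p = cls Q q"
    unfolding cls_eq using d small_zero_add small_zero_diff by blast
qed

lemma cls_mult: "cls Q p \<otimes>\<^bsub>O_ring Q\<^esub> cls Q q = cls Q (p * q)"
  unfolding O_ring_def cls_def FactRing_def
  using ideal.rcoset_mult_add[OF O_ideal_ideal, of p q] by simp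

lemma cls_add: "cls Q p \<oplus>\<^bsub>O_ring Q\<^esub> cls Q q = cls Q (p + q)"
  unfolding O_ring_def cls_def FactRing_def
  using abelian_subgroup.a_rcos_sum[OF abelian_subgroupI3[OF ideal.axioms(1)[OF O_ideal_ideal] LXYZ.abelian_group_axioms], of p q]
  by simp

lemma O_ring_carrier: "carrier (O_ring Q) = range (cls Q)"
  unfolding O_ring_def FactRing_def A_RCOSETS_def' cls_def by auto

section \<open>The expansion of R in powers of P\<close>

text \<open>The polynomial \<open>balanced 1 N\<close> is \<open>(x\<^bsup>N+3\<^esup> - y\<^bsup>N+3\<^esup>) / (x\<^sup>3 - y\<^sup>3)\<close> for \<open>N\<close> divisible by 3; the parameter \<open>d\<close>
  describes its images under Frobenius.\<close>

definition balanced :: "nat \<Rightarrow> nat \<Rightarrow> pol" where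
  "balanced d N = (\<Sum>a \<in> {a. a \<le> N \<and> d dvd a \<and> d dvd N - a \<and> a mod 3 = (N - a) mod 3}. xx ^ a * yy ^ (N - a))"

lemma cf_balanced:
  "cf (balanced d N) a b c = (if c = 0 \<and> a + b = N \<and> d dvd a \<and> d dvd b \<and> a mod 3 = b mod 3 then 1 else 0)"
proof -
  let ?A = "{a. a \<le> N \<and> d dvd a \<and> d dvd N - a \<and> a mod 3 = (N - a) mod 3}"
  have fin: "finite ?A" by (rule finite_subset[of _ "{..N}"]) auto
  have "cf (balanced d N) a b c = (\<Sum>i\<in>?A. if i = a then (if b = N - a \<and> c = 0 then 1 else 0) else 0)"
    unfolding balanced_def cf_sum cf_xy by (intro sum.cong) auto
  also have "\<dots> = (if a \<in> ?A then (if b = N - a \<and> c = 0 then 1 else 0) else 0)"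
    using fin by (simp add: sum.delta)
  finally have *: "cf (balanced d N) a b c = (if a \<in> ?A then (if b = N - a \<and> c = 0 then 1 else 0) else 0)" .
  show ?thesis
  proof (cases "a + b = N")
    case True
    then have "N - a = b" "a \<le> N" by auto
    then show ?thesis unfolding * mem_Collect_eq using True by simp
  next
    case False
    then have "\<not> (a \<le> N \<and> b = N - a)" by auto
    then have "cf (balanced d N) a b c = 0" unfolding * mem_Collect_eq by (simp split: if_splits)
    then show ?thesis using False by simp
  qed
qed

lemma balanced_0 [simp]: "balanced d 0 = 1"
  using cf_xy[of 0 0] by (intro cf_eqI) (auto simp: cf_balanced)

text \<open>Doubling both exponents neither creates nor destroys a congruence modulo 3, because 2 is
  invertible there.\<close>

lemma balanced_square: "(balanced d N)\<^sup>2 = balanced (2 * d) (2 * N)"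
proof (rule cf_eqI)
  fix a b c
  show "cf ((balanced d N)\<^sup>2) a b c = cf (balanced (2 * d) (2 * N)) a b c"
  proof (cases "even a \<and> even b \<and> even c")
    case True
    then obtain a' b' c' where abc: "a = 2 * a'" "b = 2 * b'" "c = 2 * c'" by (auto elim!: evenE)
    have "2 * a' + 2 * b' = 2 * N \<longleftrightarrow> a' + b' = N" "2 * c' = 0 \<longleftrightarrow> c' = 0" by linarith+
    then show ?thesis unfolding cf_square cf_balanced abc mod3_double by simp
  next
    case False
    then have "\<not> (c = 0 \<and> 2 * d dvd a \<and> 2 * d dvd b)"
      using dvd_mult_left[of 2 d] by auto
    then show ?thesis unfolding cf_square cf_balanced using False by auto
  qed
qed

text \<open>In even degree the two exponents have the same parity; the terms with both odd carry the
  factor xy, and removing it preserves the difference of the exponents.\<close>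

lemma balanced_even:
  "balanced 1 (2 * N + 2) = balanced 2 (2 * N) * (xx * yy) + balanced 2 (2 * N + 2)"
proof (rule cf_eqI)
  fix a b c
  have eq: "balanced 2 (2 * N) * (xx * yy) = xx ^ 1 * yy ^ 1 * balanced 2 (2 * N)"
    by (simp add: mult_ac)
  show "cf (balanced 1 (2 * N + 2)) a b c = cf (balanced 2 (2 * N) * (xx * yy) + balanced 2 (2 * N + 2)) a b c"
  proof (cases "c = 0 \<and> a + b = 2 * N + 2")
    case True
    then have par: "even a \<longleftrightarrow> even b" by presburger
    show ?thesis
    proof (cases "even a")
      case True
      then have "\<not> (1 \<le> a \<and> 1 \<le> b \<and> 2 dvd a - 1)" by auto
      then show ?thesis unfolding eq cf_add cf_xy_mult cf_balanced using True par by auto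
    next
      case False
      then have o: "1 \<le> a" "1 \<le> b" "even (a - 1)" "even (b - 1)" using par by (auto elim!: oddE)
      have s: "a - 1 + (b - 1) = 2 * N \<longleftrightarrow> a + b = 2 * N + 2" using o by auto
      show ?thesis unfolding eq cf_add cf_xy_mult cf_balanced s using o False mod3_diff[OF o(1,2)] by simp
    qed
  next
    case False
    then show ?thesis unfolding eq cf_add cf_xy_mult cf_balanced by auto
  qed
qed

text \<open>In odd degree exactly one exponent is odd, and lowering it by 3 makes it even without
  changing its residue modulo 3. Only an exponent 1 could not be lowered; it would need 1 congruent
  to 2N + 2 modulo 3, which the assumption excludes.\<close>

lemma balanced_odd:
  assumes "N mod 3 \<noteq> 1"
  shows "balanced 1 (2 * N + 3) = balanced 2 (2 * N) * (xx ^ 3 + yy ^ 3)"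
proof (rule cf_eqI)
  fix a b c :: nat
  have eq: "balanced 2 (2 * N) * (xx ^ 3 + yy ^ 3) =
      xx ^ 3 * yy ^ 0 * balanced 2 (2 * N) + xx ^ 0 * yy ^ 3 * balanced 2 (2 * N)"
    by (simp add: distrib_left mult.commute)
  have m3: "(d - 3) mod 3 = d mod 3" if "3 \<le> d" for d :: nat
    using that le_mod_geq by metis
  have one: "\<not> (1 mod 3 = (2 * N + 2) mod (3::nat))"
  proof
    assume "1 mod 3 = (2 * N + 2) mod (3::nat)"
    moreover have "2 * N + 2 = 2 * (N + 1)" "(1::nat) mod 3 = (2 * 2) mod 3" by simp_all
    ultimately have "(2 * 2) mod 3 = (2 * (N + 1)) mod (3::nat)" by (simp only:)
    then have "2 mod 3 = Suc N mod (3::nat)" unfolding mod3_double Suc_eq_plus1 .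
    then show False using assms mod_Suc[of N 3] by (cases "Suc (N mod 3) = 3") simp_all
  qed
  define P3 where "P3 \<longleftrightarrow> a mod 3 = b mod (3::nat)"
  have s1: "a - 3 + b = 2 * N \<longleftrightarrow> a + b = 2 * N + 3" "(a - 3) mod 3 = b mod 3 \<longleftrightarrow> P3" if "3 \<le> a"
    using that m3[OF that] by (auto simp: P3_def)
  have s2: "a + (b - 3) = 2 * N \<longleftrightarrow> a + b = 2 * N + 3" "a mod 3 = (b - 3) mod 3 \<longleftrightarrow> P3" if "3 \<le> b"
    using that m3[OF that] by (auto simp: P3_def)
  have L: "cf (balanced 1 (2 * N + 3)) a b c = (if c = 0 \<and> a + b = 2 * N + 3 \<and> P3 then 1 else 0)"
    unfolding cf_balanced P3_def by simp
  have R: "cf (balanced 2 (2 * N) * (xx ^ 3 + yy ^ 3)) a b c =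
      (if 3 \<le> a then if c = 0 \<and> a + b = 2 * N + 3 \<and> even (a - 3) \<and> even b \<and> P3 then 1 else 0 else 0) +
      (if 3 \<le> b then if c = 0 \<and> a + b = 2 * N + 3 \<and> even a \<and> even (b - 3) \<and> P3 then 1 else 0 else 0)"
    unfolding eq cf_add cf_xy_mult cf_balanced
    by (cases "3 \<le> a"; cases "3 \<le> b") (simp_all only: s1 s2 if_True if_False le0 diff_zero simp_thms)
  show "cf (balanced 1 (2 * N + 3)) a b c = cf (balanced 2 (2 * N) * (xx ^ 3 + yy ^ 3)) a b c"
  proof (cases "c = 0 \<and> a + b = 2 * N + 3 \<and> P3")
    case True
    then have par: "even a \<longleftrightarrow> odd b"
      by (metis even_add even_mult_iff even_numeral odd_numeral)
    show ?thesis
    proof (cases "even a")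
      case e: True
      have "3 \<le> b"
      proof (rule ccontr)
        assume "\<not> 3 \<le> b"
        then have "b = 1" using e par by (auto simp: not_le numeral_3_eq_3 less_Suc_eq)
        then have "a = 2 * N + 2" using True by simp
        then show False using True one \<open>b = 1\<close> unfolding P3_def by (metis (no_types))
      qed
      then have "even (b - 3)" using e par by (simp add: even_diff_nat)
      then show ?thesis unfolding L R using True \<open>3 \<le> b\<close> e par by simp
    next
      case e: False
      have "3 \<le> a"
      proof (rule ccontr)
        assume "\<not> 3 \<le> a"
        then have "a = 1" using e by (auto simp: not_le numeral_3_eq_3 less_Suc_eq)
        then have "b = 2 * N + 2" using True by simp
        then show False using True one \<open>a = 1\<close> unfolding P3_def by (metis (no_types))
      qed
      then have "even (a - 3)" using e par by (simp add: even_diff_nat)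
      then show ?thesis unfolding L R using True \<open>3 \<le> a\<close> e par by simp
    qed
  next
    case False
    then show ?thesis unfolding L R by auto
  qed
qed

lemma two_power_mod3: "(2 ^ n) mod 3 \<noteq> (0::nat)"
proof
  assume "(2 ^ n) mod 3 = (0::nat)"
  then have "3 dvd (2::nat) ^ n" by (simp add: dvd_eq_mod_eq_0)
  then have "(3::nat) dvd 2" by (rule prime_dvd_power[rotated]) simp
  then show False by simp
qed

text \<open>Squaring the expansion turns z^2 into z^4 = P + xyz^2 + (x^3 + y^3)z. The multiple of P
  becomes the new summand k = 0, the old summands move up by one, and \<open>balanced_even\<close>
  and \<open>balanced_odd\<close> regroup what is left at z^2 and z.\<close>

lemma zz_power_expansion:
  assumes "n \<ge> 1"
  shows "zz ^ (2 ^ n) = (\<Sum>k<n - 1. balanced (2 ^ (k + 1)) (2 ^ n - 2 ^ (k + 2)) * P_pol ^ (2 ^ k))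
     + balanced 1 (2 ^ n - 2) * zz\<^sup>2 + balanced 1 (2 ^ n - 1) * zz"
  using assms
proof (induction n rule: dec_induct)
  case base
  have "balanced 1 1 = 0" by (rule cf_eqI) (auto simp: cf_balanced add_is_1)
  then show ?case by simp
next
  case (step n)
  obtain l where l: "n = Suc l" using step(1) by (cases n) auto
  define N where "N = (2::nat) ^ n - 2"
  have N: "2 ^ n = N + 2" "2 ^ n - 2 = N" "2 ^ n - 1 = N + 1"
  proof -
    have "2 \<le> (2::nat) ^ n" unfolding l by simp
    then show "2 ^ n = N + 2" "2 ^ n - 2 = N" "2 ^ n - 1 = N + 1" unfolding N_def by linarith+
  qed
  have N3: "N mod 3 \<noteq> 1"
    using two_power_mod3[of n] mod_Suc[of "Suc N" 3] mod_Suc[of N 3] unfolding N(1) by auto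
  have N2: "2 ^ Suc n - 2 = 2 * N + 2" "2 ^ Suc n - 1 = 2 * N + 3" "2 ^ Suc n - 4 = 2 * N"
    using N(1) by auto
  let ?f = "\<lambda>n k. balanced (2 ^ (k + 1)) (2 ^ n - 2 ^ (k + 2)) * P_pol ^ (2 ^ k)"
  have "zz ^ (2 ^ Suc n) = (zz ^ (2 ^ n))\<^sup>2" by (simp add: mult.commute flip: power_mult)
  also have "\<dots> = (\<Sum>k<l. (?f n k)\<^sup>2) + (balanced 1 N)\<^sup>2 * (zz\<^sup>2)\<^sup>2 + (balanced 1 (N + 1))\<^sup>2 * zz\<^sup>2"
  proof -
    have "zz ^ (2 ^ n) = (\<Sum>k<l. ?f n k) + balanced 1 N * zz\<^sup>2 + balanced 1 (N + 1) * zz"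
      using step.IH unfolding N(2,3) by (simp only: l diff_Suc_1)
    moreover have "(\<Sum>k<l. ?f n k)\<^sup>2 = (\<Sum>k<l. (?f n k)\<^sup>2)"
      using char2_frobenius_sum[OF two_pol, of "?f n" "{..<l}" 1] by (simp only: power_one_right)
    ultimately show ?thesis
      by (simp only: char2_square_add[OF two_pol] power_mult_distrib[of _ zz] power_mult_distrib[of _ "zz\<^sup>2"])
  qed
  also have "(\<Sum>k<l. (?f n k)\<^sup>2) = (\<Sum>k<l. ?f (Suc n) (Suc k))"
  proof (rule sum.cong)
    fix k
    show "(?f n k)\<^sup>2 = ?f (Suc n) (Suc k)"
    proof -
      have "2 * (2 ^ n - 2 ^ (k + 2)) = (2::nat) ^ Suc n - 2 ^ (Suc k + 2)" "2 * 2 ^ (k + 1) = (2::nat) ^ (Suc k + 1)"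
        by simp_all
      moreover have "(P_pol ^ (2 ^ k))\<^sup>2 = P_pol ^ (2 ^ Suc k)" by (simp add: mult.commute flip: power_mult)
      ultimately show ?thesis by (simp only: power_mult_distrib balanced_square)
    qed
  qed simp
  also have "(balanced 1 N)\<^sup>2 = balanced 2 (2 * N)" by (simp add: balanced_square)
  also have "(balanced 1 (N + 1))\<^sup>2 = balanced 2 (2 * N + 2)" by (simp add: balanced_square)
  also have "(zz\<^sup>2)\<^sup>2 = zz ^ 4" by (simp flip: power_mult)
  also have "zz ^ 4 = P_pol + xx * yy * zz\<^sup>2 + (xx ^ 3 + yy ^ 3) * zz"
  proof -
    have "P_pol + xx * yy * zz\<^sup>2 + (xx ^ 3 + yy ^ 3) * zz = zz ^ 4 + (xx * yy * zz\<^sup>2 + xx * yy * zz\<^sup>2)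
      + ((xx ^ 3 + yy ^ 3) * zz + (xx ^ 3 + yy ^ 3) * zz)"
      by (simp add: P_pol_def algebra_simps)
    then show ?thesis by (simp only: char2_add_self[OF two_pol] add_0_right)
  qed
  finally have "zz ^ (2 ^ Suc n) = (balanced 2 (2 * N) * P_pol + (\<Sum>k<l. ?f (Suc n) (Suc k)))
    + (balanced 2 (2 * N) * (xx * yy) + balanced 2 (2 * N + 2)) * zz\<^sup>2
    + balanced 2 (2 * N) * (xx ^ 3 + yy ^ 3) * zz"
    by (simp only: distrib_left distrib_right ac_simps)
  also have "balanced 2 (2 * N) * P_pol + (\<Sum>k<l. ?f (Suc n) (Suc k)) = (\<Sum>k<Suc l. ?f (Suc n) k)"
    unfolding sum.lessThan_Suc_shift using N2(3) by simp
  finally show ?case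
    unfolding balanced_even[symmetric] balanced_odd[OF N3, symmetric] N2 using l by simp
qed

lemma cf_R:
  "cf (R_pol Q) a b c = (if (c = 1 \<or> c = 2) \<and> a + b + c = 4 * Q \<and> a mod 3 = b mod 3 then 1 else 0)"
proof -
  let ?A = "{(i, j, k). (k = 1 \<or> k = 2) \<and> i + j + k = 4 * Q \<and> i mod 3 = j mod 3}"
  have fin: "finite ?A"
    by (rule finite_subset[of _ "{..4 * Q} \<times> {..4 * Q} \<times> {..4 * Q}"]) auto
  have "cf (R_pol Q) a b c = (\<Sum>s\<in>?A. if s = (a, b, c) then 1 else 0)"
    unfolding R_pol_def cf_sum
  proof (rule sum.cong[OF refl])
    fix s
    show "cf (case s of (i, j, k) \<Rightarrow> xx ^ i * yy ^ j * zz ^ k) a b c = (if s = (a, b, c) then 1 else 0)"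
      by (cases s) (simp only: prod.case cf_monomial prod.inject eq_commute[of _ a] eq_commute[of _ b] eq_commute[of _ c])
  qed
  then show ?thesis using fin by (simp add: sum.delta)
qed

lemma R_pol_eq:
  assumes "Q \<ge> 1"
  shows "R_pol Q = balanced 1 (4 * Q - 2) * zz\<^sup>2 + balanced 1 (4 * Q - 1) * zz"
proof (rule cf_eqI)
  fix a b c
  have "balanced 1 (4 * Q - 2) * zz\<^sup>2 + balanced 1 (4 * Q - 1) * zz =
      xx ^ 0 * yy ^ 0 * zz ^ 2 * balanced 1 (4 * Q - 2) + xx ^ 0 * yy ^ 0 * zz ^ 1 * balanced 1 (4 * Q - 1)"
    by (simp add: mult.commute)
  then show "cf (R_pol Q) a b c = cf (balanced 1 (4 * Q - 2) * zz\<^sup>2 + balanced 1 (4 * Q - 1) * zz) a b c"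
    using assms by (simp only: cf_add cf_monomial_mult cf_R cf_balanced) auto
qed

lemma minus_pol: "(p :: pol) - q = p + q"
  using char2_add_self[OF two_pol, of q] by (simp add: diff_eq_eq add.assoc)

text \<open>This is the expansion of z^(4Q), where 4Q = 2^(m+1), read in O, where that power
  vanishes. Its last summand is P^Q with coefficient 1.\<close>

lemma R_congruence:
  assumes "m \<ge> 1" "Q = 2 ^ (m - 1)"
  shows "R_pol Q + (\<Sum>k<m. balanced (2 ^ (k + 1)) (4 * Q - 2 ^ (k + 2)) * P_pol ^ (2 ^ k)) \<in> small_zero Q"
proof -
  have q: "4 * Q = 2 ^ Suc m" using assms by (cases m) auto
  have "zz ^ (4 * Q) = (\<Sum>k<m. balanced (2 ^ (k + 1)) (4 * Q - 2 ^ (k + 2)) * P_pol ^ (2 ^ k)) + R_pol Q"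
  proof -
    have "1 \<le> Suc m" "1 \<le> Q" using assms(2) by simp_all
    from zz_power_expansion[OF this(1)] R_pol_eq[OF this(2)]
    show ?thesis unfolding q[symmetric] diff_Suc_1 by (simp only: add.assoc)
  qed
  moreover have "zz ^ (4 * Q) \<in> small_zero Q"
    using cf_monomial[of 0 0 "4 * Q"] by (simp add: small_zero_def)
  ultimately show ?thesis by (simp add: add.commute)
qed

section \<open>Multiplication by g\<close>

interpretation pol_vs: Vector_Spaces.vector_space "\<lambda>c (p :: pol). Const c * p"
  by (rule vector_space_pol)

lemma Const_add: "Const (a + b) = Const a + Const b"
  and Const_mult: "Const (a * b) = Const a * Const b"
  and Const_0 [simp]: "Const 0 = 0"
  by (simp_all add: Const_def single_add mult_single)

definition W0_set :: "nat \<Rightarrow> pol set" where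
  "W0_set Q = lspan {xx ^ i * yy ^ j * P_pol ^ k | i j k. i + j + 4 * k = 6 * Q - 5 \<and> k < Q - 1}"

text \<open>Congruence modulo \<open>gW\<^sub>0\<close> in \<open>\<O>\<close>.\<close>

definition gcong :: "L \<Rightarrow> nat \<Rightarrow> pol \<Rightarrow> pol \<Rightarrow> bool" where
  "gcong \<alpha> Q p q \<longleftrightarrow> (\<exists>w\<in>W0_set Q. p - q - g_pol \<alpha> * w \<in> small_zero Q)"

lemma W0_set_closed:
  "0 \<in> W0_set Q" "w \<in> W0_set Q \<Longrightarrow> w' \<in> W0_set Q \<Longrightarrow> w + w' \<in> W0_set Q"
  "w \<in> W0_set Q \<Longrightarrow> Const c * w \<in> W0_set Q"
  unfolding W0_set_def lspan_def by (simp_all add: pol_vs.span_zero pol_vs.span_add pol_vs.span_scale)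

lemma gcongI: "w \<in> W0_set Q \<Longrightarrow> p - q - g_pol \<alpha> * w \<in> small_zero Q \<Longrightarrow> gcong \<alpha> Q p q"
  unfolding gcong_def by blast

lemma gcong_small: "p + q \<in> small_zero Q \<Longrightarrow> gcong \<alpha> Q p q"
  by (rule gcongI[OF W0_set_closed(1)]) (simp add: minus_pol)

lemma gcong_refl: "gcong \<alpha> Q p p"
  by (rule gcongI[OF W0_set_closed(1)]) simp

lemma gcong_sym: "gcong \<alpha> Q p q \<Longrightarrow> gcong \<alpha> Q q p"
  unfolding gcong_def by (simp add: minus_pol add.commute)

lemma gcong_add: "gcong \<alpha> Q p q \<Longrightarrow> gcong \<alpha> Q p' q' \<Longrightarrow> gcong \<alpha> Q (p + p') (q + q')"
proof -
  assume "gcong \<alpha> Q p q" "gcong \<alpha> Q p' q'"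
  then obtain w w' where w: "w \<in> W0_set Q" "w' \<in> W0_set Q"
    "p - q - g_pol \<alpha> * w \<in> small_zero Q" "p' - q' - g_pol \<alpha> * w' \<in> small_zero Q"
    unfolding gcong_def by blast
  have eq: "p + p' - (q + q') - g_pol \<alpha> * (w + w') = (p - q - g_pol \<alpha> * w) + (p' - q' - g_pol \<alpha> * w')"
    by (simp add: algebra_simps)
  show ?thesis
    by (rule gcongI[OF W0_set_closed(2)[OF w(1,2)]], unfold eq, rule small_zero_add[OF w(3,4)])
qed

lemma gcong_trans [trans]: "gcong \<alpha> Q p q \<Longrightarrow> gcong \<alpha> Q q r \<Longrightarrow> gcong \<alpha> Q p r"
  using gcong_add[of \<alpha> Q p q q r] unfolding gcong_def by simp

lemma gcong_Const: "gcong \<alpha> Q p q \<Longrightarrow> gcong \<alpha> Q (Const c * p) (Const c * q)"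
proof -
  assume "gcong \<alpha> Q p q"
  then obtain w where w: "w \<in> W0_set Q" "p - q - g_pol \<alpha> * w \<in> small_zero Q"
    unfolding gcong_def by blast
  have eq: "Const c * p - Const c * q - g_pol \<alpha> * (Const c * w) = Const c * (p - q - g_pol \<alpha> * w)"
    by (simp add: algebra_simps)
  show ?thesis
    by (rule gcongI[OF W0_set_closed(3)[OF w(1), of c]], unfold eq, rule small_zero_mult[OF w(2)])
qed

lemma gcong_sum: "(\<And>i. i \<in> A \<Longrightarrow> gcong \<alpha> Q (f i) (h i)) \<Longrightarrow> gcong \<alpha> Q (\<Sum>i\<in>A. f i) (\<Sum>i\<in>A. h i)"
  by (induction A rule: infinite_finite_induct) (auto intro: gcong_add gcong_refl)

text \<open>P and \<alpha>x^2y^2 differ by g, so factors P are traded one at a time. Each trade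
  costs g times x^a y^b P^k with one factor P less; this multiplier must lie in W_0, whence the
  bound Q - 1 on the exponent.\<close>

lemma gcong_P_power:
  assumes "a + b + 4 * k = 6 * Q - 1" "k \<le> Q - 1"
  shows "gcong \<alpha> Q (xx ^ a * yy ^ b * P_pol ^ k) (Const (\<alpha> ^ k) * (xx ^ (a + 2 * k) * yy ^ (b + 2 * k)))"
  using assms
proof (induction k arbitrary: a b)
  case 0
  then show ?case by (simp add: Const_1 gcong_refl)
next
  case (Suc k)
  let ?w = "xx ^ a * yy ^ b * P_pol ^ k"
  have "?w \<in> W0_set Q"
    unfolding W0_set_def lspan_def by (rule pol_vs.span_base) (use Suc.prems in force)
  moreover have "xx ^ a * yy ^ b * P_pol ^ Suc k - Const \<alpha> * (xx ^ (a + 2) * yy ^ (b + 2) * P_pol ^ k) - g_pol \<alpha> * ?w = 0"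
    unfolding minus_pol by (simp add: g_pol_def algebra_simps power2_eq_square char2_add_self[OF two_pol])
  ultimately have "gcong \<alpha> Q (xx ^ a * yy ^ b * P_pol ^ Suc k) (Const \<alpha> * (xx ^ (a + 2) * yy ^ (b + 2) * P_pol ^ k))"
    by (intro gcongI[of ?w]) simp_all
  also have "gcong \<alpha> Q \<dots> (Const \<alpha> * (Const (\<alpha> ^ k) * (xx ^ (a + 2 + 2 * k) * yy ^ (b + 2 + 2 * k))))"
    by (rule gcong_Const, rule Suc.IH) (use Suc.prems in auto)
  also have "Const \<alpha> * (Const (\<alpha> ^ k) * (xx ^ (a + 2 + 2 * k) * yy ^ (b + 2 + 2 * k))) =
      Const (\<alpha> ^ Suc k) * (xx ^ (a + 2 * Suc k) * yy ^ (b + 2 * Suc k))"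
  proof -
    have "a + 2 + 2 * k = a + 2 * Suc k" "b + 2 + 2 * k = b + 2 * Suc k" by simp_all
    then show ?thesis by (simp only: power_Suc Const_mult mult.assoc)
  qed
  finally show ?case .
qed

lemma gcong_balanced_P_power:
  assumes "t + u + N + 4 * k = 6 * Q - 1" "k \<le> Q - 1"
  shows "gcong \<alpha> Q (xx ^ t * yy ^ u * (balanced d N * P_pol ^ k))
    (Const (\<alpha> ^ k) * (xx ^ (t + 2 * k) * yy ^ (u + 2 * k) * balanced d N))"
proof -
  let ?A = "{a. a \<le> N \<and> d dvd a \<and> d dvd N - a \<and> a mod 3 = (N - a) mod 3}"
  have "gcong \<alpha> Q (\<Sum>a\<in>?A. xx ^ (t + a) * yy ^ (u + (N - a)) * P_pol ^ k)
      (\<Sum>a\<in>?A. Const (\<alpha> ^ k) * (xx ^ (t + a + 2 * k) * yy ^ (u + (N - a) + 2 * k)))"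
    by (rule gcong_sum, rule gcong_P_power) (use assms in auto)
  also have "(\<Sum>a\<in>?A. xx ^ (t + a) * yy ^ (u + (N - a)) * P_pol ^ k) = xx ^ t * yy ^ u * (balanced d N * P_pol ^ k)"
    unfolding balanced_def sum_distrib_right sum_distrib_left power_add by (intro sum.cong refl) (simp only: ac_simps)
  also have "(\<Sum>a\<in>?A. Const (\<alpha> ^ k) * (xx ^ (t + a + 2 * k) * yy ^ (u + (N - a) + 2 * k))) =
      Const (\<alpha> ^ k) * (xx ^ (t + 2 * k) * yy ^ (u + 2 * k) * balanced d N)"
    unfolding balanced_def sum_distrib_right sum_distrib_left power_add by (intro sum.cong refl) (simp only: ac_simps)
  finally show ?thesis .
qed

text \<open>The product is x^t y^u P^Q plus \<alpha> x^(t+2) y^(u+2) P^(Q-1). The first term is out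
  of reach of \<open>gcong_P_power\<close> and is rewritten with \<open>R_congruence\<close>; the
  second one reduces to exactly the summand k = m - 1 that the rewriting leaves out.\<close>

lemma g_mult_E_balanced:
  assumes m: "m \<ge> 1" "Q = 2 ^ (m - 1)" and tu: "t + u = 2 * Q - 1"
  shows "gcong \<alpha> Q (g_pol \<alpha> * (xx ^ t * yy ^ u * P_pol ^ (Q - 1)))
    (xx ^ t * yy ^ u * R_pol Q + (\<Sum>k<m. Const (\<alpha> ^ (2 ^ k)) *
       (xx ^ (t + 2 ^ (k + 1)) * yy ^ (u + 2 ^ (k + 1)) * balanced (2 ^ (k + 1)) (4 * Q - 2 ^ (k + 2)))))"
proof -
  obtain n where n: "m = Suc n" using m by (cases m) auto
  have Q: "Q = 2 ^ n" "Q \<ge> 1" using m n by simp_all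
  have SQ: "Suc (Q - 1) = Q" using Q(2) by simp
  let ?X = "xx ^ t * yy ^ u"
  let ?U = "\<lambda>k. balanced (2 ^ (k + 1)) (4 * Q - 2 ^ (k + 2))"
  let ?V = "\<lambda>k. Const (\<alpha> ^ (2 ^ k)) * (xx ^ (t + 2 ^ (k + 1)) * yy ^ (u + 2 ^ (k + 1)) * ?U k)"
  have B: "gcong \<alpha> Q (?X * (?U k * P_pol ^ (2 ^ k))) (?V k)" if "k < n" for k
  proof -
    have "(2::nat) ^ (k + 1) \<le> 2 ^ n" using that by (intro power_increasing) auto
    then have k: "2 ^ k * 2 \<le> Q" unfolding Q by (simp add: mult.commute)
    have "gcong \<alpha> Q (?X * (?U k * P_pol ^ (2 ^ k)))
      (Const (\<alpha> ^ (2 ^ k)) * (xx ^ (t + 2 * 2 ^ k) * yy ^ (u + 2 * 2 ^ k) * ?U k))"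
    proof (rule gcong_balanced_P_power)
      show "t + u + (4 * Q - 2 ^ (k + 2)) + 4 * 2 ^ k = 6 * Q - 1"
        using tu k Q(2) by simp
      have "(1::nat) \<le> 2 ^ k" by simp
      then show "2 ^ k \<le> Q - 1" using k by linarith
    qed
    then show ?thesis by simp
  qed
  let ?S = "\<Sum>k<n. ?X * (?U k * P_pol ^ (2 ^ k))"
  have last: "?U n = 1" unfolding Q by simp
  have "gcong \<alpha> Q (?X * R_pol Q) (?S + ?X * P_pol ^ Q)"
  proof (rule gcong_small)
    have "?X * R_pol Q + (?S + ?X * P_pol ^ Q) = ?X * (R_pol Q + (\<Sum>k<m. ?U k * P_pol ^ (2 ^ k)))"
      unfolding n sum.lessThan_Suc last distrib_left sum_distrib_left Q by simp
    then show "?X * R_pol Q + (?S + ?X * P_pol ^ Q) \<in> small_zero Q"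
      using small_zero_mult[OF R_congruence[OF m]] by simp
  qed
  then have "gcong \<alpha> Q (?X * R_pol Q + (\<Sum>k<n. ?V k)) (?S + ?X * P_pol ^ Q + ?S)"
    by (rule gcong_add) (rule gcong_sym[OF gcong_sum], use B in simp)
  also have "?S + ?X * P_pol ^ Q + ?S = ?X * P_pol ^ Q"
    using char2_add_self[OF two_pol, of ?S] by (simp only: add.assoc add.left_commute[of ?S] add_0_right)
  finally have 1: "gcong \<alpha> Q (?X * P_pol ^ Q) (?X * R_pol Q + (\<Sum>k<n. ?V k))"
    by (rule gcong_sym)
  have "gcong \<alpha> Q (xx ^ (t + 2) * yy ^ (u + 2) * P_pol ^ (Q - 1))
      (Const (\<alpha> ^ (Q - 1)) * (xx ^ (t + 2 + 2 * (Q - 1)) * yy ^ (u + 2 + 2 * (Q - 1))))"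
    by (rule gcong_P_power) (use tu Q(2) in auto)
  then have "gcong \<alpha> Q (Const \<alpha> * (xx ^ (t + 2) * yy ^ (u + 2) * P_pol ^ (Q - 1)))
      (Const \<alpha> * (Const (\<alpha> ^ (Q - 1)) * (xx ^ (t + 2 + 2 * (Q - 1)) * yy ^ (u + 2 + 2 * (Q - 1)))))"
    by (rule gcong_Const)
  also have "Const \<alpha> * (Const (\<alpha> ^ (Q - 1)) * (xx ^ (t + 2 + 2 * (Q - 1)) * yy ^ (u + 2 + 2 * (Q - 1)))) = ?V n"
  proof -
    have "t + 2 + 2 * (Q - 1) = t + 2 ^ (n + 1)" "u + 2 + 2 * (Q - 1) = u + 2 ^ (n + 1)"
    proof -
      have "2 ^ (n + 1) = 2 * Q" using Q(1) by simp
      then show "t + 2 + 2 * (Q - 1) = t + 2 ^ (n + 1)" "u + 2 + 2 * (Q - 1) = u + 2 ^ (n + 1)"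
        using Q(2) by linarith+
    qed
    moreover have "Const \<alpha> * Const (\<alpha> ^ (Q - 1)) = Const (\<alpha> ^ (2 ^ n))"
      unfolding Q(1)[symmetric] Const_mult[symmetric] power_Suc[symmetric] SQ ..
    ultimately show ?thesis unfolding last by (simp only: mult.assoc[symmetric] mult_1_right)
  qed
  finally have 2: "gcong \<alpha> Q (Const \<alpha> * (xx ^ (t + 2) * yy ^ (u + 2) * P_pol ^ (Q - 1))) (?V n)" .
  have PQ: "P_pol ^ Q = P_pol * P_pol ^ (Q - 1)" unfolding power_Suc[symmetric] SQ ..
  have "g_pol \<alpha> * (?X * P_pol ^ (Q - 1)) = ?X * P_pol ^ Q + Const \<alpha> * (xx ^ (t + 2) * yy ^ (u + 2) * P_pol ^ (Q - 1))"
    unfolding PQ g_pol_def power_add distrib_right by (simp only: ac_simps)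
  then show ?thesis
    using gcong_add[OF 1 2] unfolding n sum.lessThan_Suc by (simp only: add.assoc)
qed

section \<open>Frobenius sums as coefficients of the F_j\<close>

definition frob_diff :: "L \<Rightarrow> nat \<Rightarrow> L" where
  "frob_diff \<beta> k = \<beta> ^ (2 ^ k) + \<beta>"

text \<open>The powers of 2 dividing d form an initial segment, so the sum telescopes up to
  ord_2(d). For d = 0 it runs over all k < m and gives \<beta>^(2^m) + \<beta> = 0, which produces
  the zero diagonal.\<close>

lemma sum_frobenius_dvd:
  fixes d :: int
  assumes \<alpha>: "\<alpha> = \<beta>\<^sup>2 + \<beta>" and \<beta>: "\<beta> ^ (2 ^ m) = \<beta>" and d: "\<bar>d\<bar> < 2 ^ m"
  shows "(\<Sum>k<m. if 2 ^ (k + 1) dvd d then \<alpha> ^ (2 ^ k) else 0) =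
    (if d = 0 then 0 else frob_diff \<beta> (multiplicity 2 d))"
proof (cases "d = 0")
  case True
  then show ?thesis
    using char2_artin_schreier_sum[OF two_L, of \<beta> m] \<beta> \<alpha> char2_add_self[OF two_L, of \<beta>] by simp
next
  case False
  have dvd: "2 ^ k dvd d \<longleftrightarrow> k \<le> multiplicity 2 d" for k
    using False by (intro power_dvd_iff_le_multiplicity) auto
  have "multiplicity 2 d < m"
  proof (rule ccontr)
    assume "\<not> multiplicity 2 d < m"
    then have "2 ^ m dvd d" using dvd by simp
    then have "\<bar>2 ^ m\<bar> \<le> \<bar>d\<bar>" by (rule dvd_imp_le_int[OF False])
    then show False using d by simp
  qed
  then have "(\<Sum>k<m. if 2 ^ (k + 1) dvd d then \<alpha> ^ (2 ^ k) else 0) = (\<Sum>k<multiplicity 2 d. \<alpha> ^ (2 ^ k))"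
    unfolding dvd by (intro sum.mono_neutral_cong_right) auto
  then show ?thesis
    using False char2_artin_schreier_sum[OF two_L, of \<beta>] \<alpha> by (simp add: frob_diff_def)
qed

text \<open>Here a - t = 2Q - (t - j) and b - u = 2Q + (t - j). As D divides 2Q, both divisibilities
  mean that D divides t - j; the difference of the two numbers is 2(j - t), which gives the
  condition modulo 3. The inequalities follow since a positive multiple of D is at least D.\<close>

lemma shifted_balanced_condition:
  fixes D Q t u j :: nat
  assumes D: "D dvd 2 * Q" "D > 0" and tu: "t + u = 2 * Q - 1" "Q \<ge> 1" and ab: "a = 2 * Q + j" "b = 4 * Q - 1 - j" "j < 2 * Q"
  shows "(t + D \<le> a \<and> u + D \<le> b) \<and> a - (t + D) + (b - (u + D)) = 4 * Q - 2 * D \<and>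
      D dvd a - (t + D) \<and> D dvd b - (u + D) \<and> (a - (t + D)) mod 3 = (b - (u + D)) mod 3 \<longleftrightarrow>
    t mod 3 = j mod 3 \<and> int D dvd int t - int j"
proof -
  define A where "A = a - t"
  define B where "B = b - u"
  have AB: "int A = int (2 * Q) - (int t - int j)" "int B = int (2 * Q) + (int t - int j)"
    "A + B = 4 * Q" "A > 0" "B > 0" "t \<le> a" "u \<le> b"
    unfolding A_def B_def using tu ab by (auto simp: of_nat_diff)
  have s: "a - (t + D) = A - D" "b - (u + D) = B - D" "t + D \<le> a \<longleftrightarrow> D \<le> A" "u + D \<le> b \<longleftrightarrow> D \<le> B"
    unfolding A_def B_def using AB(6,7) by auto
  have DQ: "int D dvd int (2 * Q)" using D(1) by (simp only: of_nat_dvd_iff)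
  have dA: "D dvd A \<longleftrightarrow> int D dvd int t - int j"
    using dvd_diff_right_iff[OF DQ, of "int t - int j"] unfolding of_nat_dvd_iff[symmetric, where 'a = int] AB(1) by simp
  have dB: "D dvd B \<longleftrightarrow> int D dvd int t - int j"
    using dvd_add_right_iff[OF DQ, of "int t - int j"] unfolding of_nat_dvd_iff[symmetric, where 'a = int] AB(2) by simp
  have m3: "A mod 3 = B mod 3 \<longleftrightarrow> t mod 3 = j mod 3"
  proof -
    have "A mod 3 = B mod 3 \<longleftrightarrow> int A mod 3 = int B mod 3"
      using of_nat_eq_iff[of "A mod 3" "B mod 3", where 'a = int] by (simp only: of_nat_mod of_nat_numeral)
    also have "\<dots> \<longleftrightarrow> 3 dvd int A - int B" by (rule mod_eq_dvd_iff)
    also have "int A - int B = 2 * (int j - int t)" using AB by simp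
    also have "3 dvd 2 * (int j - int t) \<longleftrightarrow> 3 dvd int j - int t"
      by (rule coprime_dvd_mult_right_iff) simp
    also have "\<dots> \<longleftrightarrow> int j mod 3 = int t mod 3" by (rule mod_eq_dvd_iff[symmetric])
    also have "\<dots> \<longleftrightarrow> t mod 3 = j mod 3"
      using of_nat_eq_iff[of "t mod 3" "j mod 3", where 'a = int] by (simp only: of_nat_mod of_nat_numeral eq_commute)
    finally show ?thesis .
  qed
  show ?thesis
  proof (cases "D dvd A \<and> D dvd B")
    case True
    then have le: "D \<le> A" "D \<le> B" using AB by (auto intro: dvd_imp_le)
    then have "D dvd A - D" "D dvd B - D" "A - D + (B - D) = 4 * Q - 2 * D"
      using True AB(3) by auto
    then show ?thesis unfolding s using le True mod3_diff[OF le] m3 dA by simp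
  next
    case False
    then have "\<not> (D \<le> A \<and> D \<le> B \<and> D dvd A - D \<and> D dvd B - D)"
      by (auto simp: dvd_diff_nat dest: dvd_diffD)
    then show ?thesis unfolding s using False dA dB by blast
  qed
qed

lemma cf_F:
  "cf (F_pol Q j) a b c = (if a = 2 * Q + j \<and> b = 4 * Q - 1 - j \<and> c = 0 then 1 else 0)"
  unfolding F_pol_def cf_xy ..

text \<open>The monomials in x, y of degree 6Q - 1 with exponents below 4Q are exactly the F_j with
  j < 2Q. The coefficient of F_j collects \<alpha>^(2^k) over those k for which 2^(k+1) divides t -
  j, provided that t and j agree modulo 3.\<close>

lemma balanced_sum_eq_F_sum:
  assumes m: "m \<ge> 1" "Q = 2 ^ (m - 1)" and tu: "t + u = 2 * Q - 1"
    and \<alpha>: "\<alpha> = \<beta>\<^sup>2 + \<beta>" and \<beta>: "\<beta> ^ (2 ^ m) = \<beta>"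
  shows "(\<Sum>k<m. Const (\<alpha> ^ (2 ^ k)) *
       (xx ^ (t + 2 ^ (k + 1)) * yy ^ (u + 2 ^ (k + 1)) * balanced (2 ^ (k + 1)) (4 * Q - 2 ^ (k + 2)))) +
     (\<Sum>j<2 * Q. Const (special_fun (frob_diff \<beta>) t j) * F_pol Q j) \<in> small_zero Q"
    (is "?L + ?R \<in> _")
proof -
  have Q1: "Q \<ge> 1" and Q2: "2 * Q = 2 ^ m" using m by (simp, cases m) simp_all
  have D: "2 ^ (k + 1) dvd 2 * Q" if "k < m" for k
    unfolding Q2 using that by (intro le_imp_power_dvd) simp
  have "cf ?L a b c = cf ?R a b c" if abc: "a < 4 * Q" "b < 4 * Q" "c < 4 * Q" for a b c
  proof (cases "c = 0 \<and> a + b = 6 * Q - 1")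
    case True
    define j where "j = a - 2 * Q"
    have j: "a = 2 * Q + j" "b = 4 * Q - 1 - j" "j < 2 * Q"
      using True abc unfolding j_def by auto
    have "cf ?L a b c = (\<Sum>k<m. if t mod 3 = j mod 3 then if 2 ^ (k + 1) dvd int t - int j then \<alpha> ^ (2 ^ k) else 0 else 0)"
      unfolding cf_sum
    proof (rule sum.cong[OF refl])
      fix k assume "k \<in> {..<m}"
      then have k: "k < m" by simp
      define P where "P = (2::nat) ^ (k + 1)"
      have P: "4 * Q - 2 ^ (k + 2) = 4 * Q - 2 * P" "(2::int) ^ (k + 1) = int P" "P > 0" by (simp_all add: P_def)
      have C: "(t + P \<le> a \<and> u + P \<le> b) \<and> a - (t + P) + (b - (u + P)) = 4 * Q - 2 * P \<and>
          P dvd a - (t + P) \<and> P dvd b - (u + P) \<and> (a - (t + P)) mod 3 = (b - (u + P)) mod 3 \<longleftrightarrow>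
          t mod 3 = j mod 3 \<and> int P dvd int t - int j" (is "?A \<and> ?B \<longleftrightarrow> ?C \<and> ?D")
        by (rule shifted_balanced_condition[OF D[OF k, folded P_def] P(3) tu Q1 j])
      have "cf (Const (\<alpha> ^ (2 ^ k)) * (xx ^ (t + P) * yy ^ (u + P) * balanced P (4 * Q - 2 * P))) a b c =
          (if ?A then \<alpha> ^ (2 ^ k) * (if c = 0 \<and> ?B then 1 else 0) else 0)"
        unfolding cf_Const_mult cf_xy_mult cf_balanced by (cases ?A) (simp_all only: simp_thms if_True if_False mult_zero_right)
      also have "\<dots> = (if ?A \<and> ?B then \<alpha> ^ (2 ^ k) else 0)"
        using True by (cases ?A; cases ?B) (simp_all only: simp_thms if_True if_False mult_1_right mult_zero_right)
      also have "\<dots> = (if ?C then if ?D then \<alpha> ^ (2 ^ k) else 0 else 0)"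
        unfolding C by (cases ?C; cases ?D) (simp_all only: simp_thms if_True if_False)
      finally show "cf (Const (\<alpha> ^ (2 ^ k)) * (xx ^ (t + 2 ^ (k + 1)) * yy ^ (u + 2 ^ (k + 1)) * balanced (2 ^ (k + 1)) (4 * Q - 2 ^ (k + 2)))) a b c
        = (if t mod 3 = j mod 3 then if 2 ^ (k + 1) dvd int t - int j then \<alpha> ^ (2 ^ k) else 0 else 0)"
        unfolding P(1,2) P_def[symmetric] .
    qed
    also have "\<dots> = special_fun (frob_diff \<beta>) t j"
    proof -
      have "\<bar>int t - int j\<bar> < int (2 ^ m)" using tu j(3) Q1 unfolding Q2[symmetric] by linarith
      then have "\<bar>int t - int j\<bar> < 2 ^ m" by simp
      from sum_frobenius_dvd[OF \<alpha> \<beta> this] show ?thesis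
        unfolding special_fun_def dist_kernel_def by (cases "t mod 3 = j mod 3") simp_all
    qed
    also have "\<dots> = (\<Sum>i<2 * Q. if i = j then special_fun (frob_diff \<beta>) t j else 0)"
      using j(3) by simp
    also have "\<dots> = cf ?R a b c"
      unfolding cf_sum
    proof (rule sum.cong[OF refl])
      fix i assume "i \<in> {..<2 * Q}"
      then have i: "i < 2 * Q" by simp
      have "a = 2 * Q + i \<and> b = 4 * Q - 1 - i \<and> c = 0 \<longleftrightarrow> i = j"
        using j True by auto
      then show "(if i = j then special_fun (frob_diff \<beta>) t j else 0) =
        cf (Const (special_fun (frob_diff \<beta>) t i) * F_pol Q i) a b c"
        unfolding cf_Const_mult cf_F by simp
    qed
    finally show ?thesis .
  next
    case False
    have "cf (Const (\<alpha> ^ (2 ^ k)) * (xx ^ (t + 2 ^ (k + 1)) * yy ^ (u + 2 ^ (k + 1)) * balanced (2 ^ (k + 1)) (4 * Q - 2 ^ (k + 2)))) a b c = 0"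
      if "k < m" for k
    proof -
      have "2 ^ (k + 1) \<le> 2 * Q" using D[OF that] Q1 by (intro dvd_imp_le) auto
      then have "2 ^ (k + 2) \<le> 4 * Q" by simp
      then have "\<not> (t + 2 ^ (k + 1) \<le> a \<and> u + 2 ^ (k + 1) \<le> b \<and> c = 0 \<and>
         a - (t + 2 ^ (k + 1)) + (b - (u + 2 ^ (k + 1))) = 4 * Q - 2 ^ (k + 2))"
        using False tu Q1 by auto
      then show ?thesis unfolding cf_Const_mult cf_xy_mult cf_balanced by auto
    qed
    then have "cf ?L a b c = 0" unfolding cf_sum by (intro sum.neutral ballI) (simp only: lessThan_iff)
    moreover have "cf (Const (special_fun (frob_diff \<beta>) t j) * F_pol Q j) a b c = 0" if "j < 2 * Q" for j
      unfolding cf_Const_mult cf_F using False that by auto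
    then have "cf ?R a b c = 0" unfolding cf_sum by (intro sum.neutral ballI) (simp only: lessThan_iff)
    ultimately show ?thesis by simp
  qed
  then have "cf (?L + ?R) a b c = 0" if "a < 4 * Q" "b < 4 * Q" "c < 4 * Q" for a b c
    using that by (simp only: cf_add char2_add_self[OF two_L])
  then show ?thesis unfolding small_zero_def by blast
qed

lemma g_mult_E:
  assumes m: "m \<ge> 1" "Q = 2 ^ (m - 1)" and t: "t \<le> 2 * Q - 1"
    and \<alpha>: "\<alpha> = \<beta>\<^sup>2 + \<beta>" and \<beta>: "\<beta> ^ (2 ^ m) = \<beta>"
  shows "gcong \<alpha> Q (g_pol \<alpha> * E_pol Q t)
    (xx ^ t * yy ^ (2 * Q - 1 - t) * R_pol Q + (\<Sum>j<2 * Q. Const (special_fun (frob_diff \<beta>) t j) * F_pol Q j))"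
proof -
  have tu: "t + (2 * Q - 1 - t) = 2 * Q - 1" using t by simp
  show ?thesis unfolding E_pol_def
    by (rule gcong_trans[OF g_mult_E_balanced[OF m tu]],
        rule gcong_add[OF gcong_refl gcong_small[OF balanced_sum_eq_F_sum[OF m tu \<alpha> \<beta>]]])
qed

section \<open>From E and F to the symmetric combinations G and H\<close>

lemma sum_even_odd:
  fixes f :: "nat \<Rightarrow> 'a::comm_monoid_add"
  shows "(\<Sum>j<2 * Q. f j) = (\<Sum>j<Q. f (2 * j)) + (\<Sum>j<Q. f (2 * Q - 1 - 2 * j))"
proof -
  have "(\<Sum>j<2 * Q. f j) = (\<Sum>j<Q. f (2 * j)) + (\<Sum>j<Q. f (2 * j + 1))"
    by (induction Q) (simp_all add: ac_simps)
  also have "(\<Sum>j<Q. f (2 * j + 1)) = (\<Sum>j<Q. f (2 * (Q - Suc j) + 1))"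
    by (rule sum.nat_diff_reindex[symmetric])
  also have "\<dots> = (\<Sum>j<Q. f (2 * Q - 1 - 2 * j))"
  proof (rule sum.cong[OF refl])
    fix j assume "j \<in> {..<Q}"
    then have "2 * (Q - Suc j) + 1 = 2 * Q - 1 - 2 * j" by auto
    then show "f (2 * (Q - Suc j) + 1) = f (2 * Q - 1 - 2 * j)" by simp
  qed
  finally show ?thesis .
qed

lemma frob_diff_0: "frob_diff \<beta> 0 = 0"
  using char2_add_self[OF two_L] by (simp add: frob_diff_def)

text \<open>The shift by one arises because G_i and H_j are indexed by half of the even index: 2i -
  2j has order one more than i - j.\<close>

definition frob_coeff :: "L \<Rightarrow> nat \<Rightarrow> L" where
  "frob_coeff \<beta> k = frob_diff \<beta> (Suc k)"

text \<open>Since \<open>frob_diff \<beta> 0\<close> is 0, even and odd indices of the E and F do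
  not interact.\<close>

lemma special_fun_odd_diff:
  assumes "even i \<noteq> even j" shows "special_fun (frob_diff \<beta>) i j = 0"
proof -
  have "odd (int i - int j)" using assms by simp
  then have "multiplicity 2 (int i - int j) = 0" by (rule not_dvd_imp_multiplicity_0)
  then show ?thesis by (simp add: special_fun_def dist_kernel_def frob_diff_0)
qed

lemma special_fun_double:
  "special_fun (frob_diff \<beta>) (2 * i) (2 * j) = special_fun (frob_coeff \<beta>) i j"
  unfolding special_fun_def mod3_double dist_kernel_double frob_coeff_def ..

text \<open>Reflection only changes the sign of i - j, so the two summands of G_i have the same
  coefficients and their images combine to multiples of the H_j.\<close>

lemma special_fun_reflect:
  assumes "i \<le> N" "j \<le> N"
  shows "special_fun c (N - i) (N - j) = special_fun c i j"
proof -
  have "(N - i) mod 3 = (N - j) mod 3 \<longleftrightarrow> int (N - i) mod 3 = int (N - j) mod 3"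
    using of_nat_eq_iff[of "(N - i) mod 3" "(N - j) mod 3", where 'a = int] by (simp only: of_nat_mod of_nat_numeral)
  also have "\<dots> \<longleftrightarrow> 3 dvd int j - int i"
    using assms by (simp add: mod_eq_dvd_iff of_nat_diff)
  also have "\<dots> \<longleftrightarrow> int j mod 3 = int i mod 3" by (rule mod_eq_dvd_iff[symmetric])
  also have "\<dots> \<longleftrightarrow> i mod 3 = j mod 3"
    using of_nat_eq_iff[of "i mod 3" "j mod 3", where 'a = int] by (simp only: of_nat_mod of_nat_numeral eq_commute)
  finally have 1: "(N - i) mod 3 = (N - j) mod 3 \<longleftrightarrow> i mod 3 = j mod 3" .
  have "int (N - i) - int (N - j) = int j - int i" "N - i = N - j \<longleftrightarrow> j = i" using assms by auto
  then have "dist_kernel c (N - i) (N - j) = dist_kernel c j i" by (simp add: dist_kernel_def)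
  then show ?thesis unfolding special_fun_def 1 by (simp add: dist_kernel_sym[of c j i])
qed

lemma sum_F_eq_sum_H:
  assumes i: "i < Q"
  shows "(\<Sum>j<2 * Q. Const (special_fun (frob_diff \<beta>) (2 * i) j) * F_pol Q j) +
    (\<Sum>j<2 * Q. Const (special_fun (frob_diff \<beta>) (2 * Q - 1 - 2 * i) j) * F_pol Q j) =
    (\<Sum>j<Q. Const (special_fun (frob_coeff \<beta>) i j) * H_pol Q j)"
proof -
  have o: "odd (2 * Q - 1 - 2 * j)" if "j < Q" for j
  proof -
    have "2 * Q - 1 - 2 * j = 2 * (Q - Suc j) + 1" using that by auto
    then show ?thesis by simp
  qed
  have 1: "(\<Sum>j<2 * Q. Const (special_fun (frob_diff \<beta>) (2 * i) j) * F_pol Q j) =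
    (\<Sum>j<Q. Const (special_fun (frob_coeff \<beta>) i j) * F_pol Q (2 * j))"
    unfolding sum_even_odd special_fun_double using o by (simp add: special_fun_odd_diff)
  have "special_fun (frob_diff \<beta>) (2 * Q - 1 - 2 * i) (2 * Q - 1 - 2 * j) = special_fun (frob_coeff \<beta>) i j"
    if "j < Q" for j
  proof -
    have "2 * i \<le> 2 * Q - 1" "2 * j \<le> 2 * Q - 1" using i that by auto
    from special_fun_reflect[OF this, of "frob_diff \<beta>"] show ?thesis unfolding special_fun_double .
  qed
  then have 2: "(\<Sum>j<2 * Q. Const (special_fun (frob_diff \<beta>) (2 * Q - 1 - 2 * i) j) * F_pol Q j) =
    (\<Sum>j<Q. Const (special_fun (frob_coeff \<beta>) i j) * F_pol Q (2 * Q - 1 - 2 * j))"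
    unfolding sum_even_odd using o[OF i] by (simp add: special_fun_odd_diff)
  show ?thesis unfolding 1 2 H_pol_def by (simp add: distrib_left sum.distrib)
qed

section \<open>Multiples of R and the origin of gamma\<close>

text \<open>The restriction to exponents at least t and u leaves no trace: a monomial inside the box
  with a < t or b < u that meets the other conditions would have an exponent 4Q - 1 and force 3 to
  divide 4Q.\<close>

lemma cf_monomial_R:
  assumes tu: "t + u = 2 * Q - 1" "\<not> 3 dvd int Q" "Q \<ge> 1" and ab: "a < 4 * Q" "b < 4 * Q"
  shows "cf (xx ^ t * yy ^ u * R_pol Q) a b c =
    (if (c = 1 \<or> c = 2) \<and> a + b + c = 6 * Q - 1 \<and> 3 dvd (int a - int b) - (int t - int u) then 1 else 0)"
proof (cases "t \<le> a \<and> u \<le> b")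
  case True
  have "(a - t) mod 3 = (b - u) mod 3 \<longleftrightarrow> int (a - t) mod 3 = int (b - u) mod 3"
    using of_nat_eq_iff[of "(a - t) mod 3" "(b - u) mod 3", where 'a = int] by (simp only: of_nat_mod of_nat_numeral)
  also have "\<dots> \<longleftrightarrow> 3 dvd int (a - t) - int (b - u)" by (rule mod_eq_dvd_iff)
  also have "int (a - t) - int (b - u) = (int a - int b) - (int t - int u)"
    using True by (simp add: of_nat_diff)
  finally have 1: "(a - t) mod 3 = (b - u) mod 3 \<longleftrightarrow> 3 dvd (int a - int b) - (int t - int u)" .
  have 2: "a - t + (b - u) + c = 4 * Q \<longleftrightarrow> a + b + c = 6 * Q - 1"
    using True tu by linarith
  show ?thesis unfolding cf_xy_mult cf_R 1 2 using True by simp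
next
  case False
  have n: "\<not> ((c = 1 \<or> c = 2) \<and> a + b + c = 6 * Q - 1 \<and> 3 dvd (int a - int b) - (int t - int u))"
  proof
    assume *: "(c = 1 \<or> c = 2) \<and> a + b + c = 6 * Q - 1 \<and> 3 dvd (int a - int b) - (int t - int u)"
    from False consider "a < t" | "b < u" by linarith
    then show False
    proof cases
      case 1
      then have "int a = 2 * int Q - 2" "int t = 2 * int Q - 1" "int u = 0" "int b = 4 * int Q - 1"
        using * tu ab by linarith+
      then have "(int a - int b) - (int t - int u) = - (4 * int Q)" by simp
      then have "3 dvd 4 * int Q" using * by (simp only: dvd_minus_iff)
      then have "3 dvd int Q" by presburger
      then show False using tu by simp
    next
      case 2
      then have "int b = 2 * int Q - 2" "int u = 2 * int Q - 1" "int t = 0" "int a = 4 * int Q - 1"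
        using * tu ab by linarith+
      then have "(int a - int b) - (int t - int u) = 4 * int Q" by simp
      then have "3 dvd 4 * int Q" using * by simp
      then have "3 dvd int Q" by presburger
      then show False using tu by simp
    qed
  qed
  show ?thesis unfolding cf_xy_mult if_not_P[OF False] if_not_P[OF n] ..
qed

text \<open>Inside the box the coefficients depend on t only modulo 3, so at most three different
  elements x^t y^u R occur in this degree of O.\<close>

lemma monomial_R_small:
  assumes "t + u = 2 * Q - 1" "t' + u' = 2 * Q - 1" "\<not> 3 dvd int Q" "Q \<ge> 1" "3 dvd int t - int t'"
  shows "xx ^ t * yy ^ u * R_pol Q + xx ^ t' * yy ^ u' * R_pol Q \<in> small_zero Q"
proof -
  have "3 dvd (int a - int b) - (int t - int u) \<longleftrightarrow> 3 dvd (int a - int b) - (int t' - int u')" for a b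
  proof -
    have "(int a - int b) - (int t' - int u') = (int a - int b) - (int t - int u) + 2 * (int t - int t')"
    proof -
      have "int t + int u = int t' + int u'" using assms(1,2) by linarith
      then show ?thesis by simp
    qed
    then show ?thesis using assms(5) dvd_add_left_iff[of 3 "2 * (int t - int t')"] by (simp only: dvd_mult)
  qed
  then show ?thesis
    unfolding small_zero_def mem_Collect_eq cf_add
    using cf_monomial_R[OF assms(1,3,4)] cf_monomial_R[OF assms(2,3,4)] by (simp add: char2_add_self[OF two_L])
qed

text \<open>Modulo 3, the case i = 2Q - 1 is exactly t = u, and there the two multiples of R cancel.
  In the other two cases t and u are 2Q - 2 and 1 in some order, the exponents out of which gamma is
  built.\<close>

lemma G_R_part:
  assumes i: "i < Q" and Q: "\<not> 3 dvd int Q" and Q2: "Q \<ge> 2"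
  shows "(xx ^ (2 * i) * yy ^ (2 * Q - 1 - 2 * i) * R_pol Q + xx ^ (2 * Q - 1 - 2 * i) * yy ^ (2 * i) * R_pol Q) +
     (if i \<in> residue_block Q (2 * Q + 2) then 0 else gamma_pol Q) \<in> small_zero Q"
proof -
  define t u where "t = 2 * i" and "u = 2 * Q - 1 - 2 * i"
  have tu: "t + u = 2 * Q - 1" "u + t = 2 * Q - 1" and Q1: "Q \<ge> 1" using i by (auto simp: t_def u_def)
  have intu: "int t = 2 * int i" "int u = 2 * int Q - 1 - 2 * int i" using i by (auto simp: t_def u_def)
  have mem: "i \<in> residue_block Q (2 * Q + 2) \<longleftrightarrow> 3 dvd 2 * int Q + 2 - int i"
  proof -
    have "i \<in> residue_block Q (2 * Q + 2) \<longleftrightarrow> int (2 * Q + 2) mod 3 = int i mod 3"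
      using i of_nat_eq_iff[of "(2 * Q + 2) mod 3" "i mod 3", where 'a = int] unfolding residue_block_def
      by (simp only: of_nat_mod of_nat_numeral mem_Collect_eq eq_commute simp_thms)
    then show ?thesis by (simp add: mod_eq_dvd_iff add.commute)
  qed
  show ?thesis
  proof (cases "i \<in> residue_block Q (2 * Q + 2)")
    case True
    have "int t - int u = 4 * int i - 2 * int Q + 1" using intu by simp
    also have "\<dots> = 3 * (int i + 1) - (2 * int Q + 2 - int i)" by simp
    finally have "3 dvd int t - int u" using True mem by (simp only: dvd_diff dvd_triv_left)
    from monomial_R_small[OF tu Q Q1 this] show ?thesis
      using True by (simp add: t_def u_def)
  next
    case False
    have s: "2 * Q - 2 + 1 = 2 * Q - 1" "1 + (2 * Q - 2) = 2 * Q - 1" using Q2 by auto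
    have "\<not> 3 dvd 2 * int Q + 2 - int i" using False mem by simp
    then have "3 dvd 2 * int i - (2 * int Q - 2) \<or> 3 dvd 2 * int i - 1"
      using Q by presburger
    then have "3 dvd int t - int (2 * Q - 2) \<and> 3 dvd int u - int 1 \<or> 3 dvd int t - int 1 \<and> 3 dvd int u - int (2 * Q - 2)"
    proof
      assume d: "3 dvd 2 * int i - (2 * int Q - 2)"
      have "int t - int (2 * Q - 2) = 2 * int i - (2 * int Q - 2)" "int u - int 1 = - (2 * int i - (2 * int Q - 2))"
        using intu Q2 by auto
      then show ?thesis using d by (simp only: dvd_minus_iff simp_thms)
    next
      assume d: "3 dvd 2 * int i - 1"
      have "int t - int 1 = 2 * int i - 1" "int u - int (2 * Q - 2) = - (2 * int i - 1)"
        using intu Q2 by auto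
      then show ?thesis using d by (simp only: dvd_minus_iff simp_thms)
    qed
    then have "(xx ^ t * yy ^ u * R_pol Q + xx ^ u * yy ^ t * R_pol Q) +
      (xx ^ (2 * Q - 2) * yy ^ 1 * R_pol Q + xx ^ 1 * yy ^ (2 * Q - 2) * R_pol Q) \<in> small_zero Q"
    proof
      assume d: "3 dvd int t - int (2 * Q - 2) \<and> 3 dvd int u - int 1"
      show ?thesis
        using small_zero_add[OF monomial_R_small[OF tu(1) s(1) Q Q1 conjunct1[OF d]]
            monomial_R_small[OF tu(2) s(2) Q Q1 conjunct2[OF d]]] by (simp only: ac_simps)
    next
      assume d: "3 dvd int t - int 1 \<and> 3 dvd int u - int (2 * Q - 2)"
      show ?thesis
        using small_zero_add[OF monomial_R_small[OF tu(1) s(2) Q Q1 conjunct1[OF d]]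
            monomial_R_small[OF tu(2) s(1) Q Q1 conjunct2[OF d]]] by (simp only: ac_simps)
    qed
    then show ?thesis using False by (simp add: t_def u_def gamma_pol_def distrib_right)
  qed
qed

lemma not_3_dvd_two_power: "\<not> 3 dvd int (2 ^ n)"
proof
  assume "3 dvd int (2 ^ n)"
  then have "int 3 dvd int (2 ^ n)" by simp
  then have "3 dvd (2::nat) ^ n" by (simp only: of_nat_dvd_iff)
  then show False using two_power_mod3[of n] by (simp add: dvd_eq_mod_eq_0)
qed

lemma g_mult_G:
  assumes m2: "m \<ge> 2" and Q: "Q = 2 ^ (m - 1)" and i: "i < Q"
    and \<alpha>: "\<alpha> = \<beta>\<^sup>2 + \<beta>" and \<beta>: "\<beta> ^ (2 ^ m) = \<beta>"
  shows "gcong \<alpha> Q (g_pol \<alpha> * G_pol Q i)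
    ((if i \<in> residue_block Q (2 * Q + 2) then 0 else gamma_pol Q) +
     (\<Sum>j<Q. Const (special_fun (frob_coeff \<beta>) i j) * H_pol Q j))"
proof -
  have m: "m \<ge> 1" using m2 by simp
  have "(2::nat) ^ 1 \<le> 2 ^ (m - 1)" using m2 by (intro power_increasing) auto
  then have Q2: "Q \<ge> 2" using Q by simp
  let ?u = "2 * Q - 1 - 2 * i"
  have le: "2 * i \<le> 2 * Q - 1" "?u \<le> 2 * Q - 1" and u: "2 * Q - 1 - ?u = 2 * i" using i by auto
  have "gcong \<alpha> Q (g_pol \<alpha> * E_pol Q (2 * i) + g_pol \<alpha> * E_pol Q ?u)
    ((xx ^ (2 * i) * yy ^ ?u * R_pol Q + (\<Sum>j<2 * Q. Const (special_fun (frob_diff \<beta>) (2 * i) j) * F_pol Q j)) +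
     (xx ^ ?u * yy ^ (2 * i) * R_pol Q + (\<Sum>j<2 * Q. Const (special_fun (frob_diff \<beta>) ?u j) * F_pol Q j)))"
    using gcong_add[OF g_mult_E[OF m Q le(1) \<alpha> \<beta>] g_mult_E[OF m Q le(2) \<alpha> \<beta>]] unfolding u .
  also have "((xx ^ (2 * i) * yy ^ ?u * R_pol Q + (\<Sum>j<2 * Q. Const (special_fun (frob_diff \<beta>) (2 * i) j) * F_pol Q j)) +
     (xx ^ ?u * yy ^ (2 * i) * R_pol Q + (\<Sum>j<2 * Q. Const (special_fun (frob_diff \<beta>) ?u j) * F_pol Q j))) =
     (xx ^ (2 * i) * yy ^ ?u * R_pol Q + xx ^ ?u * yy ^ (2 * i) * R_pol Q) +
     (\<Sum>j<Q. Const (special_fun (frob_coeff \<beta>) i j) * H_pol Q j)"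
    unfolding sum_F_eq_sum_H[OF i, symmetric] by (simp only: ac_simps)
  also have "gcong \<alpha> Q \<dots> ((if i \<in> residue_block Q (2 * Q + 2) then 0 else gamma_pol Q) +
     (\<Sum>j<Q. Const (special_fun (frob_coeff \<beta>) i j) * H_pol Q j))"
    using G_R_part[OF i _ Q2] not_3_dvd_two_power[of "m - 1"] Q by (intro gcong_add gcong_refl gcong_small) blast
  finally show ?thesis unfolding G_pol_def distrib_left .
qed

section \<open>Multiplication by v\<close>

lemma cf_P_mult:
  "cf (P_pol * h) a b c = (if 4 \<le> c then cf h a b (c - 4) else 0)
     + (if 1 \<le> a \<and> 1 \<le> b \<and> 2 \<le> c then cf h (a - 1) (b - 1) (c - 2) else 0)
     + (if 3 \<le> a \<and> 1 \<le> c then cf h (a - 3) b (c - 1) else 0)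
     + (if 3 \<le> b \<and> 1 \<le> c then cf h a (b - 3) (c - 1) else 0)"
  unfolding P_pol_eq distrib_right cf_add cf_monomial_mult by (simp only: le0 simp_thms diff_zero)

text \<open>A square contains only even powers of z, so an odd power must use one of the terms x^3z
  and y^3z of P.\<close>

lemma cf_P_mult_square:
  "cf (P_pol * f\<^sup>2) a b (2 * n + 1) = (if 3 \<le> a then cf (f\<^sup>2) (a - 3) b (2 * n) else 0)
     + (if 3 \<le> b then cf (f\<^sup>2) a (b - 3) (2 * n) else 0)"
proof -
  have 1: "cf (f\<^sup>2) a b (2 * n + 1 - 4) = 0" if "4 \<le> 2 * n + 1" for a b
  proof -
    have "2 * n + 1 - 4 = 2 * (n - 2) + 1" using that by linarith
    then have "odd (2 * n + 1 - 4)" by simp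
    then show ?thesis unfolding cf_square by simp
  qed
  have 2: "cf (f\<^sup>2) a b (2 * n + 1 - 2) = 0" if "2 \<le> 2 * n + 1" for a b
  proof -
    have "2 * n + 1 - 2 = 2 * (n - 1) + 1" using that by linarith
    then have "odd (2 * n + 1 - 2)" by simp
    then show ?thesis unfolding cf_square by simp
  qed
  have 3: "2 * n + 1 - 1 = 2 * n" "1 \<le> 2 * n + 1" by simp_all
  show ?thesis
    unfolding cf_P_mult using 1 2 by (simp only: 3 simp_thms if_cancel add_0 cong: if_cong)
qed

text \<open>Recursion along the binary digits of k: for even k the power is a square and has no odd
  power of z, while k = 2k' + 1 leads back to k' and a smaller n.\<close>

lemma cf_P_power_low:
  assumes "k < 2 ^ n - 1"
  shows "cf (P_pol ^ k) a b (2 ^ n - 1) = 0"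
  using assms
proof (induction n arbitrary: k a b)
  case 0
  then show ?case by simp
next
  case (Suc n)
  define N where "N = (2::nat) ^ n - 1"
  have "(1::nat) \<le> 2 ^ n" by simp
  then have N: "2 ^ Suc n - 1 = 2 * N + 1" unfolding N_def power_Suc by linarith
  have IH: "cf (P_pol ^ k) a b N = 0" if "k < N" for k a b
    using Suc.IH that unfolding N_def by blast
  show ?case
  proof (cases "even k")
    case True
    then obtain k' where "k = 2 * k'" by (auto elim: evenE)
    then have P: "P_pol ^ k = (P_pol ^ k')\<^sup>2" by (simp add: mult.commute flip: power_mult)
    show ?thesis unfolding N P cf_square by simp
  next
    case False
    then obtain k' where k': "k = 2 * k' + 1" by (auto elim: oddE)
    then have P: "P_pol ^ k = P_pol * (P_pol ^ k')\<^sup>2" by (simp add: mult.commute flip: power_mult)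
    have "k' < N" using Suc.prems k' unfolding N by linarith
    then have "cf ((P_pol ^ k')\<^sup>2) a b (2 * N) = 0" for a b
      unfolding cf_square using IH by simp
    then show ?thesis unfolding N P cf_P_mult_square by simp
  qed
qed

text \<open>P is z times a polynomial with value x^3 + y^3 at z = 0, so this is a coefficient of
  (x^3 + y^3)^(2^n - 1), whose binomial coefficients are all odd. The recursion of the preceding
  lemma computes it directly.\<close>

lemma cf_P_power_top:
  "cf (P_pol ^ (2 ^ n - 1)) a b (2 ^ n - 1) = (if a + b = 3 * (2 ^ n - 1) \<and> 3 dvd a then 1 else 0)"
proof (induction n arbitrary: a b)
  case 0
  then show ?case using cf_xy[of 0 0] by simp
next
  case (Suc n)
  define N where "N = (2::nat) ^ n - 1"
  have "(1::nat) \<le> 2 ^ n" by simp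
  then have N: "2 ^ Suc n - 1 = 2 * N + 1" unfolding N_def power_Suc by linarith
  have IH: "cf (P_pol ^ N) a b N = (if a + b = 3 * N \<and> 3 dvd a then 1 else 0)" for a b
    using Suc.IH unfolding N_def .
  have P: "P_pol ^ (2 * N + 1) = P_pol * (P_pol ^ N)\<^sup>2" by (simp add: mult.commute flip: power_mult)
  have sq: "cf ((P_pol ^ N)\<^sup>2) (2 * a) (2 * b) (2 * N) = (if a + b = 3 * N \<and> 3 dvd a then 1 else 0)" for a b
    unfolding cf_square using IH by simp
  have sq0: "cf ((P_pol ^ N)\<^sup>2) a b (2 * N) = 0" if "odd a \<or> odd b" for a b
    unfolding cf_square using that by auto
  have d3: "3 dvd 2 * x \<longleftrightarrow> 3 dvd x" for x :: nat by presburger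
  show ?case
    unfolding N P cf_P_mult_square
  proof (cases "even a")
    case True
    then obtain a' where a: "a = 2 * a'" by (auto elim: evenE)
    have 1: "(if 3 \<le> a then cf ((P_pol ^ N)\<^sup>2) (a - 3) b (2 * N) else 0) = 0"
      using True sq0[of "a - 3" b] by (simp add: even_diff_nat)
    show "(if 3 \<le> a then cf ((P_pol ^ N)\<^sup>2) (a - 3) b (2 * N) else 0) +
      (if 3 \<le> b then cf ((P_pol ^ N)\<^sup>2) a (b - 3) (2 * N) else 0) =
      (if a + b = 3 * (2 * N + 1) \<and> 3 dvd a then 1 else 0)"
    proof (cases "even b")
      case b: True
      then have "a + b \<noteq> 3 * (2 * N + 1)" using True by presburger
      then show ?thesis unfolding 1 using b sq0[of a "b - 3"] by (simp add: even_diff_nat)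
    next
      case False
      then obtain b'' where b'': "b = 2 * b'' + 1" by (auto elim: oddE)
      show ?thesis
      proof (cases "b'' = 0")
        case True
        have "\<not> (a + b = 3 * (2 * N + 1) \<and> 3 dvd a)" unfolding b'' True by presburger
        then show ?thesis unfolding 1 using b'' True by simp
      next
        case False
        then obtain b' where b: "b = 2 * b' + 3" using b'' by (cases b'') auto
        have "a + b = 3 * (2 * N + 1) \<longleftrightarrow> a' + b' = 3 * N" unfolding a b by presburger
        then show ?thesis unfolding 1 using sq[of a' b'] d3[of a'] unfolding a b by simp
      qed
    qed
  next
    case False
    then obtain a'' where a'': "a = 2 * a'' + 1" by (auto elim: oddE)
    have 1: "(if 3 \<le> b then cf ((P_pol ^ N)\<^sup>2) a (b - 3) (2 * N) else 0) = 0"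
      using False sq0[of a "b - 3"] by simp
    show "(if 3 \<le> a then cf ((P_pol ^ N)\<^sup>2) (a - 3) b (2 * N) else 0) +
      (if 3 \<le> b then cf ((P_pol ^ N)\<^sup>2) a (b - 3) (2 * N) else 0) =
      (if a + b = 3 * (2 * N + 1) \<and> 3 dvd a then 1 else 0)"
    proof (cases "even b")
      case b: False
      then have "a + b \<noteq> 3 * (2 * N + 1)" using False by presburger
      then show ?thesis unfolding 1 using b sq0[of "a - 3" b] by simp
    next
      case True
      then obtain b' where b: "b = 2 * b'" by (auto elim: evenE)
      show ?thesis
      proof (cases "a'' = 0")
        case True
        then have "a = 1" using a'' by simp
        then show ?thesis unfolding 1 by simp
      next
        case False
        then obtain a' where a: "a = 2 * a' + 3" using a'' by (cases a'') auto
        have e: "a + b = 3 * (2 * N + 1) \<longleftrightarrow> a' + b' = 3 * N" unfolding a b by presburger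
        have d: "3 dvd a \<longleftrightarrow> 3 dvd a'" unfolding a by presburger
        show ?thesis unfolding 1 e d using sq[of a' b'] unfolding a b by simp
      qed
    qed
  qed
qed

text \<open>As \<open>3(4Q - 1) = 12Q - 3\<close>, the only monomial of \<open>\<O>\<^bsub>12Q-3\<^esub>\<close> is \<open>(xyz)\<^bsup>4Q-1\<^esup>\<close>.\<close>

lemma v_mult_small_iff:
  assumes p: "homogeneous (6 * Q - 5) p" and Q: "Q \<ge> 2"
  shows "v_pol Q * p \<in> small_zero Q \<longleftrightarrow> cf p (4 * Q - 2) (Q - 2) (Q - 1) = 0"
proof -
  have cv: "cf (v_pol Q * p) a b c = (if 1 \<le> a \<and> 3 * Q + 1 \<le> b \<and> 3 * Q \<le> c
      then cf p (a - 1) (b - (3 * Q + 1)) (c - 3 * Q) else 0)" for a b c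
    unfolding v_pol_eq cf_monomial_mult ..
  have top: "cf (v_pol Q * p) (4 * Q - 1) (4 * Q - 1) (4 * Q - 1) = cf p (4 * Q - 2) (Q - 2) (Q - 1)"
  proof -
    have "1 \<le> 4 * Q - 1 \<and> 3 * Q + 1 \<le> 4 * Q - 1 \<and> 3 * Q \<le> 4 * Q - 1"
      "4 * Q - 1 - 1 = 4 * Q - 2" "4 * Q - 1 - (3 * Q + 1) = Q - 2" "4 * Q - 1 - 3 * Q = Q - 1" using Q by auto
    then show ?thesis unfolding cv by simp
  qed
  show ?thesis
  proof
    assume "v_pol Q * p \<in> small_zero Q"
    from small_zeroD[OF this, of "4 * Q - 1" "4 * Q - 1" "4 * Q - 1"]
    show "cf p (4 * Q - 2) (Q - 2) (Q - 1) = 0" using top Q by simp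
  next
    assume 0: "cf p (4 * Q - 2) (Q - 2) (Q - 1) = 0"
    have "cf (v_pol Q * p) a b c = 0" if abc: "a < 4 * Q" "b < 4 * Q" "c < 4 * Q" for a b c
    proof (rule ccontr)
      assume nz: "cf (v_pol Q * p) a b c \<noteq> 0"
      then have le: "1 \<le> a \<and> 3 * Q + 1 \<le> b \<and> 3 * Q \<le> c" unfolding cv by (rule contrapos_np) (simp only: if_False)
      then have "cf p (a - 1) (b - (3 * Q + 1)) (c - 3 * Q) \<noteq> 0" using nz unfolding cv by simp
      then have "a - 1 + (b - (3 * Q + 1)) + (c - 3 * Q) = 6 * Q - 5" using p unfolding homogeneous_iff by blast
      then have "a = 4 * Q - 1" "b = 4 * Q - 1" "c = 4 * Q - 1" using le abc Q by linarith+
      then show False using nz 0 top by simp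
    qed
    then show "v_pol Q * p \<in> small_zero Q" unfolding small_zero_def by blast
  qed
qed

text \<open>This makes \<open>mult_v\<close> single-valued on cosets. The coefficient that decides
  has z-exponent Q - 1 = 2^n - 1, which no smaller power of P contains.\<close>

lemma v_mult_W0:
  assumes n: "n \<ge> 1" "Q = 2 ^ n" and w: "w \<in> W0_set Q"
  shows "v_pol Q * w \<in> small_zero Q"
proof -
  have "(2::nat) ^ 1 \<le> 2 ^ n" using n(1) by (intro power_increasing) auto
  then have Q: "Q \<ge> 2" using n(2) by simp
  have "v_pol Q * (xx ^ i * yy ^ j * P_pol ^ k) \<in> small_zero Q" if "i + j + 4 * k = 6 * Q - 5" "k < Q - 1" for i j k
    unfolding v_mult_small_iff[OF homogeneous_P_power[of i j k, unfolded that(1)] Q] cf_xy_mult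
    using cf_P_power_low[of k n] that(2) n(2) by simp
  then have "{xx ^ i * yy ^ j * P_pol ^ k | i j k. i + j + 4 * k = 6 * Q - 5 \<and> k < Q - 1} \<subseteq> {w. v_pol Q * w \<in> small_zero Q}"
    by blast
  moreover have "pol_vs.subspace {w. v_pol Q * w \<in> small_zero Q}"
    unfolding pol_vs.subspace_def by (simp add: distrib_left small_zero_add mult.left_commute[of "v_pol Q"] small_zero_mult)
  ultimately have "W0_set Q \<subseteq> {w. v_pol Q * w \<in> small_zero Q}"
    unfolding W0_set_def lspan_def by (rule pol_vs.span_minimal)
  then show ?thesis using w by blast
qed

lemma homogeneous_E: "t \<le> 2 * Q - 1 \<Longrightarrow> Q \<ge> 1 \<Longrightarrow> homogeneous (6 * Q - 5) (E_pol Q t)"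
proof -
  assume "t \<le> 2 * Q - 1" "Q \<ge> 1"
  then have "t + (2 * Q - 1 - t) + 4 * (Q - 1) = 6 * Q - 5" by auto
  then show ?thesis using homogeneous_P_power[of t "2 * Q - 1 - t" "Q - 1"] unfolding E_pol_def by simp
qed

lemma homogeneous_G: "i < Q \<Longrightarrow> homogeneous (6 * Q - 5) (G_pol Q i)"
  unfolding G_pol_def by (intro homogeneous_add homogeneous_E) auto

lemma cf_E_top:
  assumes n: "Q = 2 ^ n" "Q \<ge> 2" and t: "t \<le> 2 * Q - 1"
  shows "cf (E_pol Q t) (4 * Q - 2) (Q - 2) (Q - 1) = (if Q + 1 \<le> t \<and> 3 dvd 4 * int Q - 2 - int t then 1 else 0)"
proof (cases "Q + 1 \<le> t")
  case True
  then have le: "t \<le> 4 * Q - 2 \<and> 2 * Q - 1 - t \<le> Q - 2" and s: "4 * Q - 2 - t + (Q - 2 - (2 * Q - 1 - t)) = 3 * (Q - 1)"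
    using n(2) t by linarith+
  have "int (4 * Q - 2 - t) = 4 * int Q - 2 - int t" using le n(2) by linarith
  then have "3 dvd 4 * Q - 2 - t \<longleftrightarrow> 3 dvd 4 * int Q - 2 - int t"
    by (metis of_nat_dvd_iff of_nat_numeral)
  then show ?thesis unfolding E_pol_def cf_xy_mult using le s True cf_P_power_top[of n, folded n(1)] by simp
next
  case False
  then have "\<not> 2 * Q - 1 - t \<le> Q - 2" using n(2) by linarith
  then show ?thesis unfolding E_pol_def cf_xy_mult using False by simp
qed

lemma residue_block_iff_dvd:
  "i \<in> residue_block Q (2 * Q + 2) \<longleftrightarrow> i < Q \<and> 3 dvd 2 * int Q + 2 - int i"
proof -
  have "i \<in> residue_block Q (2 * Q + 2) \<longleftrightarrow> i < Q \<and> int (2 * Q + 2) mod 3 = int i mod 3"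
    using of_nat_eq_iff[of "(2 * Q + 2) mod 3" "i mod 3", where 'a = int] unfolding residue_block_def
    by (simp only: of_nat_mod of_nat_numeral mem_Collect_eq eq_commute)
  then show ?thesis by (simp add: mod_eq_dvd_iff add.commute)
qed

text \<open>The indices 2i and 2Q - 1 - 2i have sum 2Q - 1, so exactly one of them reaches Q + 1
  unless they are Q and Q - 1. The exception is i = Q/2, which is outside the class. Both indices
  lead to the same divisibility by 3.\<close>

lemma cf_G_top:
  assumes n: "n \<ge> 1" "Q = 2 ^ n" and i: "i < Q"
  shows "cf (G_pol Q i) (4 * Q - 2) (Q - 2) (Q - 1) = (if i \<in> residue_block Q (2 * Q + 2) then 1 else 0)"
proof -
  obtain Q' where Q': "Q = 2 * Q'" using n by (cases n) auto
  have Q'1: "Q' \<ge> 1" using i Q' by simp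
  then have Q2: "Q \<ge> 2" using Q' by simp
  have le: "2 * i \<le> 2 * Q - 1" "2 * Q - 1 - 2 * i \<le> 2 * Q - 1" using i by auto
  have i1: "int (2 * i) = 2 * int i" "int (2 * Q - 1 - 2 * i) = 2 * int Q - 1 - 2 * int i" using i by auto
  have a: "3 dvd 4 * int Q - 2 - int (2 * i) \<longleftrightarrow> 3 dvd 2 * int Q + 2 - int i"
    unfolding i1 by presburger
  have b: "3 dvd 4 * int Q - 2 - int (2 * Q - 1 - 2 * i) \<longleftrightarrow> 3 dvd 2 * int Q + 2 - int i"
    unfolding i1 by presburger
  have nQ: "\<not> 3 dvd 2 * int Q + 2 - int i" if "i = Q'"
  proof -
    have "2 * int Q + 2 - int i = 3 * (int Q' + 1) - 1" using that Q' by simp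
    then show ?thesis by presburger
  qed
  consider "2 * i \<ge> Q + 1" "\<not> 2 * Q - 1 - 2 * i \<ge> Q + 1" | "2 * Q - 1 - 2 * i \<ge> Q + 1" "\<not> 2 * i \<ge> Q + 1" | "i = Q'"
    using Q' i by linarith
  then show ?thesis
  proof cases
    case 3
    have "\<not> Q + 1 \<le> 2 * i" "\<not> Q + 1 \<le> 2 * Q - 1 - 2 * i" using 3 Q' by auto
    then show ?thesis using nQ[OF 3] i
      unfolding G_pol_def cf_add cf_E_top[OF n(2) Q2 le(1)] cf_E_top[OF n(2) Q2 le(2)] residue_block_iff_dvd by simp
  qed (use i in \<open>simp_all only: G_pol_def cf_add cf_E_top[OF n(2) Q2 le(1)] cf_E_top[OF n(2) Q2 le(2)] residue_block_iff_dvd a b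
      simp_thms if_False add_0_left add_0_right\<close>)
qed

section \<open>Independence modulo gW_0\<close>

definition zdeg_less :: "nat \<Rightarrow> pol \<Rightarrow> bool" where
  "zdeg_less n p \<longleftrightarrow> (\<forall>a b c. n \<le> c \<longrightarrow> cf p a b c = 0)"

lemma zdeg_lessD: "zdeg_less n p \<Longrightarrow> n \<le> c \<Longrightarrow> cf p a b c = 0"
  by (simp add: zdeg_less_def)

lemma zdeg_less_mono: "zdeg_less m p \<Longrightarrow> m \<le> n \<Longrightarrow> zdeg_less n p"
  by (simp add: zdeg_less_def)

lemma zdeg_less_0 [simp]: "zdeg_less n 0"
  and zdeg_less_add: "zdeg_less n p \<Longrightarrow> zdeg_less n q \<Longrightarrow> zdeg_less n (p + q)"
  and zdeg_less_Const: "zdeg_less n p \<Longrightarrow> zdeg_less n (Const c * p)"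
  by (simp_all add: zdeg_less_def)

lemma zdeg_less_monomial: "k < n \<Longrightarrow> zdeg_less n (xx ^ i * yy ^ j * zz ^ k)"
  by (auto simp: zdeg_less_def cf_monomial)

lemma zdeg_less_keys: "zdeg_less n p \<longleftrightarrow> (\<forall>e\<in>Poly_Mapping.keys p. Poly_Mapping.lookup e VZ < n)"
proof
  assume p: "zdeg_less n p"
  show "\<forall>e\<in>Poly_Mapping.keys p. Poly_Mapping.lookup e VZ < n"
  proof
    fix e assume e: "e \<in> Poly_Mapping.keys p"
    obtain a b c where abc: "e = expo a b c" by (rule expo_cases)
    then have "cf p a b c \<noteq> 0" using e by (simp add: cf_def in_keys_iff)
    then have "\<not> n \<le> c" using p zdeg_lessD by blast
    then show "Poly_Mapping.lookup e VZ < n" using abc by simp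
  qed
next
  assume p: "\<forall>e\<in>Poly_Mapping.keys p. Poly_Mapping.lookup e VZ < n"
  have "cf p a b c = 0" if "n \<le> c" for a b c
  proof (rule ccontr)
    assume "cf p a b c \<noteq> 0"
    then have "expo a b c \<in> Poly_Mapping.keys p" by (simp add: cf_def in_keys_iff)
    then have "Poly_Mapping.lookup (expo a b c) VZ < n" using p by blast
    then show False using that by simp
  qed
  then show "zdeg_less n p" by (simp add: zdeg_less_def)
qed

lemma zdeg_less_mult:
  assumes "zdeg_less m p" "zdeg_less (Suc n) q"
  shows "zdeg_less (m + n) (p * q)"
  unfolding zdeg_less_keys
proof
  fix e assume "e \<in> Poly_Mapping.keys (p * q)"
  then obtain f g where "e = f + g" "f \<in> Poly_Mapping.keys p" "g \<in> Poly_Mapping.keys q"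
    using keys_mult by blast
  then have "Poly_Mapping.lookup e VZ = Poly_Mapping.lookup f VZ + Poly_Mapping.lookup g VZ"
    "Poly_Mapping.lookup f VZ < m" "Poly_Mapping.lookup g VZ < Suc n"
    using assms unfolding zdeg_less_keys by (simp_all add: lookup_add)
  then show "Poly_Mapping.lookup e VZ < m + n" by linarith
qed

definition zmonic :: "nat \<Rightarrow> pol \<Rightarrow> bool" where
  "zmonic n p \<longleftrightarrow> (\<exists>r. p = zz ^ n + r \<and> zdeg_less n r)"

lemma zdeg_less_zz: "zdeg_less (Suc n) (zz ^ n)"
  using zdeg_less_monomial[of n "Suc n" 0 0] by simp

lemma zmonic_zdeg: "zmonic n p \<Longrightarrow> zdeg_less (Suc n) p"
  unfolding zmonic_def using zdeg_less_zz zdeg_less_add zdeg_less_mono[of n _ "Suc n"] by auto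

lemma zmonic_mult:
  assumes "zmonic m p" "zmonic n q"
  shows "zmonic (m + n) (p * q)"
proof -
  obtain r s where r: "p = zz ^ m + r" "zdeg_less m r" and s: "q = zz ^ n + s" "zdeg_less n s"
    using assms unfolding zmonic_def by blast
  have "p * q = zz ^ (m + n) + (s * zz ^ m + r * q)"
    unfolding r(1) s(1) by (simp add: power_add algebra_simps)
  moreover have "zdeg_less (m + n) (s * zz ^ m + r * q)"
    using zdeg_less_mult[OF s(2) zdeg_less_zz[of m]] zdeg_less_mult[OF r(2) zmonic_zdeg[OF assms(2)]]
    by (intro zdeg_less_add) (simp_all add: add.commute)
  ultimately show ?thesis unfolding zmonic_def by blast
qed

lemma zmonic_P: "zmonic 4 P_pol"
  unfolding zmonic_def
proof (intro exI conjI)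
  show "P_pol = zz ^ 4 + (xx ^ 1 * yy ^ 1 * zz ^ 2 + (xx ^ 3 * yy ^ 0 * zz ^ 1 + xx ^ 0 * yy ^ 3 * zz ^ 1))"
    by (simp add: P_pol_def algebra_simps)
  show "zdeg_less 4 (xx ^ 1 * yy ^ 1 * zz ^ 2 + (xx ^ 3 * yy ^ 0 * zz ^ 1 + xx ^ 0 * yy ^ 3 * zz ^ 1))"
    by (intro zdeg_less_add zdeg_less_monomial) simp_all
qed

lemma zmonic_g: "zmonic 4 (g_pol \<alpha>)"
proof -
  obtain r where r: "P_pol = zz ^ 4 + r" "zdeg_less 4 r" using zmonic_P unfolding zmonic_def by blast
  have "g_pol \<alpha> = zz ^ 4 + (r + Const \<alpha> * (xx ^ 2 * yy ^ 2 * zz ^ 0))"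
    unfolding g_pol_def r(1) by (simp add: algebra_simps)
  moreover have "zdeg_less 4 (r + Const \<alpha> * (xx ^ 2 * yy ^ 2 * zz ^ 0))"
    by (intro zdeg_less_add zdeg_less_Const zdeg_less_monomial r(2)) simp
  ultimately show ?thesis unfolding zmonic_def by blast
qed

lemma zmonic_P_power: "zmonic (4 * k) (P_pol ^ k)"
proof (induction k)
  case 0
  show ?case unfolding zmonic_def by (intro exI[of _ 0]) simp
next
  case (Suc k)
  then show ?case using zmonic_mult[OF zmonic_P Suc.IH] by simp
qed

lemma zmonic_g_P_power: "zmonic (4 * (k + 1)) (g_pol \<alpha> * P_pol ^ k)"
  using zmonic_mult[OF zmonic_g zmonic_P_power[of k]] by simp

lemma zmonic_coeff_high:
  assumes "zdeg_less 1 h" "zmonic n p" "n < c"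
  shows "cf (h * p) a b c = 0"
  using zdeg_less_mult[of "Suc n" p 0 h] zmonic_zdeg[OF assms(2)] assms(1,3)
  by (intro zdeg_lessD[of "Suc n"]) (simp_all add: mult.commute)

lemma zmonic_coeff:
  assumes "zdeg_less 1 h" "zmonic n p"
  shows "cf (h * p) a b n = cf h a b 0"
proof -
  obtain r where r: "p = zz ^ n + r" "zdeg_less n r" using assms(2) unfolding zmonic_def by blast
  have "h * p = xx ^ 0 * yy ^ 0 * zz ^ n * h + r * h"
    unfolding r(1) by (simp add: algebra_simps)
  moreover have "cf (r * h) a b n = 0"
    using zdeg_less_mult[OF r(2), of 0 h] assms(1) by (intro zdeg_lessD[of n]) simp_all
  ultimately show ?thesis by (simp only: cf_add cf_monomial_mult) simp
qed

text \<open>An expansion in powers of P with coefficients free of z: as P is monic in z, the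
  z-degree of each summand can be read off.\<close>

lemma W0_set_expansion:
  assumes "w \<in> W0_set Q"
  obtains h where "w = (\<Sum>k<Q - 1. h k * P_pol ^ k)" "\<And>k. zdeg_less 1 (h k)"
proof -
  let ?S = "{w. \<exists>h. w = (\<Sum>k<Q - 1. h k * P_pol ^ k) \<and> (\<forall>k. zdeg_less 1 (h k))}"
  have "{xx ^ i * yy ^ j * P_pol ^ k | i j k. i + j + 4 * k = 6 * Q - 5 \<and> k < Q - 1} \<subseteq> ?S"
  proof
    fix w assume "w \<in> {xx ^ i * yy ^ j * P_pol ^ k | i j k. i + j + 4 * k = 6 * Q - 5 \<and> k < Q - 1}"
    then obtain i j k where w: "w = xx ^ i * yy ^ j * P_pol ^ k" "k < Q - 1" by blast
    have "(\<Sum>l<Q - 1. (if l = k then xx ^ i * yy ^ j else 0) * P_pol ^ l) =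
        (\<Sum>l<Q - 1. if l = k then xx ^ i * yy ^ j * P_pol ^ l else 0)"
      by (intro sum.cong) auto
    also have "\<dots> = w" using w by simp
    finally have eq: "w = (\<Sum>l<Q - 1. (if l = k then xx ^ i * yy ^ j else 0) * P_pol ^ l)" by simp
    moreover have "zdeg_less 1 (if l = k then xx ^ i * yy ^ j else 0)" for l
      using zdeg_less_monomial[of 0 1 i j] by simp
    ultimately show "w \<in> ?S" by (intro CollectI exI[of _ "\<lambda>l. if l = k then xx ^ i * yy ^ j else 0"]) blast
  qed
  moreover have "pol_vs.subspace ?S"
    unfolding pol_vs.subspace_def
  proof (intro conjI ballI allI)
    show "0 \<in> ?S" by (intro CollectI exI[of _ "\<lambda>_. 0"]) simp
  next
    fix v w assume "v \<in> ?S" "w \<in> ?S"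
    then obtain h h' where "v = (\<Sum>k<Q - 1. h k * P_pol ^ k)" "\<forall>k. zdeg_less 1 (h k)"
      "w = (\<Sum>k<Q - 1. h' k * P_pol ^ k)" "\<forall>k. zdeg_less 1 (h' k)" by blast
    then show "v + w \<in> ?S"
      by (intro CollectI exI[of _ "\<lambda>k. h k + h' k"]) (simp add: zdeg_less_add distrib_right sum.distrib)
  next
    fix c v assume "v \<in> ?S"
    then obtain h where "v = (\<Sum>k<Q - 1. h k * P_pol ^ k)" "\<forall>k. zdeg_less 1 (h k)" by blast
    then show "Const c * v \<in> ?S"
      by (intro CollectI exI[of _ "\<lambda>k. Const c * h k"]) (simp add: zdeg_less_Const mult.assoc sum_distrib_left)
  qed
  ultimately have "W0_set Q \<subseteq> ?S"
    unfolding W0_set_def lspan_def by (rule pol_vs.span_minimal)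
  then show thesis using assms that by blast
qed

text \<open>Both \<open>g\<close> and \<open>P\<close> are monic in \<open>z\<close>, so the leading coefficient of the topmost term of \<open>g w\<close>
  that is non-zero in \<open>\<O>\<close> cannot cancel.\<close>

lemma small_if_low_zdeg:
  assumes w: "w \<in> W0_set Q" and T: "zdeg_less 4 p" and s: "p - g_pol \<alpha> * w \<in> small_zero Q"
  shows "p \<in> small_zero Q"
proof -
  obtain h where h: "w = (\<Sum>k<Q - 1. h k * P_pol ^ k)" "\<And>k. zdeg_less 1 (h k)"
    using W0_set_expansion[OF w] by blast
  let ?B = "{k. k < Q - 1 \<and> h k \<notin> small_zero Q}"
  have gw: "g_pol \<alpha> * w = (\<Sum>k<Q - 1. h k * (g_pol \<alpha> * P_pol ^ k))"
    unfolding h(1) sum_distrib_left by (intro sum.cong refl) (simp only: mult.left_commute)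
  have "?B = {}"
  proof (rule ccontr)
    assume ne: "?B \<noteq> {}"
    have fin: "finite ?B" by simp
    define K where "K = Max ?B"
    have "K \<in> ?B" unfolding K_def by (rule Max_in[OF fin ne])
    then have K: "K < Q - 1" "h K \<notin> small_zero Q" by auto
    have K_max: "h k \<in> small_zero Q" if "K < k" "k < Q - 1" for k
    proof (rule ccontr)
      assume "h k \<notin> small_zero Q"
      then have "k \<le> K" unfolding K_def using that fin by (intro Max_ge) auto
      then show False using that by simp
    qed
    obtain a b c where abc: "a < 4 * Q" "b < 4 * Q" "c < 4 * Q" "cf (h K) a b c \<noteq> 0"
      using K(2) unfolding small_zero_def by blast
    have "c = 0"
    proof (rule ccontr)
      assume "c \<noteq> 0"
      then have "1 \<le> c" by simp
      then show False using zdeg_lessD[OF h(2)] abc(4) by blast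
    qed
    \<comment> \<open>At this z-exponent the summands below K have too small a degree in z, and
      those above K vanish in O. It is less than 4Q because K < Q - 1, so the coefficient survives
      in O.\<close>
    let ?d = "4 * (K + 1)"
    have d: "?d < 4 * Q" using K(1) by simp
    have "cf (h k * (g_pol \<alpha> * P_pol ^ k)) a b ?d = (if k = K then cf (h K) a b 0 else 0)" if "k < Q - 1" for k
    proof (cases k K rule: linorder_cases)
      case less
      then have "4 * (k + 1) < ?d" by simp
      from zmonic_coeff_high[OF h(2) zmonic_g_P_power this] show ?thesis using less by simp
    next
      case equal
      then show ?thesis using zmonic_coeff[OF h(2) zmonic_g_P_power] by simp
    next
      case greater
      have "(g_pol \<alpha> * P_pol ^ k) * h k \<in> small_zero Q"
        by (rule small_zero_mult[OF K_max[OF greater that]])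
      then have "cf ((g_pol \<alpha> * P_pol ^ k) * h k) a b ?d = 0"
        using abc d by (intro small_zeroD)
      then show ?thesis using greater by (simp add: mult.commute)
    qed
    then have "cf (g_pol \<alpha> * w) a b ?d = (\<Sum>k<Q - 1. if k = K then cf (h K) a b 0 else 0)"
      unfolding gw cf_sum by (intro sum.cong refl) (simp only: lessThan_iff)
    also have "\<dots> = cf (h K) a b 0" using K(1) by simp
    finally have "cf (g_pol \<alpha> * w) a b ?d \<noteq> 0" using abc(4) \<open>c = 0\<close> by simp
    moreover have "cf p a b ?d = 0" using T by (rule zdeg_lessD) simp
    moreover have "cf (p - g_pol \<alpha> * w) a b ?d = 0" using s abc d by (intro small_zeroD)
    ultimately show False by simp
  qed
  then have "h k \<in> small_zero Q" if "k < Q - 1" for k using that by blast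
  then have gw0: "g_pol \<alpha> * w \<in> small_zero Q"
    unfolding gw by (intro small_zero_sum, subst mult.commute) (simp only: small_zero_mult lessThan_iff)
  show ?thesis using small_zero_add[OF s gw0] by simp
qed

lemma cf_gamma_0: "cf (gamma_pol Q) a b 0 = 0"
proof -
  have "gamma_pol Q = xx ^ (2 * Q - 2) * yy ^ 1 * R_pol Q + xx ^ 1 * yy ^ (2 * Q - 2) * R_pol Q"
    by (simp add: gamma_pol_def distrib_right)
  then show ?thesis by (simp only: cf_add cf_xy_mult cf_R) simp
qed

lemma zdeg_less_gamma: "zdeg_less 4 (gamma_pol Q)"
proof -
  have "gamma_pol Q = xx ^ (2 * Q - 2) * yy ^ 1 * R_pol Q + xx ^ 1 * yy ^ (2 * Q - 2) * R_pol Q"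
    by (simp add: gamma_pol_def distrib_right)
  then show ?thesis unfolding zdeg_less_def by (simp only: cf_add cf_xy_mult cf_R) auto
qed

text \<open>The residues modulo 3 let only the first of the two multiples of R in gamma contain this
  monomial, and its factor z^2 keeps it apart from every H_j.\<close>

lemma cf_gamma_top:
  assumes "Q \<ge> 2" "\<not> 3 dvd int Q"
  shows "cf (gamma_pol Q) (4 * Q - 3) (2 * Q) 2 = 1"
proof -
  have g: "gamma_pol Q = xx ^ (2 * Q - 2) * yy ^ 1 * R_pol Q + xx ^ 1 * yy ^ (2 * Q - 2) * R_pol Q"
    by (simp add: gamma_pol_def distrib_right)
  have s: "2 * Q - 2 + 1 = 2 * Q - 1" "1 + (2 * Q - 2) = 2 * Q - 1" "1 \<le> Q"
    "4 * Q - 3 < 4 * Q" "2 * Q < 4 * Q" "4 * Q - 3 + 2 * Q + 2 = 6 * Q - 1" using assms(1) by auto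
  have i: "int (4 * Q - 3) = 4 * int Q - 3" "int (2 * Q - 2) = 2 * int Q - 2" "int (2 * Q) = 2 * int Q"
    using assms(1) by auto
  have "3 dvd (int (4 * Q - 3) - int (2 * Q)) - (int (2 * Q - 2) - int 1)" unfolding i by simp
  moreover have "\<not> 3 dvd (int (4 * Q - 3) - int (2 * Q)) - (int 1 - int (2 * Q - 2))"
    unfolding i using assms(2) by presburger
  ultimately show ?thesis
    unfolding g cf_add cf_monomial_R[OF s(1) assms(2) s(3,4,5)] cf_monomial_R[OF s(2) assms(2) s(3,4,5)] s(6)
    by (simp only: simp_thms if_True if_False add_0_right)
qed

lemma cf_H_nonzero_z: "0 < c \<Longrightarrow> cf (H_pol Q j) a b c = 0"
  unfolding H_pol_def F_pol_def cf_add cf_xy by simp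

lemma cf_H:
  assumes "j < Q" "i < Q"
  shows "cf (H_pol Q i) (2 * Q + 2 * j) (4 * Q - 1 - 2 * j) 0 = (if i = j then 1 else 0)"
proof -
  have "2 * Q + 2 * j \<noteq> 2 * Q + (2 * Q - 1 - 2 * i)" using assms(2) by presburger
  moreover have "2 * Q + 2 * j = 2 * Q + 2 * i \<and> 4 * Q - 1 - 2 * j = 4 * Q - 1 - 2 * i \<longleftrightarrow> i = j" by auto
  ultimately show ?thesis unfolding H_pol_def F_pol_def cf_add cf_xy by simp
qed

text \<open>All elements involved have z-degree below 4, so by \<open>small_if_low_zdeg\<close> a
  relation modulo gW_0 already holds in O, where suitable monomials isolate the
  coefficients.\<close>

lemma H_gamma_independent:
  assumes Q: "Q \<ge> 2" "\<not> 3 dvd int Q"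
    and g: "gcong \<alpha> Q (Const d * gamma_pol Q + (\<Sum>j<Q. Const (a j) * H_pol Q j)) 0"
  shows "d = 0" "\<And>j. j < Q \<Longrightarrow> a j = 0"
proof -
  let ?p = "Const d * gamma_pol Q + (\<Sum>j<Q. Const (a j) * H_pol Q j)"
  obtain w where w: "w \<in> W0_set Q" "?p - g_pol \<alpha> * w \<in> small_zero Q"
    using g unfolding gcong_def by auto
  have "zdeg_less 4 (\<Sum>j<Q. Const (a j) * H_pol Q j)"
    unfolding zdeg_less_def cf_sum cf_Const_mult using cf_H_nonzero_z by auto
  then have "zdeg_less 4 ?p" by (intro zdeg_less_add zdeg_less_Const zdeg_less_gamma)
  then have p: "?p \<in> small_zero Q" using small_if_low_zdeg[OF w(1) _ w(2)] by blast
  have "cf ?p (4 * Q - 3) (2 * Q) 2 = 0" using Q(1) by (intro small_zeroD[OF p]) auto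
  moreover have "cf ?p (4 * Q - 3) (2 * Q) 2 = d"
    unfolding cf_add cf_Const_mult cf_sum cf_gamma_top[OF Q] by (simp add: cf_H_nonzero_z)
  ultimately show "d = 0" by simp
  fix j assume j: "j < Q"
  have "cf ?p (2 * Q + 2 * j) (4 * Q - 1 - 2 * j) 0 = 0" using j by (intro small_zeroD[OF p]) auto
  moreover have "cf ?p (2 * Q + 2 * j) (4 * Q - 1 - 2 * j) 0 = (\<Sum>i<Q. if i = j then a j else 0)"
    unfolding cf_add cf_Const_mult cf_sum cf_gamma_0 mult_zero_right add_0_left
  proof (rule sum.cong[OF refl])
    fix i assume "i \<in> {..<Q}"
    then have "cf (H_pol Q i) (2 * Q + 2 * j) (4 * Q - 1 - 2 * j) 0 = (if i = j then 1 else 0)"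
      by (intro cf_H[OF j]) simp
    then show "a i * cf (H_pol Q i) (2 * Q + 2 * j) (4 * Q - 1 - 2 * j) 0 = (if i = j then a j else 0)"
      by simp
  qed
  ultimately show "a j = 0" using j by simp
qed

section \<open>The maps on X\<close>

lemma O_coset_eq: "cls Q ` A +>\<^bsub>O_ring Q\<^esub> cls Q p = (\<lambda>w. cls Q (w + p)) ` A"
  unfolding a_r_coset_def' by (auto simp: cls_add)

lemma W0_sp_eq: "W0_sp Q = cls Q ` W0_set Q"
  by (simp add: W0_sp_def W0_set_def)

lemma gW0_eq: "gW0 \<alpha> Q = cls Q ` (\<lambda>w. g_pol \<alpha> * w) ` W0_set Q"
  by (simp add: gW0_def W0_sp_eq image_image cls_mult)

lemma gW0_coset: "gW0 \<alpha> Q +>\<^bsub>O_ring Q\<^esub> cls Q p = (\<lambda>w. cls Q (g_pol \<alpha> * w + p)) ` W0_set Q"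
  unfolding gW0_eq O_coset_eq by (simp add: image_image)

lemma mult_g_coset:
  "mult_g \<alpha> Q (W0_sp Q +>\<^bsub>O_ring Q\<^esub> cls Q p) = gW0 \<alpha> Q +>\<^bsub>O_ring Q\<^esub> cls Q (g_pol \<alpha> * p)"
  unfolding gW0_coset mult_g_def W0_sp_eq O_coset_eq by (simp add: image_image cls_mult distrib_left)

lemma mult_v_coset:
  assumes "n \<ge> 1" "Q = 2 ^ n"
  shows "mult_v Q (W0_sp Q +>\<^bsub>O_ring Q\<^esub> cls Q p) = cls Q (v_pol Q * p)"
proof -
  have "cls Q (v_pol Q * (w + p)) = cls Q (v_pol Q * p)" if "w \<in> W0_set Q" for w
    unfolding cls_eq_iff using v_mult_W0[OF assms that] by (simp add: distrib_left)
  then have "(\<lambda>w. cls Q (v_pol Q) \<otimes>\<^bsub>O_ring Q\<^esub> w) ` (W0_sp Q +>\<^bsub>O_ring Q\<^esub> cls Q p) = (\<lambda>w. cls Q (v_pol Q * p)) ` W0_set Q"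
    unfolding W0_sp_eq O_coset_eq image_image cls_mult by (intro image_cong refl) simp
  also have "\<dots> = {cls Q (v_pol Q * p)}" using W0_set_closed(1) by auto
  finally show ?thesis unfolding mult_v_def by simp
qed

lemma gW0_coset_subset:
  assumes "gcong \<alpha> Q p q"
  shows "gW0 \<alpha> Q +>\<^bsub>O_ring Q\<^esub> cls Q p \<subseteq> gW0 \<alpha> Q +>\<^bsub>O_ring Q\<^esub> cls Q q"
proof -
  obtain w where w: "w \<in> W0_set Q" "p - q - g_pol \<alpha> * w \<in> small_zero Q"
    using assms unfolding gcong_def by blast
  have "cls Q (g_pol \<alpha> * v + p) = cls Q (g_pol \<alpha> * (v + w) + q)" for v
  proof -
    have eq: "g_pol \<alpha> * v + p - (g_pol \<alpha> * (v + w) + q) = p - q - g_pol \<alpha> * w"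
      by (simp add: algebra_simps)
    show ?thesis unfolding cls_eq_iff eq by (rule w(2))
  qed
  then show ?thesis unfolding gW0_coset using W0_set_closed(2)[OF _ w(1)] by blast
qed

lemma gW0_coset_eq_iff:
  "gW0 \<alpha> Q +>\<^bsub>O_ring Q\<^esub> cls Q p = gW0 \<alpha> Q +>\<^bsub>O_ring Q\<^esub> cls Q q \<longleftrightarrow> gcong \<alpha> Q p q"
proof
  assume eq: "gW0 \<alpha> Q +>\<^bsub>O_ring Q\<^esub> cls Q p = gW0 \<alpha> Q +>\<^bsub>O_ring Q\<^esub> cls Q q"
  have "cls Q (g_pol \<alpha> * 0 + p) \<in> gW0 \<alpha> Q +>\<^bsub>O_ring Q\<^esub> cls Q p"
    unfolding gW0_coset using W0_set_closed(1) by blast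
  then have "cls Q (g_pol \<alpha> * 0 + p) \<in> gW0 \<alpha> Q +>\<^bsub>O_ring Q\<^esub> cls Q q" unfolding eq .
  then obtain w where w: "w \<in> W0_set Q" "cls Q (g_pol \<alpha> * 0 + p) = cls Q (g_pol \<alpha> * w + q)"
    unfolding gW0_coset by blast
  then have "p - q - g_pol \<alpha> * w \<in> small_zero Q" unfolding cls_eq_iff by (simp add: algebra_simps)
  then show "gcong \<alpha> Q p q" by (rule gcongI[OF w(1)])
next
  assume "gcong \<alpha> Q p q"
  then show "gW0 \<alpha> Q +>\<^bsub>O_ring Q\<^esub> cls Q p = gW0 \<alpha> Q +>\<^bsub>O_ring Q\<^esub> cls Q q"
    using gW0_coset_subset gcong_sym by blast
qed

section \<open>Coordinates on X and the two maps in these coordinates\<close>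

definition G_comb :: "nat \<Rightarrow> (nat \<Rightarrow> L) \<Rightarrow> pol" where
  "G_comb Q u = (\<Sum>i<Q. Const (u i) * G_pol Q i)"

lemma lspan_G:
  assumes "Q \<ge> 1"
  shows "lspan {G_pol Q i | i. i \<le> Q - 1} = range (G_comb Q)"
proof
  have "pol_vs.subspace (range (G_comb Q))"
    unfolding pol_vs.subspace_def
  proof (intro conjI ballI allI)
    show "0 \<in> range (G_comb Q)" by (rule range_eqI[of _ _ "\<lambda>_. 0"]) (simp add: G_comb_def)
  next
    fix p q assume "p \<in> range (G_comb Q)" "q \<in> range (G_comb Q)"
    then obtain u w where "p = G_comb Q u" "q = G_comb Q w" by blast
    then show "p + q \<in> range (G_comb Q)"
      by (intro range_eqI[of _ _ "\<lambda>i. u i + w i"]) (simp add: G_comb_def Const_add distrib_right sum.distrib)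
  next
    fix c p assume "p \<in> range (G_comb Q)"
    then obtain u where "p = G_comb Q u" by blast
    then have "Const c * p = G_comb Q (\<lambda>i. c * u i)"
      by (simp only: G_comb_def Const_mult mult.assoc sum_distrib_left)
    then show "Const c * p \<in> range (G_comb Q)" by (metis rangeI)
  qed
  moreover have "{G_pol Q i | i. i \<le> Q - 1} \<subseteq> range (G_comb Q)"
  proof
    fix p assume "p \<in> {G_pol Q i | i. i \<le> Q - 1}"
    then obtain i where i: "p = G_pol Q i" "i \<le> Q - 1" by blast
    then have "i < Q" using assms by simp
    have "G_comb Q (\<lambda>j. if j = i then 1 else 0) = (\<Sum>j<Q. if j = i then G_pol Q j else 0)"
      unfolding G_comb_def by (intro sum.cong) (auto simp: Const_1)
    also have "\<dots> = p" using \<open>i < Q\<close> i(1) by simp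
    finally show "p \<in> range (G_comb Q)" by (metis rangeI)
  qed
  ultimately show "lspan {G_pol Q i | i. i \<le> Q - 1} \<subseteq> range (G_comb Q)"
    unfolding lspan_def by (intro pol_vs.span_minimal)
  have "G_comb Q u \<in> lspan {G_pol Q i | i. i \<le> Q - 1}" for u
    unfolding G_comb_def lspan_def
    by (intro pol_vs.span_sum pol_vs.span_scale pol_vs.span_base) (use assms in auto)
  then show "range (G_comb Q) \<subseteq> lspan {G_pol Q i | i. i \<le> Q - 1}" by blast
qed

lemma G_comb_diff: "G_comb Q u - G_comb Q w = G_comb Q (\<lambda>i. u i - w i)"
proof -
  have "Const (a - b) = Const a - Const b" for a b by (simp add: Const_def single_diff)
  then show ?thesis by (simp add: G_comb_def left_diff_distrib sum_subtractf)
qed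

lemma homogeneous_G_comb: "homogeneous (6 * Q - 5) (G_comb Q u)"
proof -
  have "homogeneous (6 * Q - 5) (\<Sum>i\<in>A. Const (u i) * G_pol Q i)" if "A \<subseteq> {..<Q}" for A
    using finite_subset[OF that] that
    by (induction A) (auto simp: homogeneous_iff[of _ 0] intro!: homogeneous_add homogeneous_Const_mult homogeneous_G)
  then show ?thesis by (simp add: G_comb_def)
qed

text \<open>The right-hand side is the row B applied to the coordinate vector; with
  \<open>v_mult_small_iff\<close> this describes when multiplication by v gives 0.\<close>

lemma cf_G_comb_top:
  assumes "n \<ge> 1" "Q = 2 ^ n"
  shows "cf (G_comb Q u) (4 * Q - 2) (Q - 2) (Q - 1) = sum u (residue_block Q (2 * Q + 2))"
proof -
  have "cf (G_comb Q u) (4 * Q - 2) (Q - 2) (Q - 1) = (\<Sum>i<Q. u i * (if i \<in> residue_block Q (2 * Q + 2) then 1 else 0))"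
    unfolding G_comb_def cf_sum cf_Const_mult
    by (intro sum.cong refl) (simp only: cf_G_top[OF assms] lessThan_iff)
  also have "\<dots> = sum u (residue_block Q (2 * Q + 2))"
    by (rule sum.mono_neutral_cong_right) (auto simp: residue_block_def)
  finally show ?thesis .
qed

text \<open>This functional is the row C minus the row B.\<close>

definition gamma_coeff :: "nat \<Rightarrow> (nat \<Rightarrow> L) \<Rightarrow> L" where
  "gamma_coeff Q u = (\<Sum>i \<in> {..<Q} - residue_block Q (2 * Q + 2). u i)"

lemma g_mult_G_comb:
  assumes "m \<ge> 2" "Q = 2 ^ (m - 1)" "\<alpha> = \<beta>\<^sup>2 + \<beta>" "\<beta> ^ (2 ^ m) = \<beta>"
  shows "gcong \<alpha> Q (g_pol \<alpha> * G_comb Q u)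
    (Const (gamma_coeff Q u) * gamma_pol Q +
     (\<Sum>j<Q. Const (\<Sum>i<Q. special_fun (frob_coeff \<beta>) j i * u i) * H_pol Q j))"
proof -
  let ?B = "residue_block Q (2 * Q + 2)"
  let ?f = "special_fun (frob_coeff \<beta>)"
  have Const_sum: "Const (sum f A) = (\<Sum>i\<in>A. Const (f i))" for f :: "nat \<Rightarrow> L" and A
    by (induction A rule: infinite_finite_induct) (simp_all add: Const_add)
  have "gcong \<alpha> Q (\<Sum>i<Q. Const (u i) * (g_pol \<alpha> * G_pol Q i))
    (\<Sum>i<Q. Const (u i) * ((if i \<in> ?B then 0 else gamma_pol Q) + (\<Sum>j<Q. Const (?f i j) * H_pol Q j)))"
    by (intro gcong_sum gcong_Const g_mult_G[OF assms(1,2) _ assms(3,4)]) simp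
  also have "(\<Sum>i<Q. Const (u i) * (g_pol \<alpha> * G_pol Q i)) = g_pol \<alpha> * G_comb Q u"
    unfolding G_comb_def sum_distrib_left by (intro sum.cong refl) (simp only: mult.left_commute)
  also have "(\<Sum>i<Q. Const (u i) * ((if i \<in> ?B then 0 else gamma_pol Q) + (\<Sum>j<Q. Const (?f i j) * H_pol Q j))) =
    (\<Sum>i<Q. Const (u i) * (if i \<in> ?B then 0 else gamma_pol Q)) +
    (\<Sum>i<Q. \<Sum>j<Q. Const (u i) * (Const (?f i j) * H_pol Q j))"
    by (simp only: distrib_left sum.distrib sum_distrib_left)
  also have "(\<Sum>i<Q. Const (u i) * (if i \<in> ?B then 0 else gamma_pol Q)) = Const (gamma_coeff Q u) * gamma_pol Q"
    unfolding gamma_coeff_def Const_sum sum_distrib_right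
    by (rule sum.mono_neutral_cong_right) auto
  \<comment> \<open>The symmetry of \<open>special_fun\<close> turns the coefficient of H_j into the
    j-th entry of the matrix applied to \<open>u\<close>.\<close>
  also have "(\<Sum>i<Q. \<Sum>j<Q. Const (u i) * (Const (?f i j) * H_pol Q j)) =
    (\<Sum>j<Q. Const (\<Sum>i<Q. ?f j i * u i) * H_pol Q j)"
    unfolding Const_sum sum_distrib_right
    by (subst sum.swap) (intro sum.cong refl, simp add: Const_mult special_fun_sym[of _ _ "_ :: nat"] mult_ac)
  finally show ?thesis .
qed

section \<open>The conclusions for a given \<alpha>\<close>

locale alpha_data =
  fixes \<alpha> \<beta> :: L and m Q :: nat
  assumes \<alpha>_nonzero: "\<alpha> \<noteq> 0" and \<alpha>: "\<alpha> = \<beta>\<^sup>2 + \<beta>" and m_def: "m = deg_Z2 \<beta>" and Q_def: "Q = 2 ^ (m - 1)"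
begin

sublocale Z2_degree \<beta> m
  by unfold_locales (rule m_def)

lemma m_ge_2: "m \<ge> 2"
proof (rule ccontr)
  assume "\<not> m \<ge> 2"
  then have "m = 1" using m_pos by simp
  then have "\<beta>\<^sup>2 = \<beta>" using frobenius_m by simp
  then show False using \<alpha> \<alpha>_nonzero char2_add_self[OF two_L] by simp
qed

lemma n_pos: "m - 1 \<ge> 1"
  using m_ge_2 by simp

lemma Q_ge_2: "Q \<ge> 2"
proof -
  have "(2::nat) ^ 1 \<le> 2 ^ (m - 1)" using m_ge_2 by (intro power_increasing) auto
  then show ?thesis by (simp add: Q_def)
qed

lemma Q_not_dvd: "\<not> 3 dvd int Q"
  unfolding Q_def by (rule not_3_dvd_two_power)

lemma frob_coeff_nonzero: "Suc k < m \<Longrightarrow> frob_coeff \<beta> k \<noteq> 0"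
proof
  assume k: "Suc k < m" and "frob_coeff \<beta> k = 0"
  then have "\<beta> ^ (2 ^ Suc k) + \<beta> = \<beta> + \<beta>"
    using char2_add_self[OF two_L, of \<beta>] by (simp add: frob_coeff_def frob_diff_def)
  then have "\<beta> ^ (2 ^ Suc k) = \<beta>" by (rule add_right_imp_eq)
  then show False using frobenius_less_m[OF _ k] by simp
qed

text \<open>\<open>frob_coeff \<beta>\<close> vanishes at m - 1, so it cannot serve as a nowhere
  zero function. Distinct indices below Q = 2^(m-1) differ by a number of order less than m - 1,
  where it is non-zero, so the correction leaves the matrix unchanged.\<close>

definition special_coeff :: "nat \<Rightarrow> L" where
  "special_coeff k = (if frob_coeff \<beta> k = 0 then 1 else frob_coeff \<beta> k)"

lemma special_coeff_nonzero: "\<forall>k. special_coeff k \<noteq> 0"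
  by (simp add: special_coeff_def)

lemma special_fun_special_coeff:
  assumes "i < Q" "j < Q"
  shows "special_fun (frob_coeff \<beta>) i j = special_fun special_coeff i j"
proof (cases "i = j")
  case False
  let ?d = "int i - int j"
  have d0: "?d \<noteq> 0" using False by simp
  have "2 ^ multiplicity 2 ?d dvd ?d" by (rule multiplicity_dvd)
  then have "\<bar>2 ^ multiplicity 2 ?d\<bar> \<le> \<bar>?d\<bar>" by (rule dvd_imp_le_int[OF d0])
  also have "\<bar>?d\<bar> < int Q" using assms by linarith
  finally have "2 ^ multiplicity 2 ?d < (2::int) ^ (m - 1)" by (simp add: Q_def)
  then have "multiplicity 2 ?d < m - 1" by (rule power_less_imp_less_exp[rotated]) simp
  then have "frob_coeff \<beta> (multiplicity 2 ?d) \<noteq> 0" by (intro frob_coeff_nonzero) simp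
  then show ?thesis by (simp add: special_fun_def dist_kernel_def special_coeff_def)
qed (simp add: special_fun_def dist_kernel_def)

lemma g_mult:
  "gcong \<alpha> Q (g_pol \<alpha> * G_comb Q u)
    (Const (gamma_coeff Q u) * gamma_pol Q + (\<Sum>j<Q. Const (\<Sum>i<Q. special_fun special_coeff j i * u i) * H_pol Q j))"
proof -
  have "(\<Sum>i<Q. special_fun (frob_coeff \<beta>) j i * u i) = (\<Sum>i<Q. special_fun special_coeff j i * u i)" if "j < Q" for j
    by (intro sum.cong refl) (simp add: special_fun_special_coeff[OF that])
  then have "(\<Sum>j<Q. Const (\<Sum>i<Q. special_fun (frob_coeff \<beta>) j i * u i) * H_pol Q j) =
    (\<Sum>j<Q. Const (\<Sum>i<Q. special_fun special_coeff j i * u i) * H_pol Q j)"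
    by (intro sum.cong refl) (simp only: lessThan_iff)
  then show ?thesis using g_mult_G_comb[OF m_ge_2 Q_def \<alpha> frobenius_m, of u] by simp
qed

lemma X_sp_cases:
  assumes "x \<in> X_sp Q"
  obtains u where "x = W0_sp Q +>\<^bsub>O_ring Q\<^esub> cls Q (G_comb Q u)"
  using assms lspan_G[of Q] Q_ge_2 unfolding X_sp_def by auto

lemma maps_X_into:
  "(\<lambda>u. (mult_g \<alpha> Q u, mult_v Q u)) \<in> X_sp Q \<rightarrow> Y_sp \<alpha> Q \<times> O_graded Q (12 * Q - 3)"
proof
  fix x assume "x \<in> X_sp Q"
  then obtain u where x: "x = W0_sp Q +>\<^bsub>O_ring Q\<^esub> cls Q (G_comb Q u)" by (rule X_sp_cases)
  let ?y = "Const (gamma_coeff Q u) * gamma_pol Q + (\<Sum>j<Q. Const (\<Sum>i<Q. special_fun special_coeff j i * u i) * H_pol Q j)"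
  have "mult_g \<alpha> Q x = gW0 \<alpha> Q +>\<^bsub>O_ring Q\<^esub> cls Q ?y"
    unfolding x mult_g_coset gW0_coset_eq_iff by (rule g_mult)
  moreover have "H_pol Q j \<in> {H_pol Q i | i. i \<le> Q - 1}" if "j < Q" for j
    using that by (intro CollectI exI[of _ j]) simp
  then have "?y \<in> lspan ({H_pol Q i | i. i \<le> Q - 1} \<union> {gamma_pol Q})"
    unfolding lspan_def by (intro pol_vs.span_add pol_vs.span_sum pol_vs.span_scale pol_vs.span_base) auto
  ultimately have "mult_g \<alpha> Q x \<in> Y_sp \<alpha> Q" unfolding Y_sp_def by blast
  moreover have "homogeneous (12 * Q - 3) (v_pol Q * G_comb Q u)"
  proof -
    have "6 * Q + 2 + (6 * Q - 5) = 12 * Q - 3" using Q_ge_2 by simp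
    then show ?thesis using homogeneous_mult[OF homogeneous_v[of Q] homogeneous_G_comb[of Q u]] by (simp only:)
  qed
  then have "mult_v Q x \<in> O_graded Q (12 * Q - 3)"
    unfolding x mult_v_coset[OF n_pos Q_def] O_graded_def by blast
  ultimately show "(mult_g \<alpha> Q x, mult_v Q x) \<in> Y_sp \<alpha> Q \<times> O_graded Q (12 * Q - 3)" by blast
qed

lemma inj_on_X: "inj_on (\<lambda>u. (mult_g \<alpha> Q u, mult_v Q u)) (X_sp Q)"
proof (rule inj_onI)
  fix x x' assume xx: "x \<in> X_sp Q" "x' \<in> X_sp Q" and "(mult_g \<alpha> Q x, mult_v Q x) = (mult_g \<alpha> Q x', mult_v Q x')"
  then have eq: "mult_g \<alpha> Q x = mult_g \<alpha> Q x'" "mult_v Q x = mult_v Q x'" by simp_all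
  obtain u u' where u: "x = W0_sp Q +>\<^bsub>O_ring Q\<^esub> cls Q (G_comb Q u)" "x' = W0_sp Q +>\<^bsub>O_ring Q\<^esub> cls Q (G_comb Q u')"
    using X_sp_cases[OF xx(1)] X_sp_cases[OF xx(2)] by metis
  define d where "d = (\<lambda>i. u i - u' i)"
  have d: "G_comb Q d = G_comb Q u - G_comb Q u'" by (simp add: d_def G_comb_diff)
  have "gcong \<alpha> Q (g_pol \<alpha> * G_comb Q u) (g_pol \<alpha> * G_comb Q u')"
    using eq(1) unfolding u mult_g_coset gW0_coset_eq_iff .
  then have g0: "gcong \<alpha> Q (g_pol \<alpha> * G_comb Q d) 0" unfolding gcong_def d by (simp add: right_diff_distrib)
  \<comment> \<open>Independence yields that the matrix kills \<open>d\<close> and that the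
    coefficient of gamma is 0. Multiplication by v supplies the row B, and adding the coefficient of
    gamma to it gives the row C.\<close>
  note ind = H_gamma_independent[OF Q_ge_2 Q_not_dvd gcong_trans[OF gcong_sym[OF g_mult] g0]]
  have "v_pol Q * G_comb Q d \<in> small_zero Q"
    using eq(2) unfolding u mult_v_coset[OF n_pos Q_def] cls_eq_iff d by (simp add: right_diff_distrib)
  then have B: "sum d (residue_block Q (2 * Q + 2)) = 0"
    unfolding v_mult_small_iff[OF homogeneous_G_comb Q_ge_2] cf_G_comb_top[OF n_pos Q_def] .
  have "residue_block Q (2 * Q + 2) \<subseteq> {..<Q}" by (auto simp: residue_block_def)
  then have "sum d {..<Q} = sum d ({..<Q} - residue_block Q (2 * Q + 2)) + sum d (residue_block Q (2 * Q + 2))"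
    by (intro sum.subset_diff) simp_all
  then have C: "sum d {..<Q} = 0" using B ind(1) by (simp add: gamma_coeff_def)
  have "d i = 0" if "i < Q" for i
    using special_fun_kernel_zero[OF two_L n_pos Q_def special_coeff_nonzero _ B C that] ind(2) by blast
  then have "G_comb Q d = 0" unfolding G_comb_def by simp
  then show "x = x'" using d u by simp
qed

text \<open>The kernel vector gives p with gp = gw_0 in O for some w_0 in W_0. If v were gh, then v
  would kill p - w_0, because g does; as v also kills w_0, it would kill p, but the row B does not
  vanish on the vector.\<close>

lemma v_notin_gO:
  "cls Q (v_pol Q) \<notin> (\<lambda>w. cls Q (g_pol \<alpha>) \<otimes>\<^bsub>O_ring Q\<^esub> w) ` carrier (O_ring Q)"
proof
  assume "cls Q (v_pol Q) \<in> (\<lambda>w. cls Q (g_pol \<alpha>) \<otimes>\<^bsub>O_ring Q\<^esub> w) ` carrier (O_ring Q)"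
  then obtain h where "cls Q (v_pol Q) = cls Q (g_pol \<alpha> * h)"
    unfolding O_ring_carrier by (auto simp: cls_mult)
  then have vg: "v_pol Q - g_pol \<alpha> * h \<in> small_zero Q" unfolding cls_eq_iff .
  obtain w where w: "\<forall>i<Q. (\<Sum>j<Q. special_fun special_coeff i j * w j) = 0"
    "sum w (residue_block Q (2 * Q + 2)) = 1" "\<forall>i. i \<notin> residue_block Q (2 * Q + 2) \<longrightarrow> w i = 0"
    using special_fun_kernel_vector[OF two_L n_pos Q_def special_coeff_nonzero] by blast
  let ?p = "G_comb Q w"
  have "gamma_coeff Q w = 0" unfolding gamma_coeff_def using w(3) by (intro sum.neutral) simp
  moreover have "(\<Sum>j<Q. Const (\<Sum>i<Q. special_fun special_coeff j i * w i) * H_pol Q j) = 0"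
    using w(1) by (intro sum.neutral) simp
  ultimately have "gcong \<alpha> Q (g_pol \<alpha> * ?p) 0" using g_mult[of w] by simp
  then obtain w0 where w0: "w0 \<in> W0_set Q" "g_pol \<alpha> * ?p - g_pol \<alpha> * w0 \<in> small_zero Q"
    unfolding gcong_def by auto
  have "v_pol Q * ?p = (?p - w0) * (v_pol Q - g_pol \<alpha> * h) + h * (g_pol \<alpha> * ?p - g_pol \<alpha> * w0) + v_pol Q * w0"
    by (simp add: algebra_simps)
  moreover have "\<dots> \<in> small_zero Q"
    by (intro small_zero_add small_zero_mult[OF vg] small_zero_mult[OF w0(2)] v_mult_W0[OF n_pos Q_def w0(1)])
  ultimately have "v_pol Q * ?p \<in> small_zero Q" by simp
  then have "sum w (residue_block Q (2 * Q + 2)) = 0"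
    unfolding v_mult_small_iff[OF homogeneous_G_comb Q_ge_2] cf_G_comb_top[OF n_pos Q_def] .
  then show False using w(2) by simp
qed

lemma v_eq_f_power: "(xx * yy) * f_pol ^ Q = v_pol Q"
  by (simp add: f_pol_def v_pol_def power_mult_distrib flip: power_mult)

lemma f_power_notin_ideal:
  "(xx * yy) * f_pol ^ Q \<notin> genideal LXYZ {xx ^ (4 * Q), yy ^ (4 * Q), zz ^ (4 * Q), g_pol \<alpha>}"
proof
  assume v: "(xx * yy) * f_pol ^ Q \<in> genideal LXYZ {xx ^ (4 * Q), yy ^ (4 * Q), zz ^ (4 * Q), g_pol \<alpha>}"
  \<comment> \<open>The preimage of gO in the polynomial ring, an ideal that contains all four
    generators.\<close>
  let ?J = "{p. \<exists>h. p - g_pol \<alpha> * h \<in> small_zero Q}"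
  have "ideal ?J LXYZ"
  proof (rule LXYZ_idealI)
    show "0 \<in> ?J" by (intro CollectI exI[of _ 0]) simp
    show "p + q \<in> ?J" if pq: "p \<in> ?J" "q \<in> ?J" for p q
    proof -
      obtain h k where "p - g_pol \<alpha> * h \<in> small_zero Q" "q - g_pol \<alpha> * k \<in> small_zero Q" using pq by blast
      moreover have "p + q - g_pol \<alpha> * (h + k) = (p - g_pol \<alpha> * h) + (q - g_pol \<alpha> * k)"
        by (simp add: algebra_simps)
      ultimately show ?thesis by (intro CollectI exI[of _ "h + k"]) (simp only: small_zero_add)
    qed
    show "r * p \<in> ?J" if p: "p \<in> ?J" for p r
    proof -
      obtain h where "p - g_pol \<alpha> * h \<in> small_zero Q" using p by blast
      moreover have "r * p - g_pol \<alpha> * (r * h) = r * (p - g_pol \<alpha> * h)" by (simp add: algebra_simps)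
      ultimately show ?thesis by (intro CollectI exI[of _ "r * h"]) (simp only: small_zero_mult)
    qed
  qed
  moreover have "{xx ^ (4 * Q), yy ^ (4 * Q), zz ^ (4 * Q), g_pol \<alpha>} \<subseteq> ?J"
  proof -
    have "{xx ^ (4 * Q), yy ^ (4 * Q), zz ^ (4 * Q)} \<subseteq> small_zero Q"
      unfolding O_ideal_eq[symmetric] O_ideal_def by (rule LXYZ.genideal_self) simp
    moreover have "small_zero Q \<subseteq> ?J" by (intro subsetI CollectI exI[of _ 0]) simp
    moreover have "g_pol \<alpha> \<in> ?J" by (intro CollectI exI[of _ 1]) simp
    ultimately show ?thesis by blast
  qed
  ultimately have "genideal LXYZ {xx ^ (4 * Q), yy ^ (4 * Q), zz ^ (4 * Q), g_pol \<alpha>} \<subseteq> ?J"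
    by (rule LXYZ.genideal_minimal)
  then obtain h where "v_pol Q - g_pol \<alpha> * h \<in> small_zero Q" using v unfolding v_eq_f_power by blast
  then have "cls Q (v_pol Q) = cls Q (g_pol \<alpha>) \<otimes>\<^bsub>O_ring Q\<^esub> cls Q h" unfolding cls_mult cls_eq_iff .
  then show False using v_notin_gO unfolding O_ring_carrier by blast
qed

end

theorem theorem3p25:
  shows
    "(CHAR('f::field) = 2 \<longrightarrow>
       (\<forall>Q (M :: 'f mat). Q \<ge> 2 \<and> (\<exists>n. Q = 2 ^ n) \<and> special_matrix Q M \<longrightarrow>
          vec_space.rank (Q + 2) (M @\<^sub>r row_B Q @\<^sub>r row_C Q) = Q))
     \<and>
     (\<forall>(\<alpha> :: L) \<beta> m Q.
        \<alpha> \<noteq> 0 \<and> \<alpha> = \<beta>\<^sup>2 + \<beta> \<and> m = deg_Z2 \<beta> \<and> Q = 2 ^ (m - 1) \<longrightarrow>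
          (\<lambda>u. (mult_g \<alpha> Q u, mult_v Q u)) \<in> X_sp Q \<rightarrow> Y_sp \<alpha> Q \<times> O_graded Q (12 * Q - 3) \<and>
          inj_on (\<lambda>u. (mult_g \<alpha> Q u, mult_v Q u)) (X_sp Q) \<and>
          cls Q (v_pol Q) \<notin> (\<lambda>w. cls Q (g_pol \<alpha>) \<otimes>\<^bsub>O_ring Q\<^esub> w) ` carrier (O_ring Q) \<and>
          (xx * yy) * f_pol ^ Q \<notin> genideal LXYZ {xx ^ (4 * Q), yy ^ (4 * Q), zz ^ (4 * Q), g_pol \<alpha>})"
proof (intro conjI impI allI)
  fix Q and M :: "'f mat"
  assume "CHAR('f) = 2" "Q \<ge> 2 \<and> (\<exists>n. Q = 2 ^ n) \<and> special_matrix Q M"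
  then show "vec_space.rank (Q + 2) (M @\<^sub>r row_B Q @\<^sub>r row_C Q) = Q"
    using special_matrix_rank by blast
next
  fix \<alpha> \<beta> :: L and m Q :: nat
  assume "\<alpha> \<noteq> 0 \<and> \<alpha> = \<beta>\<^sup>2 + \<beta> \<and> m = deg_Z2 \<beta> \<and> Q = 2 ^ (m - 1)"
  then interpret alpha_data \<alpha> \<beta> m Q
    by unfold_locales blast+
  show "(\<lambda>u. (mult_g \<alpha> Q u, mult_v Q u)) \<in> X_sp Q \<rightarrow> Y_sp \<alpha> Q \<times> O_graded Q (12 * Q - 3)"
    by (rule maps_X_into)
  show "inj_on (\<lambda>u. (mult_g \<alpha> Q u, mult_v Q u)) (X_sp Q)"
    by (rule inj_on_X)
  show "cls Q (v_pol Q) \<notin> (\<lambda>w. cls Q (g_pol \<alpha>) \<otimes>\<^bsub>O_ring Q\<^esub> w) ` carrier (O_ring Q)"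
    by (rule v_notin_gO)
  show "(xx * yy) * f_pol ^ Q \<notin> genideal LXYZ {xx ^ (4 * Q), yy ^ (4 * Q), zz ^ (4 * Q), g_pol \<alpha>}"
    by (rule f_power_notin_ideal)
qed

end
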